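(* There is an absolute constant $A>0$ such that the following holds. Let $n\ge 1$, $p\ge n$, $p\ge 2$. For every real $n\times p$ matrix $X$, every $0<q\le 1$ and every $\sigma\ge 0$, there exists a projected nearest neighbor estimator $M=H_P$ for the set $K=X\ell_q=\{X\theta:\theta\in\mathbb{R}^p,\ \|\theta\|_q\le 1\}$ (with respect to some linear subspace $P\subseteq\mathbb{R}^n$) such that $$R_M(X\ell_q,\sigma)\ \le\ A\, c_q\,(\log p)^{1-q/2}\, R^\ast(X\ell_q,\sigma),\qquad c_q=2^{1/q}\,\frac1q\,\ln\frac2q .$$
   Context: Notation. For $x\in\mathbb{R}^p$ and $q>0$, $\|x\|_q=(\sum_i|x_i|^q)^{1/q}$; $\|\cdot\|=\|\cdot\|_2$; $\ell_q=\{\theta\in\mathbb{R}^p:\|\theta\|_q\le1\}$. Risk. An estimator is a (measurable) map $M:\mathbb{R}^n\to\mathbb{R}^n$. For $y\in\mathbb{R}^n$ let $\mathrm{err}_M(y,\sigma)=\mathbb{E}\,\|M(y+g)-y\|^2$, where $g$ is an $n$-dimensional centered Gaussian vector with covariance $\sigma^2I$. For $K\subseteq\mathbb{R}^n$, $R_M(K,\sigma)=\sup_{y\in K}\mathrm{err}_M(y,\sigma)$ is the risk of $M$ over $K$, and $R^\ast(K,\sigma)=\inf_M R_M(K,\sigma)$ (infimum over all estimators) is the minimax risk. Projected nearest neighbor estimator. For a compact set $S$, $N_S(z)$ denotes a nearest point of $S$ to $z$ in Euclidean distance (a minimizer of $\|\widehat y-z\|$ over $\widehat y\in S$). For a linear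 subspace $P\subseteq\mathbb{R}^n$ of any dimension $0\le k\le n$, also write $P$ for the orthogonal projection onto it and $P^\perp$ for the orthogonal projection onto its orthogonal complement. The projected nearest neighbor estimator for $K$ with respect to $P$ is $$H_P(\widetilde y)=P\widetilde y+N_{P^\perp K}(P^\perp\widetilde y).$$ *)

theory Defs
  imports "HOL-Probability.Probability"
begin

text \<open>
  The dimensions are quantified inside the statement, after the absolute constant, so they
  cannot be types: a vector of dimension \<open>n\<close> is a function \<open>nat \<Rightarrow> real\<close> that is
  \<open>undefined\<close> outside \<open>{..<n}\<close>, i.e. a point of the product space
  \<open>Pi\<^sub>M {..<n} (\<lambda>_. borel)\<close>, and a matrix is a function of type \<open>nat \<Rightarrow> nat \<Rightarrow> real\<close> of
  which only the entries with row \<open>< n\<close> and column \<open>< p\<close> matter.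
\<close>

definition Rn :: "nat \<Rightarrow> (nat \<Rightarrow> real) set" where
  "Rn n = {..<n} \<rightarrow>\<^sub>E UNIV"

abbreviation borel_Rn :: "nat \<Rightarrow> (nat \<Rightarrow> real) measure" where
  "borel_Rn n \<equiv> Pi\<^sub>M {..<n} (\<lambda>_. borel)"

lemma space_borel_Rn: "space (borel_Rn n) = Rn n"
  by (simp add: space_PiM Rn_def)

definition vzero :: "nat \<Rightarrow> nat \<Rightarrow> real" where
  "vzero n = (\<lambda>i\<in>{..<n}. 0)"

definition vadd :: "nat \<Rightarrow> (nat \<Rightarrow> real) \<Rightarrow> (nat \<Rightarrow> real) \<Rightarrow> nat \<Rightarrow> real" where
  "vadd n x y = (\<lambda>i\<in>{..<n}. x i + y i)"

definition vsub :: "nat \<Rightarrow> (nat \<Rightarrow> real) \<Rightarrow> (nat \<Rightarrow> real) \<Rightarrow> nat \<Rightarrow> real" where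
  "vsub n x y = (\<lambda>i\<in>{..<n}. x i - y i)"

definition vscale :: "nat \<Rightarrow> real \<Rightarrow> (nat \<Rightarrow> real) \<Rightarrow> nat \<Rightarrow> real" where
  "vscale n c x = (\<lambda>i\<in>{..<n}. c * x i)"

definition vinner :: "nat \<Rightarrow> (nat \<Rightarrow> real) \<Rightarrow> (nat \<Rightarrow> real) \<Rightarrow> real" where
  "vinner n x y = (\<Sum>i<n. x i * y i)"

definition vnorm :: "nat \<Rightarrow> (nat \<Rightarrow> real) \<Rightarrow> real" where
  "vnorm n x = L2_set x {..<n}"

definition mat_vec :: "nat \<Rightarrow> nat \<Rightarrow> (nat \<Rightarrow> nat \<Rightarrow> real) \<Rightarrow> (nat \<Rightarrow> real) \<Rightarrow> nat \<Rightarrow> real" where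
  "mat_vec n p X \<theta> = (\<lambda>i\<in>{..<n}. \<Sum>j<p. X i j * \<theta> j)"

definition lq_norm :: "nat \<Rightarrow> real \<Rightarrow> (nat \<Rightarrow> real) \<Rightarrow> real" where
  "lq_norm p q \<theta> = (\<Sum>i<p. \<bar>\<theta> i\<bar> powr q) powr (1 / q)"

definition lq_ball :: "nat \<Rightarrow> real \<Rightarrow> (nat \<Rightarrow> real) set" where
  "lq_ball p q = {\<theta> \<in> Rn p. lq_norm p q \<theta> \<le> 1}"

text \<open>
  The noise has independent coordinates of law \<open>N(0, \<sigma>\<^sup>2)\<close>. Each is written as \<open>\<sigma>\<close> times a
  standard normal variable because \<open>normal_density 0 0\<close> is the zero function, whereas
  \<open>\<sigma> = 0\<close> must give the point mass at the origin.
\<close>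

definition gaussian :: "nat \<Rightarrow> real \<Rightarrow> (nat \<Rightarrow> real) measure" where
  "gaussian n \<sigma> = Pi\<^sub>M {..<n} (\<lambda>_. distr std_normal_distribution borel (\<lambda>x. \<sigma> * x))"

definition estimators :: "nat \<Rightarrow> ((nat \<Rightarrow> real) \<Rightarrow> nat \<Rightarrow> real) set" where
  "estimators n = borel_Rn n \<rightarrow>\<^sub>M borel_Rn n"

text \<open>Errors and risks are extended nonnegative reals, since they may be infinite.\<close>

definition err :: "nat \<Rightarrow> ((nat \<Rightarrow> real) \<Rightarrow> nat \<Rightarrow> real) \<Rightarrow> (nat \<Rightarrow> real) \<Rightarrow> real \<Rightarrow> ennreal" where
  "err n M y \<sigma> = (\<integral>\<^sup>+ g. ennreal ((vnorm n (vsub n (M (vadd n y g)) y))\<^sup>2) \<partial>gaussian n \<sigma>)"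

definition risk :: "nat \<Rightarrow> ((nat \<Rightarrow> real) \<Rightarrow> nat \<Rightarrow> real) \<Rightarrow> (nat \<Rightarrow> real) set \<Rightarrow> real \<Rightarrow> ennreal" where
  "risk n M K \<sigma> = (SUP y\<in>K. err n M y \<sigma>)"

definition minimax_risk :: "nat \<Rightarrow> (nat \<Rightarrow> real) set \<Rightarrow> real \<Rightarrow> ennreal" where
  "minimax_risk n K \<sigma> = (INF M\<in>estimators n. risk n M K \<sigma>)"

definition linear_subspace :: "nat \<Rightarrow> (nat \<Rightarrow> real) set \<Rightarrow> bool" where
  "linear_subspace n P \<longleftrightarrow>
     P \<subseteq> Rn n \<and> vzero n \<in> P \<and>
     (\<forall>x\<in>P. \<forall>y\<in>P. vadd n x y \<in> P) \<and> (\<forall>c. \<forall>x\<in>P. vscale n c x \<in> P)"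

definition orth_compl :: "nat \<Rightarrow> (nat \<Rightarrow> real) set \<Rightarrow> (nat \<Rightarrow> real) set" where
  "orth_compl n P = {v \<in> Rn n. \<forall>u\<in>P. vinner n u v = 0}"

definition orth_proj :: "nat \<Rightarrow> (nat \<Rightarrow> real) set \<Rightarrow> (nat \<Rightarrow> real) \<Rightarrow> nat \<Rightarrow> real" where
  "orth_proj n P x = (THE u. u \<in> P \<and> vsub n x u \<in> orth_compl n P)"

definition nearest_point :: "nat \<Rightarrow> (nat \<Rightarrow> real) set \<Rightarrow> (nat \<Rightarrow> real) \<Rightarrow> (nat \<Rightarrow> real) \<Rightarrow> bool" where
  "nearest_point n S z w \<longleftrightarrow> is_arg_min (\<lambda>u. vnorm n (vsub n u z)) (\<lambda>u. u \<in> S) w"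

text \<open>
  Nearest points need not be unique (\<open>K\<close> is not convex in general), so this is a predicate:
  \<open>N\<close> is some choice of a nearest point of \<open>P\<^sup>\<bottom> K\<close> for every \<open>z\<close>, for which the resulting
  map is measurable.
\<close>

definition projected_nn_estimator ::
  "nat \<Rightarrow> (nat \<Rightarrow> real) set \<Rightarrow> (nat \<Rightarrow> real) set \<Rightarrow> ((nat \<Rightarrow> real) \<Rightarrow> nat \<Rightarrow> real) \<Rightarrow> bool" where
  "projected_nn_estimator n K P M \<longleftrightarrow>
     M \<in> estimators n \<and>
     (\<exists>N. (\<forall>z\<in>Rn n. nearest_point n (orth_proj n (orth_compl n P) ` K) z (N z)) \<and>
          (\<forall>y\<in>Rn n. M y = vadd n (orth_proj n P y) (N (orth_proj n (orth_compl n P) y))))"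

definition c_const :: "real \<Rightarrow> real" where
  "c_const q = 2 powr (1 / q) * (1 / q) * ln (2 / q)"

end

theory Submission
  imports Defs
begin

text \<open>
  Let \<open>k\<close> be maximal such that some \<open>k\<close> columns of \<open>X\<close> all have distance at least \<open>k powr (1/q) \<sigma>\<close>
  from the span of the others. Taking \<open>k + 1\<close> columns of maximal volume, one of them is close to the
  span \<open>P\<close> of the remaining \<open>k\<close>, and by maximality every column of \<open>X\<close> is then at least as close.

  Upper bound: with this \<open>P\<close>, projection costs \<open>k \<sigma>\<^sup>2\<close>. The error \<open>u\<close> of the nearest neighbour step
  satisfies \<open>\<parallel>u\<parallel>\<^sup>2 \<le> 2 \<langle>u, g\<rangle>\<close> and is a combination of short columns with small \<open>\<ell>\<^sub>q\<close> norm. Unbiased random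
  rounding replaces it by an integer combination; the integer combinations are controlled all at
  once by an exponential moment, each with a weight that decays in \<open>\<Sum> \<bar>z j\<bar> powr q\<close>.

  Lower bound: the dual basis of the \<open>k\<close> columns consists of short vectors. Testing the van Trees
  inequality against the combination of scores with coefficients from the dual basis bounds the minimax
  risk below by a multiple of \<open>k \<sigma>\<^sup>2\<close>, without any assumption on the singular values of the columns.
\<close>

section \<open>Residuals of orthogonal projections\<close>

text \<open>The threshold \<open>k powr (1/q) * \<sigma>\<close> makes both bounds linear in
  \<open>k\<close>. A box of half-width \<open>k powr (-1/q)\<close> in \<open>k\<close> coordinates
  fits into the lq ball; after this scaling each chosen column still sticks out of the span of the
  others by \<sigma>, so every direction is as uncertain as the noise. Conversely, if all columns
  are within \<open>L * \<sigma>\<close> of \<open>P\<close>, the nearest neighbour bound involves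
  \<open>L\<close> only through \<open>L powr q\<close>, which is \<open>k + 1\<close> here.

  In the lower bound only traces occur: for columns \<open>c j\<close> with dual vectors
  \<open>y j\<close>, the noise contributes the sum over \<open>l\<close> of
  \<open>vinner n (y j) (y l) * vinner n (c j) (c l)\<close>, which is 1, and the prior contributes
  \<open>vinner n (y j) (y j)\<close>. Hence the length of each dual vector suffices and no operator
  norm appears.

  For \<open>k = 0\<close> the additive terms of order \<open>\<sigma>\<^sup>2\<close> in the upper
  bound cannot be absorbed. All columns then have length at most \<sigma>, and the size of
  \<open>K\<close> is compared with the lower bound from the longest single column.\<close>

lemma Rn_vadd [simp]: "vadd n x y \<in> Rn n"
  and Rn_vsub [simp]: "vsub n x y \<in> Rn n"
  and Rn_vscale [simp]: "vscale n c x \<in> Rn n"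
  and Rn_vzero [simp]: "vzero n \<in> Rn n"
  and Rn_mat_vec [simp]: "mat_vec n p X \<theta> \<in> Rn n"
  by (auto simp: Rn_def vadd_def vsub_def vscale_def vzero_def mat_vec_def)

lemma Rn_eqI: "x \<in> Rn n \<Longrightarrow> y \<in> Rn n \<Longrightarrow> (\<And>i. i < n \<Longrightarrow> x i = y i) \<Longrightarrow> x = y"
  unfolding Rn_def by (rule PiE_ext) auto

lemma vinner_linear [simp]:
  "vinner n (vadd n x y) z = vinner n x z + vinner n y z"
  "vinner n (vsub n x y) z = vinner n x z - vinner n y z"
  "vinner n (vscale n c x) z = c * vinner n x z"
  "vinner n (vzero n) z = 0"
  "vinner n z (vadd n x y) = vinner n z x + vinner n z y"
  "vinner n z (vsub n x y) = vinner n z x - vinner n z y"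
  "vinner n z (vscale n c x) = c * vinner n z x"
  "vinner n z (vzero n) = 0"
  by (simp_all add: vinner_def vadd_def vsub_def vscale_def vzero_def
      algebra_simps sum.distrib sum_subtractf sum_distrib_left)

lemma vinner_commute: "vinner n x y = vinner n y x"
  by (simp add: vinner_def mult.commute)

lemma vnorm_power2: "(vnorm n x)\<^sup>2 = vinner n x x"
  by (simp add: vnorm_def L2_set_def vinner_def sum_nonneg power2_eq_square)

lemma vnorm_nonneg [simp]: "0 \<le> vnorm n x"
  by (simp add: vnorm_def)

lemma vinner_self_nonneg [simp]: "0 \<le> vinner n x x"
  by (simp add: vinner_def sum_nonneg)

lemma vinner_self_eq_0: "vinner n x x = 0 \<longleftrightarrow> (\<forall>i<n. x i = 0)"
  by (auto simp: vinner_def sum_nonneg_eq_0_iff)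

lemma vinner_zeroD: "vinner n x x = 0 \<Longrightarrow> vinner n x y = 0"
  unfolding vinner_self_eq_0 by (simp add: vinner_def)

lemma vinner_Cauchy_Schwarz: "(vinner n x y)\<^sup>2 \<le> vinner n x x * vinner n y y"
proof -
  have "\<bar>vinner n x y\<bar> \<le> vnorm n x * vnorm n y"
    unfolding vinner_def vnorm_def
    by (rule order_trans[OF sum_abs]) (simp add: abs_mult L2_set_mult_ineq)
  then have "\<bar>vinner n x y\<bar>\<^sup>2 \<le> (vnorm n x * vnorm n y)\<^sup>2"
    by (rule power_mono) simp
  then show ?thesis by (simp add: power_mult_distrib vnorm_power2)
qed

lemma vinner_mat_vec:
  "vinner n (mat_vec n p X \<theta>) z = (\<Sum>j<p. \<theta> j * vinner n (\<lambda>i. X i j) z)"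
  by (simp add: vinner_def mat_vec_def sum_distrib_left sum_distrib_right mult_ac)
    (subst sum.swap, simp add: mult_ac)

text \<open>Only coordinates below \<open>n\<close> are compared, so columns
  \<open>\<lambda>i. X i j\<close> can be list entries although they need not lie in
  \<open>Rn n\<close>. Coefficients are indexed by vectors, so a repeated entry counts once.\<close>

definition vspan :: "nat \<Rightarrow> (nat \<Rightarrow> real) list \<Rightarrow> (nat \<Rightarrow> real) set" where
  "vspan n xs = {v. \<exists>a. \<forall>i<n. v i = (\<Sum>x\<in>set xs. a x * x i)}"

lemma vspan_vzero: "vzero n \<in> vspan n xs"
  unfolding vspan_def by (auto intro!: exI[of _ "\<lambda>_. 0"] simp: vzero_def)

lemma vspan_vadd: "u \<in> vspan n xs \<Longrightarrow> v \<in> vspan n xs \<Longrightarrow> vadd n u v \<in> vspan n xs"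
  unfolding vspan_def
proof safe
  fix a b assume "\<forall>i<n. u i = (\<Sum>x\<in>set xs. a x * x i)" "\<forall>i<n. v i = (\<Sum>x\<in>set xs. b x * x i)"
  then show "\<exists>a. \<forall>i<n. vadd n u v i = (\<Sum>x\<in>set xs. a x * x i)"
    by (intro exI[of _ "\<lambda>x. a x + b x"]) (auto simp: vadd_def algebra_simps sum.distrib)
qed

lemma vspan_vscale: "u \<in> vspan n xs \<Longrightarrow> vscale n c u \<in> vspan n xs"
  unfolding vspan_def
proof safe
  fix a assume "\<forall>i<n. u i = (\<Sum>x\<in>set xs. a x * x i)"
  then show "\<exists>a. \<forall>i<n. vscale n c u i = (\<Sum>x\<in>set xs. a x * x i)"
    by (intro exI[of _ "\<lambda>x. c * a x"]) (auto simp: vscale_def algebra_simps sum_distrib_left)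
qed

lemma vspan_vsub: "u \<in> vspan n xs \<Longrightarrow> v \<in> vspan n xs \<Longrightarrow> vsub n u v \<in> vspan n xs"
proof -
  assume "u \<in> vspan n xs" "v \<in> vspan n xs"
  then have "vadd n u (vscale n (-1) v) \<in> vspan n xs" by (intro vspan_vadd vspan_vscale)
  also have "vadd n u (vscale n (-1) v) = vsub n u v"
    by (auto simp: vadd_def vscale_def vsub_def)
  finally show ?thesis .
qed

lemma vspan_member: assumes "x \<in> set xs" shows "x \<in> vspan n xs"
proof -
  have "x i = (\<Sum>y\<in>set xs. (if y = x then 1 else 0) * y i)" for i
    using assms by (simp add: if_distrib[of "\<lambda>a. a * _"] sum.delta cong: if_cong)
  then show ?thesis unfolding vspan_def by (intro CollectI exI[of _ "\<lambda>y. if y = x then 1 else 0"]) simp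
qed

lemma vspan_orthogonal:
  assumes "v \<in> vspan n xs" "\<And>x. x \<in> set xs \<Longrightarrow> vinner n z x = 0"
  shows "vinner n z v = 0"
proof -
  obtain a where a: "\<And>i. i < n \<Longrightarrow> v i = (\<Sum>x\<in>set xs. a x * x i)"
    using assms(1) by (auto simp: vspan_def)
  have "vinner n z v = (\<Sum>x\<in>set xs. a x * vinner n z x)"
    by (simp add: vinner_def a sum_distrib_left mult_ac) (subst sum.swap, simp add: mult_ac)
  then show ?thesis using assms(2) by simp
qed

lemma vspan_mono: assumes "set xs \<subseteq> set ys" shows "vspan n xs \<subseteq> vspan n ys"
proof
  fix v assume "v \<in> vspan n xs"
  then obtain a where a: "\<And>i. i < n \<Longrightarrow> v i = (\<Sum>x\<in>set xs. a x * x i)"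
    by (auto simp: vspan_def)
  have "(\<Sum>x\<in>set xs. a x * x i) = (\<Sum>x\<in>set ys. (if x \<in> set xs then a x else 0) * x i)" for i
    by (rule sum.mono_neutral_cong_left) (use assms in auto)
  then show "v \<in> vspan n ys" unfolding vspan_def
    by (auto simp: a intro!: exI[of _ "\<lambda>x. if x \<in> set xs then a x else 0"])
qed

text \<open>Gram-Schmidt: the component of \<open>x\<close> orthogonal to the span of the list. If
  \<open>y\<close> depends on \<open>ys\<close>, the quotient is \<open>0 / 0 = 0\<close> and
  \<open>y\<close> is skipped, so dependent lists are allowed.\<close>

fun residual :: "nat \<Rightarrow> (nat \<Rightarrow> real) list \<Rightarrow> (nat \<Rightarrow> real) \<Rightarrow> nat \<Rightarrow> real" where
  "residual n [] x = (\<lambda>i\<in>{..<n}. x i)"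
| "residual n (y # ys) x =
    vsub n (residual n ys x)
      (vscale n (vinner n (residual n ys x) (residual n ys y) /
                 vinner n (residual n ys y) (residual n ys y)) (residual n ys y))"

lemma residual_in_Rn [simp]: "residual n xs x \<in> Rn n"
  by (cases xs) (auto simp: Rn_def vsub_def)

lemma vinner_restrict [simp]:
  "vinner n (\<lambda>i\<in>{..<n}. x i) y = vinner n x y" "vinner n y (\<lambda>i\<in>{..<n}. x i) = vinner n y x"
  by (simp_all add: vinner_def)

section \<open>Characterisation and linearity of residuals\<close>

lemma residual_diff_vspan: "vsub n x (residual n xs x) \<in> vspan n xs"
proof (induction xs arbitrary: x)
  case Nil
  have "vsub n x (residual n [] x) = vzero n" by (auto simp: vsub_def vzero_def)
  then show ?case using vspan_vzero by metis
next
  case (Cons a ys)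
  define a' where "a' = residual n ys a"
  define c where "c = vinner n (residual n ys x) a' / vinner n a' a'"
  have m: "vspan n ys \<subseteq> vspan n (a # ys)" by (rule vspan_mono) auto
  have 1: "vsub n x (residual n ys x) \<in> vspan n (a # ys)" using Cons m by auto
  have "vsub n a a' \<in> vspan n (a # ys)" using Cons m by (auto simp: a'_def)
  then have "vsub n a (vsub n a a') \<in> vspan n (a # ys)"
    by (rule vspan_vsub[OF vspan_member, rotated]) simp
  also have "vsub n a (vsub n a a') = a'"
    by (rule Rn_eqI[where n = n]) (auto simp: a'_def, auto simp: vsub_def)
  finally have "vadd n (vsub n x (residual n ys x)) (vscale n c a') \<in> vspan n (a # ys)"
    using 1 by (intro vspan_vadd vspan_vscale)
  also have "vadd n (vsub n x (residual n ys x)) (vscale n c a') = vsub n x (residual n (a # ys) x)"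
    by (rule Rn_eqI[where n = n]) (auto simp: c_def a'_def, auto simp: vsub_def vadd_def vscale_def)
  finally show ?case .
qed

lemma residual_orthogonal:
  assumes "x \<in> set xs" shows "vinner n (residual n xs z) x = 0"
  using assms
proof (induction xs arbitrary: x z)
  case (Cons a ys)
  define a' where "a' = residual n ys a"
  have inner_a: "vinner n (residual n ys z) a = vinner n (residual n ys z) a'" for z
    using vspan_orthogonal[OF residual_diff_vspan[of n a ys], of "residual n ys z"] Cons.IH
    by (auto simp: a'_def)
  show ?case
  proof (cases "x = a")
    case True
    show ?thesis
    proof (cases "vinner n a' a' = 0")
      case True
      then have "vinner n (residual n ys z) a' = 0" using vinner_zeroD vinner_commute by metis
      then show ?thesis using \<open>x = a\<close> by (simp add: inner_a flip: a'_def)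
    next
      case False
      have "vinner n a' a = vinner n a' a'" using inner_a[of a] by (simp add: a'_def)
      with False show ?thesis using \<open>x = a\<close> by (simp add: inner_a flip: a'_def)
    qed
  next
    case False
    then show ?thesis using Cons by auto
  qed
qed simp

lemma residual_self_adjoint: "vinner n (residual n xs x) y = vinner n x (residual n xs y)"
proof -
  have "vinner n (residual n xs x) y = vinner n (residual n xs x) (residual n xs y)" for x y
    using vspan_orthogonal[OF residual_diff_vspan[of n y xs], of "residual n xs x"]
    by (auto simp: residual_orthogonal)
  then show ?thesis by (metis vinner_commute)
qed

text \<open>Two candidates differ by an element of the span that is orthogonal to the span.
  Independence of the order of the list, idempotence and linearity all reduce to this
  characterisation, without the recursion.\<close>

lemma residual_unique:
  assumes "r \<in> Rn n" "\<And>x. x \<in> set xs \<Longrightarrow> vinner n r x = 0" "vsub n z r \<in> vspan n xs"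
  shows "residual n xs z = r"
proof -
  let ?d = "vsub n (residual n xs z) r"
  have "vsub n (vsub n z r) (vsub n z (residual n xs z)) \<in> vspan n xs"
    by (intro vspan_vsub assms residual_diff_vspan)
  also have "vsub n (vsub n z r) (vsub n z (residual n xs z)) = ?d"
    by (rule Rn_eqI[where n = n]) (auto, auto simp: vsub_def)
  finally have "vinner n ?d ?d = 0"
    by (rule vspan_orthogonal) (simp add: assms residual_orthogonal)
  then show ?thesis
    by (intro Rn_eqI[OF residual_in_Rn assms(1)]) (simp add: vinner_self_eq_0 vsub_def del: vinner_linear)
qed

lemma residual_cong_set: "set xs = set ys \<Longrightarrow> residual n xs = residual n ys"
  using vspan_mono[of ys xs n] residual_diff_vspan[of n _ ys]
  by (intro ext residual_unique residual_in_Rn) (auto simp: residual_orthogonal)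

lemma vsub_self [simp]: "vsub n x x = vzero n"
  by (simp add: vsub_def vzero_def)

lemma residual_idem: "residual n xs (residual n xs x) = residual n xs x"
  by (rule residual_unique) (auto simp: residual_orthogonal vspan_vzero)

lemma residual_member: assumes "x \<in> set xs" shows "residual n xs x = vzero n"
proof (rule residual_unique)
  show "vsub n x (vzero n) \<in> vspan n xs"
    using vspan_member[OF assms, of n] by (auto simp: vspan_def vsub_def vzero_def)
qed auto

lemma residual_linear:
  "residual n xs (vadd n x y) = vadd n (residual n xs x) (residual n xs y)"
  "residual n xs (vsub n x y) = vsub n (residual n xs x) (residual n xs y)"
  "residual n xs (vscale n c x) = vscale n c (residual n xs x)"
proof -
  note r = residual_diff_vspan[of n _ xs]
  have 1: "vadd n (vsub n x (residual n xs x)) (vsub n y (residual n xs y)) =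
    vsub n (vadd n x y) (vadd n (residual n xs x) (residual n xs y))"
    and 2: "vsub n (vsub n x (residual n xs x)) (vsub n y (residual n xs y)) =
    vsub n (vsub n x y) (vsub n (residual n xs x) (residual n xs y))"
    and 3: "vscale n c (vsub n x (residual n xs x)) =
    vsub n (vscale n c x) (vscale n c (residual n xs x))"
    by (auto simp: vadd_def vsub_def vscale_def algebra_simps)
  show "residual n xs (vadd n x y) = vadd n (residual n xs x) (residual n xs y)"
    using vspan_vadd[OF r r, of x y] unfolding 1
    by (intro residual_unique) (auto simp: residual_orthogonal)
  show "residual n xs (vsub n x y) = vsub n (residual n xs x) (residual n xs y)"
    using vspan_vsub[OF r r, of x y] unfolding 2
    by (intro residual_unique) (auto simp: residual_orthogonal)
  show "residual n xs (vscale n c x) = vscale n c (residual n xs x)"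
    using vspan_vscale[OF r, of c x] unfolding 3
    by (intro residual_unique) (auto simp: residual_orthogonal)
qed

lemma residual_mat_vec:
  "residual n xs (mat_vec n p X \<theta>) = mat_vec n p (\<lambda>i j. residual n xs (\<lambda>i. X i j) i) \<theta>"
proof (induction p)
  case 0
  have "mat_vec n 0 X \<theta> = vzero n" for X by (auto simp: mat_vec_def vzero_def)
  then show ?case by (simp add: residual_unique vspan_vzero)
next
  case (Suc p)
  have *: "mat_vec n (Suc p) X \<theta> = vadd n (mat_vec n p X \<theta>) (vscale n (\<theta> p) (\<lambda>i. X i p))" for X
    by (auto simp: mat_vec_def vadd_def vscale_def)
  show ?case unfolding * residual_linear Suc by simp
qed

lemma residual_mono: "vinner n (residual n xs x) (residual n xs x) \<le> vinner n x x"
proof -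
  have "0 \<le> vinner n (vsub n x (residual n xs x)) (vsub n x (residual n xs x))" by (rule vinner_self_nonneg)
  moreover have "vinner n x (residual n xs x) = vinner n (residual n xs x) (residual n xs x)"
    by (simp add: residual_self_adjoint residual_idem)
  ultimately show ?thesis
    using vinner_commute[of n x "residual n xs x"] unfolding vinner_linear by linarith
qed

text \<open>The \<open>es\<close> are the normalised Gram-Schmidt vectors. A dependent entry yields
  the zero vector, whence \<open>vinner n e e \<le> 1\<close> instead of equality. This form lets
  the projected noise be integrated direction by direction.\<close>

lemma residual_complement_norm:
  "\<exists>es. length es \<le> length xs \<and> (\<forall>e\<in>set es. vinner n e e \<le> 1) \<and>
     (\<forall>x. vinner n (vsub n x (residual n xs x)) (vsub n x (residual n xs x)) = (\<Sum>e\<leftarrow>es. (vinner n x e)\<^sup>2))"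
proof (induction xs)
  case Nil
  have "vsub n x (residual n [] x) = vzero n" for x by (auto simp: vsub_def vzero_def)
  then show ?case by (intro exI[of _ "[]"]) (auto simp del: residual.simps)
next
  case (Cons a ys)
  then obtain es where es: "length es \<le> length ys" "\<And>e. e \<in> set es \<Longrightarrow> vinner n e e \<le> 1"
    "\<And>x. vinner n (vsub n x (residual n ys x)) (vsub n x (residual n ys x)) = (\<Sum>e\<leftarrow>es. (vinner n x e)\<^sup>2)"
    by blast
  define a' where "a' = residual n ys a"
  define b where "b = vscale n (1 / sqrt (vinner n a' a')) a'"
  have bb: "vinner n b b \<le> 1"
    by (simp add: b_def)
  have sq: "vinner n (vsub n x (residual n (a # ys) x)) (vsub n x (residual n (a # ys) x)) =
     (\<Sum>e\<leftarrow>es. (vinner n x e)\<^sup>2) + (vinner n x b)\<^sup>2" for x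
  proof -
    define r where "r = residual n ys x"
    define c where "c = vinner n x a' / vinner n a' a'"
    have ra: "vinner n r a' = vinner n x a'"
      by (simp add: r_def a'_def residual_self_adjoint residual_idem)
    have "vsub n x (residual n (a # ys) x) = vadd n (vsub n x r) (vscale n c a')"
      by (rule Rn_eqI[where n = n]) (simp_all add: c_def ra flip: a'_def r_def,
          simp add: vsub_def vadd_def vscale_def)
    moreover have "vinner n (vadd n (vsub n x r) (vscale n c a')) (vadd n (vsub n x r) (vscale n c a')) =
      vinner n (vsub n x r) (vsub n x r) + 2 * c * vinner n (vsub n x r) a' + c\<^sup>2 * vinner n a' a'"
      using vinner_commute[of n a' r] vinner_commute[of n a' x]
      by (simp add: algebra_simps power2_eq_square)
    moreover have "vinner n (vsub n x r) a' = 0" by (simp add: ra)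
    moreover have "c\<^sup>2 * vinner n a' a' = (vinner n x b)\<^sup>2"
      by (simp add: c_def b_def power_divide power2_eq_square)
    ultimately show ?thesis using es(3)[of x] by (simp add: r_def)
  qed
  show ?case
    by (intro exI[of _ "b # es"] conjI allI ballI) (use es(1,2) bb in \<open>auto simp: sq simp del: residual.simps vinner_linear\<close>)
qed

section \<open>Columns of maximal volume\<close>

text \<open>The Gram determinant, that is, the squared volume of the spanned parallelepiped, as a
  product of squared heights.\<close>

fun gram_volume :: "nat \<Rightarrow> (nat \<Rightarrow> real) list \<Rightarrow> real" where
  "gram_volume n [] = 1"
| "gram_volume n (y # ys) = vinner n (residual n ys y) (residual n ys y) * gram_volume n ys"

lemma gram_volume_nonneg: "0 \<le> gram_volume n xs"
  by (induction xs) auto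

text \<open>Over the common base \<open>ys\<close>, both sides contain the 2 by 2 Gram determinant
  of the residuals of \<open>a\<close> and \<open>b\<close>, which is symmetric in them.\<close>

lemma gram_volume_swap: "gram_volume n (a # b # ys) = gram_volume n (b # a # ys)"
proof -
  have *: "vinner n (residual n (b # ys) a) (residual n (b # ys) a) * vinner n (residual n ys b) (residual n ys b) =
    vinner n (residual n ys a) (residual n ys a) * vinner n (residual n ys b) (residual n ys b)
      - (vinner n (residual n ys a) (residual n ys b))\<^sup>2" (is "?l a b = ?r a b") for a b
  proof (cases "vinner n (residual n ys b) (residual n ys b) = 0")
    case True
    then show ?thesis using vinner_zeroD[OF True, of "residual n ys a"]
      by (simp add: vinner_commute[of n "residual n ys a" "residual n ys b"])
  next
    case False
    then show ?thesis
      by (simp add: vinner_commute[of n "residual n ys b" "residual n ys a"] field_simps power2_eq_square)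
  qed
  have "?l a b = ?l b a"
    unfolding * by (simp add: vinner_commute[of n "residual n ys a" "residual n ys b"])
  then show ?thesis by (simp flip: mult.assoc del: residual.simps)
qed

lemma gram_volume_move: "gram_volume n (xs @ a # ys) = gram_volume n (a # xs @ ys)"
proof (induction xs)
  case (Cons x xs)
  have "residual n (xs @ a # ys) = residual n (a # xs @ ys)" by (rule residual_cong_set) auto
  then have "gram_volume n ((x # xs) @ a # ys) = gram_volume n (x # a # xs @ ys)"
    using Cons by (simp del: residual.simps)
  then show ?case using gram_volume_swap by simp
qed simp

text \<open>The distance is to the span of all other columns, not only of those later in the list.
  The positive volume keeps the columns independent even if \<open>D = 0\<close>.\<close>

definition spread_columns :: "nat \<Rightarrow> nat \<Rightarrow> (nat \<Rightarrow> nat \<Rightarrow> real) \<Rightarrow> real \<Rightarrow> nat list \<Rightarrow> bool" where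
  "spread_columns n p c D js \<longleftrightarrow> distinct js \<and> set js \<subseteq> {..<p} \<and> 0 < gram_volume n (map c js) \<and>
     (\<forall>j\<in>set js. let r = residual n (map c (remove1 j js)) (c j) in D\<^sup>2 \<le> vinner n r r)"

lemma gram_volume_remove1:
  assumes "j \<in> set js" "distinct js"
  shows "gram_volume n (map c js) =
    vinner n (residual n (map c (remove1 j js)) (c j)) (residual n (map c (remove1 j js)) (c j))
      * gram_volume n (map c (remove1 j js))"
proof -
  obtain as bs where js: "js = as @ j # bs" "j \<notin> set as"
    using split_list_first[OF assms(1)] by auto
  then have "remove1 j js = as @ bs" by (simp add: remove1_append)
  then show ?thesis using gram_volume_move[of n "map c as" "c j" "map c bs"] js by simp
qed

text \<open>
  If every longer family of columns is dependent, the columns of a longest admissible family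
  span everything; otherwise dropping a column with short residual from a family of maximal volume
  leaves a subspace close to all columns, by exchange.
\<close>

lemma exists_spread_columns:
  fixes \<delta> :: "nat \<Rightarrow> real"
  shows "\<exists>js xs. spread_columns n p c (\<delta> (length js)) js \<and> length xs = length js \<and>
    (\<forall>l<p. vinner n (residual n xs (c l)) (residual n xs (c l)) \<le> (\<delta> (Suc (length js)))\<^sup>2)"
proof -
  define good where "good k \<longleftrightarrow> (\<exists>js. length js = k \<and> spread_columns n p c (\<delta> k) js)" for k
  have le: "length js \<le> p" if "distinct js" "set js \<subseteq> {..<p}" for js
    using card_mono[OF _ that(2)] distinct_card[OF that(1)] by simp
  have "good 0" by (auto simp: good_def spread_columns_def)
  moreover have "\<forall>k. good k \<longrightarrow> k \<le> p" using le by (auto simp: good_def spread_columns_def)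
  ultimately obtain k where k: "good k" "\<And>m. good m \<Longrightarrow> m \<le> k"
    using GreatestI_nat[of good 0 p] Greatest_le_nat[of good _ p] by metis
  obtain js where js: "length js = k" "spread_columns n p c (\<delta> k) js"
    using k(1) by (auto simp: good_def)
  define L where "L = {l. distinct l \<and> set l \<subseteq> {..<p} \<and> length l = Suc k \<and> 0 < gram_volume n (map c l)}"
  have "finite {l. set l \<subseteq> {..<p} \<and> length l = Suc k}" by (rule finite_lists_length_eq) simp
  then have fin: "finite L" by (rule rev_finite_subset) (auto simp: L_def)
  show ?thesis
  proof (cases "L = {}")
    case True
    have "vinner n (residual n (map c js) (c l)) (residual n (map c js) (c l)) = 0" if "l < p" for l
    proof (cases "l \<in> set js")
      case True
      then have "residual n (map c js) (c l) = vzero n" by (intro residual_member) auto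
      then show ?thesis by simp
    next
      case False
      then have "\<not> 0 < gram_volume n (map c (l # js))"
        using js that True Collect_empty_eq[of "\<lambda>l. distinct l \<and> set l \<subseteq> {..<p} \<and> length l = Suc k \<and> 0 < gram_volume n (map c l)"]
        unfolding L_def spread_columns_def by (metis distinct.simps(2) insert_subset length_Cons lessThan_iff list.simps(15))
      then have "gram_volume n (map c (l # js)) = 0"
        using gram_volume_nonneg[of n "map c (l # js)"] by linarith
      then show ?thesis using js by (auto simp: spread_columns_def)
    qed
    then show ?thesis using js by (intro exI[of _ js] exI[of _ "map c js"]) auto
  next
    case False
    let ?v = "\<lambda>l. gram_volume n (map c l)"
    obtain m where m: "m \<in> L" "\<And>l. l \<in> L \<Longrightarrow> ?v l \<le> ?v m"
    proof -
      have "Max (?v ` L) \<in> ?v ` L" using fin False by (intro Max_in) auto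
      then obtain m where "m \<in> L" "?v m = Max (?v ` L)" by auto
      then show ?thesis using that[of m] fin by auto
    qed
    have "\<not> good (Suc k)" using k(2)[of "Suc k"] by auto
    then have "\<not> spread_columns n p c (\<delta> (Suc k)) m" using m(1) by (auto simp: L_def good_def)
    then obtain j where j: "j \<in> set m"
      "vinner n (residual n (map c (remove1 j m)) (c j)) (residual n (map c (remove1 j m)) (c j)) < (\<delta> (Suc k))\<^sup>2"
      using m(1) by (auto simp: L_def spread_columns_def Let_def not_le)
    define xs where "xs = map c (remove1 j m)"
    have dm: "distinct m" "set m \<subseteq> {..<p}" "length m = Suc k" "0 < ?v m" using m(1) by (auto simp: L_def)
    have vm: "?v m = vinner n (residual n xs (c j)) (residual n xs (c j)) * gram_volume n xs"
      unfolding xs_def by (rule gram_volume_remove1) (use j dm in auto)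
    have pos: "0 < gram_volume n xs" using dm(4) gram_volume_nonneg[of n xs] vm
      by (cases "gram_volume n xs = 0") auto
    have "vinner n (residual n xs (c l)) (residual n xs (c l)) \<le> (\<delta> (Suc k))\<^sup>2" if "l < p" for l
    proof (cases "l \<in> set (remove1 j m)")
      case True
      then have "residual n xs (c l) = vzero n" by (intro residual_member) (auto simp: xs_def)
      then show ?thesis by simp
    next
      case False
      have "?v (l # remove1 j m) \<le> ?v m"
      proof (cases "0 < ?v (l # remove1 j m)")
        case True
        have "l # remove1 j m \<in> L"
          using True False dm j(1) that by (auto simp: L_def length_remove1)
        then show ?thesis by (rule m)
      next
        case False
        then show ?thesis using dm(4) by linarith
      qed
      \<comment> \<open>Both families have the base \<open>xs\<close>, so comparing volumes means
        comparing heights over it.\<close>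
      then have "vinner n (residual n xs (c l)) (residual n xs (c l)) * gram_volume n xs
        \<le> vinner n (residual n xs (c j)) (residual n xs (c j)) * gram_volume n xs"
        unfolding vm[symmetric] by (simp add: xs_def)
      then show ?thesis using pos j(2) by (simp add: xs_def)
    qed
    moreover have "length xs = k" using dm j(1) by (simp add: xs_def length_remove1)
    \<comment> \<open>\<open>js\<close> and \<open>xs\<close> may be unrelated families; their
      common length is all that links the lower bound (through \<open>js\<close>) to the subspace
      (through \<open>xs\<close>).\<close>
    ultimately show ?thesis using js by (intro exI[of _ js] exI[of _ xs]) auto
  qed
qed

text \<open>Dividing each residual by its squared length gives biorthogonal vectors of length at
  most \<open>1 / D\<close>. The last conjunct expresses that the Gram matrix of the
  \<open>y j\<close> inverts that of the columns; it supplies the trace identity of the van Trees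
  bound.\<close>

lemma spread_columns_dual_basis:
  assumes "spread_columns n p c D js" "0 < D"
  shows "\<exists>y. (\<forall>i\<in>set js. \<forall>j\<in>set js. vinner n (y i) (c j) = (if i = j then 1 else 0)) \<and>
    (\<forall>j\<in>set js. vinner n (y j) (y j) \<le> 1 / D\<^sup>2) \<and>
    (\<forall>j\<in>set js. \<forall>i<n. y j i = (\<Sum>l\<in>set js. vinner n (y j) (y l) * c l i))"
proof -
  define r where "r j = residual n (map c (remove1 j js)) (c j)" for j
  define y where "y j = vscale n (1 / vinner n (r j) (r j)) (r j)" for j
  have d: "distinct js" and D: "\<And>j. j \<in> set js \<Longrightarrow> D\<^sup>2 \<le> vinner n (r j) (r j)"
    using assms(1) by (auto simp: spread_columns_def Let_def r_def)
  have pos: "0 < vinner n (r j) (r j)" if "j \<in> set js" for j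
    using D[OF that] zero_less_power[OF assms(2), of 2] by linarith
  have rc: "vinner n (r j) (c j) = vinner n (r j) (r j)" for j
    unfolding r_def by (metis residual_idem residual_self_adjoint)
  have y1: "vinner n (y i) (c j) = (if i = j then 1 else 0)" if "i \<in> set js" "j \<in> set js" for i j
    using pos[OF that(1)] that d rc by (auto simp: y_def r_def residual_orthogonal)
  have y2: "vinner n (y j) (y j) \<le> 1 / D\<^sup>2" if "j \<in> set js" for j
    using pos[OF that] D[OF that] assms(2) by (simp add: y_def frac_le)
  \<comment> \<open>Coefficients in \<open>vspan\<close> are indexed by vectors; biorthogonality
    excludes equal columns, so they can be reindexed by \<open>js\<close>.\<close>
  have inj: "inj_on c (set js)" by (rule inj_onI) (metis y1 zero_neq_one)
  have y3: "y j i = (\<Sum>l\<in>set js. vinner n (y j) (y l) * c l i)" if j: "j \<in> set js" and "i < n" for j i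
  proof -
    define s where "s = (\<lambda>i. \<Sum>l\<in>set js. vinner n (y j) (y l) * c l i)"
    have "vspan n (map c (remove1 j js)) \<subseteq> vspan n (map c js)"
      using set_remove1_subset[of j js] by (intro vspan_mono) auto
    then have "vsub n (c j) (r j) \<in> vspan n (map c js)"
      using residual_diff_vspan[of n "c j" "map c (remove1 j js)"] by (auto simp: r_def)
    then have "vsub n (c j) (vsub n (c j) (r j)) \<in> vspan n (map c js)"
      by (rule vspan_vsub[OF vspan_member, rotated]) (simp add: j)
    moreover have "vsub n (c j) (vsub n (c j) (r j)) = r j"
      by (rule Rn_eqI[where n = n]) (auto simp: r_def, auto simp: vsub_def)
    ultimately have "y j \<in> vspan n (map c js)" by (simp add: y_def vspan_vscale)
    moreover have "s \<in> vspan n (map c js)"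
      unfolding vspan_def s_def
      by (intro CollectI exI[of _ "\<lambda>x. vinner n (y j) (y (the_inv_into (set js) c x))"])
        (simp add: sum.reindex[OF inj] the_inv_into_f_f[OF inj])
    \<comment> \<open>Pairing this combination of columns with \<open>y m\<close> extracts its
      coefficient \<open>a m\<close>; since \<open>y j\<close> and \<open>s\<close> pair equally
      with \<open>y m\<close>, every coefficient vanishes.\<close>
    ultimately have "vsub n (y j) s \<in> vspan n (map c js)" by (rule vspan_vsub)
    then obtain a where a: "\<And>i. i < n \<Longrightarrow> y j i - s i = (\<Sum>l\<in>set js. a l * c l i)"
      unfolding vspan_def by (auto simp: sum.reindex[OF inj] vsub_def)
    have lin: "vinner n (\<lambda>i. \<Sum>l\<in>set js. b l * c l i) (y m) = b m" if "m \<in> set js" for b m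
    proof -
      have "vinner n (\<lambda>i. \<Sum>l\<in>set js. b l * c l i) (y m) = (\<Sum>l\<in>set js. b l * vinner n (y m) (c l))"
        by (simp add: vinner_def sum_distrib_left sum_distrib_right mult_ac)
          (subst sum.swap, simp add: mult_ac)
      also have "\<dots> = (\<Sum>l\<in>set js. if l = m then b l else 0)"
        by (intro sum.cong) (auto simp: y1 that)
      finally show ?thesis using that by simp
    qed
    have "a m = 0" if "m \<in> set js" for m
    proof -
      have "vinner n (vsub n (y j) s) (y m) = a m"
        using lin[OF that, of a] a by (simp add: vinner_def vsub_def)
      moreover have "vinner n (vsub n (y j) s) (y m) = 0" using lin[OF that] by (simp add: s_def)
      ultimately show ?thesis by simp
    qed
    then show ?thesis using a[OF \<open>i < n\<close>] by (simp add: s_def)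
  qed
  show ?thesis using y1 y2 y3 by blast
qed

section \<open>Gaussian measures\<close>

abbreviation scaled_normal :: "real \<Rightarrow> real measure" where
  "scaled_normal \<sigma> \<equiv> distr std_normal_distribution borel (\<lambda>x. \<sigma> * x)"

lemma prob_space_scaled_normal: "prob_space (scaled_normal \<sigma>)"
proof -
  interpret prob_space "std_normal_distribution"
    by (rule prob_space_normal_density) simp
  show ?thesis by (rule prob_space_distr) simp
qed

lemma gaussian_product: "product_prob_space (\<lambda>_::nat. scaled_normal \<sigma>)"
  unfolding product_prob_space_def product_prob_space_axioms_def product_sigma_finite_def
  using prob_space_scaled_normal prob_space_imp_sigma_finite by blast

lemma prob_space_gaussian: "prob_space (gaussian n \<sigma>)"
  unfolding gaussian_def by (intro prob_space_PiM prob_space_scaled_normal)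

lemma sets_gaussian [measurable_cong, simp]: "sets (gaussian n \<sigma>) = sets (borel_Rn n)"
  unfolding gaussian_def by (intro sets_PiM_cong) auto

lemma space_gaussian [simp]: "space (gaussian n \<sigma>) = Rn n"
  unfolding gaussian_def by (simp add: space_PiM Rn_def)

lemma scaled_normal_moments:
  "integrable (scaled_normal \<sigma>) (\<lambda>x. x)" "integrable (scaled_normal \<sigma>) (\<lambda>x. x * x)"
  "integral\<^sup>L (scaled_normal \<sigma>) (\<lambda>x. x) = 0" "integral\<^sup>L (scaled_normal \<sigma>) (\<lambda>x. x * x) = \<sigma>\<^sup>2"
proof -
  have eq: "(\<lambda>x. std_normal_density x * (\<sigma> * x * (\<sigma> * x))) =
      (\<lambda>x. \<sigma>\<^sup>2 * (std_normal_density x * x ^ (2 * 1)))"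
    "(\<lambda>x. std_normal_density x * (\<sigma> * x)) = (\<lambda>x. \<sigma> * (std_normal_density x * x ^ (2 * 0 + 1)))"
    by (simp_all add: fun_eq_iff power2_eq_square)
  have i: "integrable lborel (\<lambda>x. std_normal_density x * (\<sigma> * x * (\<sigma> * x)))"
    "integrable lborel (\<lambda>x. std_normal_density x * (\<sigma> * x))"
    unfolding eq by (intro integrable_mult_right integrable_std_normal_moment)+
  have v: "(\<integral>x. std_normal_density x * (\<sigma> * x * (\<sigma> * x)) \<partial>lborel) = \<sigma>\<^sup>2"
    "(\<integral>x. std_normal_density x * (\<sigma> * x) \<partial>lborel) = 0"
    unfolding eq using integral_std_normal_moment_odd[of 0] integral_std_normal_moment_even[of 1]
    by simp_all
  show "integrable (scaled_normal \<sigma>) (\<lambda>x. x)" "integrable (scaled_normal \<sigma>) (\<lambda>x. x * x)"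
    by (subst integrable_distr_eq, simp, simp, subst integrable_density; use i in simp)+
  show "integral\<^sup>L (scaled_normal \<sigma>) (\<lambda>x. x) = 0" "integral\<^sup>L (scaled_normal \<sigma>) (\<lambda>x. x * x) = \<sigma>\<^sup>2"
    by (subst integral_distr, simp, simp, subst integral_density; use v in simp)+
qed

text \<open>Stated for a general centred \<open>f\<close> because it serves twice: for the noise
  with \<open>f\<close> the identity, and for the prior with \<open>f = score\<close>.\<close>

lemma product_moments:
  fixes f :: "'a \<Rightarrow> real"
  assumes M: "prob_space M" and I: "finite I" "i \<in> I" "j \<in> I"
    and f: "integrable M f" "integrable M (\<lambda>x. f x * f x)" "integral\<^sup>L M f = 0"
  shows "integrable (PiM I (\<lambda>_. M)) (\<lambda>\<omega>. f (\<omega> i))"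
    and "integral\<^sup>L (PiM I (\<lambda>_. M)) (\<lambda>\<omega>. f (\<omega> i)) = 0"
    and "integrable (PiM I (\<lambda>_. M)) (\<lambda>\<omega>. f (\<omega> i) * f (\<omega> j))"
    and "integral\<^sup>L (PiM I (\<lambda>_. M)) (\<lambda>\<omega>. f (\<omega> i) * f (\<omega> j)) =
      (if i = j then \<integral>x. f x * f x \<partial>M else 0)"
proof -
  interpret M: prob_space M by fact
  interpret product_prob_space "\<lambda>_. M" ..
  \<comment> \<open>Factors 1 in the remaining coordinates turn \<open>f (\<omega> i)\<close> and
    \<open>f (\<omega> i) * f (\<omega> j)\<close> into products over all of
    \<open>I\<close>.\<close>
  define a where "a l x = (if l = i then f x else 1)" for l x
  define b where "b l x = (if l = i then f x else 1) * (if l = j then f x else 1)" for l x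
  have prod_delta: "(\<Prod>l\<in>I. if l = m then g l else 1) = g m" if "m \<in> I" for m and g :: "'b \<Rightarrow> real"
    using I(1) that by simp
  have a: "(\<Prod>l\<in>I. a l (\<omega> l)) = f (\<omega> i)" for \<omega> :: "'b \<Rightarrow> 'a"
    unfolding a_def using prod_delta[OF I(2), of "\<lambda>l. f (\<omega> l)"] by simp
  have b: "(\<Prod>l\<in>I. b l (\<omega> l)) = f (\<omega> i) * f (\<omega> j)" for \<omega> :: "'b \<Rightarrow> 'a"
    unfolding b_def prod.distrib
    using prod_delta[OF I(2), of "\<lambda>l. f (\<omega> l)"] prod_delta[OF I(3), of "\<lambda>l. f (\<omega> l)"] by simp
  have ia: "integrable M (a l)" for l using f by (cases "l = i") (simp_all add: a_def[abs_def])
  have ib: "integrable M (b l)" for l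
    using f by (cases "l = i"; cases "l = j") (simp_all add: b_def[abs_def])
  show "integrable (PiM I (\<lambda>_. M)) (\<lambda>\<omega>. f (\<omega> i))"
    using product_integrable_prod[OF I(1), where f = a, OF ia] by (simp add: a)
  show "integral\<^sup>L (PiM I (\<lambda>_. M)) (\<lambda>\<omega>. f (\<omega> i)) = 0"
    using product_integral_prod[OF I(1), where f = a, OF ia] I f(3) unfolding a
    by (auto simp: a_def[abs_def] intro!: prod_zero bexI[of _ i])
  show "integrable (PiM I (\<lambda>_. M)) (\<lambda>\<omega>. f (\<omega> i) * f (\<omega> j))"
    using product_integrable_prod[OF I(1), where f = b, OF ib] by (simp add: b)
  have "integral\<^sup>L (PiM I (\<lambda>_. M)) (\<lambda>\<omega>. f (\<omega> i) * f (\<omega> j)) = (\<Prod>l\<in>I. integral\<^sup>L M (b l))"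
    using product_integral_prod[OF I(1), where f = b, OF ib] by (simp add: b)
  also have "\<dots> = (if i = j then \<integral>x. f x * f x \<partial>M else 0)"
  proof (cases "i = j")
    case True
    have "integral\<^sup>L M (b l) = (if l = i then \<integral>x. f x * f x \<partial>M else 1)" for l
      using True by (simp add: b_def[abs_def] M.prob_space)
    then show ?thesis using True prod_delta[OF I(2), of "\<lambda>_. \<integral>x. f x * f x \<partial>M"] by simp
  next
    case False
    then have "integral\<^sup>L M (b i) = 0" using f by (simp add: b_def[abs_def])
    then show ?thesis using False I by (auto intro!: prod_zero bexI[of _ i])
  qed
  finally show "integral\<^sup>L (PiM I (\<lambda>_. M)) (\<lambda>\<omega>. f (\<omega> i) * f (\<omega> j)) =
      (if i = j then \<integral>x. f x * f x \<partial>M else 0)" .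
qed

lemma gaussian_vinner_moments:
  "integrable (gaussian n \<sigma>) (\<lambda>g. vinner n a g)"
  "integral\<^sup>L (gaussian n \<sigma>) (\<lambda>g. vinner n a g) = 0"
  "integrable (gaussian n \<sigma>) (\<lambda>g. vinner n a g * vinner n b g)"
  "integral\<^sup>L (gaussian n \<sigma>) (\<lambda>g. vinner n a g * vinner n b g) = \<sigma>\<^sup>2 * vinner n a b"
proof -
  note m = product_moments[OF prob_space_scaled_normal finite_lessThan _ _ scaled_normal_moments(1,2,3),
      folded gaussian_def, unfolded scaled_normal_moments(4), simplified]
  show "integrable (gaussian n \<sigma>) (\<lambda>g. vinner n a g)"
    unfolding vinner_def by (intro Bochner_Integration.integrable_sum integrable_mult_right m) auto
  show "integral\<^sup>L (gaussian n \<sigma>) (\<lambda>g. vinner n a g) = 0"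
    unfolding vinner_def by (subst Bochner_Integration.integral_sum) (use m(1,2) in auto)
  have eq: "vinner n a g * vinner n b g = (\<Sum>i<n. \<Sum>j<n. (a i * b j) * (g i * g j))" for g
    by (simp add: vinner_def sum_product mult_ac)
  have int: "integrable (gaussian n \<sigma>) (\<lambda>g. (a i * b j) * (g i * g j))" if "i < n" "j < n" for i j
    using m(3) that by (intro integrable_mult_right) auto
  show "integrable (gaussian n \<sigma>) (\<lambda>g. vinner n a g * vinner n b g)"
    unfolding eq by (intro Bochner_Integration.integrable_sum int) auto
  have "integral\<^sup>L (gaussian n \<sigma>) (\<lambda>g. vinner n a g * vinner n b g) =
    (\<Sum>i<n. \<Sum>j<n. integral\<^sup>L (gaussian n \<sigma>) (\<lambda>g. (a i * b j) * (g i * g j)))"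
    unfolding eq
    by (subst Bochner_Integration.integral_sum, intro Bochner_Integration.integrable_sum int, simp, simp)
      (intro sum.cong refl Bochner_Integration.integral_sum int, simp_all)
  also have "\<dots> = (\<Sum>i<n. \<Sum>j<n. (a i * b j) * (if i = j then \<sigma>\<^sup>2 else 0))"
    by (intro sum.cong refl) (simp add: m(4))
  also have "\<dots> = \<sigma>\<^sup>2 * vinner n a b"
    by (simp add: vinner_def sum_distrib_left if_distrib mult_ac cong: if_cong)
  finally show "integral\<^sup>L (gaussian n \<sigma>) (\<lambda>g. vinner n a g * vinner n b g) = \<sigma>\<^sup>2 * vinner n a b" .
qed

lemma vinner_measurable [measurable]:
  assumes [measurable]: "\<And>i. i < n \<Longrightarrow> (\<lambda>x. f x i) \<in> borel_measurable M" "\<And>i. i < n \<Longrightarrow> (\<lambda>x. g x i) \<in> borel_measurable M"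
  shows "(\<lambda>x. vinner n (f x) (g x)) \<in> borel_measurable M"
  unfolding vinner_def by measurable

lemma gaussian_second_moment:
  "(\<integral>\<^sup>+g. ennreal ((vinner n a g)\<^sup>2) \<partial>gaussian n \<sigma>) = ennreal (\<sigma>\<^sup>2 * vinner n a a)"
  using gaussian_vinner_moments(3,4)[of n \<sigma> a a]
  by (subst nn_integral_eq_integral) (simp_all add: power2_eq_square)

section \<open>Translations and exponential moments of the noise\<close>

lemma scaled_normal_shift:
  assumes "\<sigma> > 0"
  shows "distr (scaled_normal \<sigma>) borel (\<lambda>x. a + x) =
    density (scaled_normal \<sigma>) (\<lambda>z. ennreal (exp (a * z / \<sigma>\<^sup>2 - a\<^sup>2 / (2 * \<sigma>\<^sup>2))))"
proof (rule measure_eqI)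
  fix A assume "A \<in> sets (distr (scaled_normal \<sigma>) borel (\<lambda>x. a + x))"
  then have A [measurable]: "A \<in> sets borel" by simp
  have "emeasure (distr (scaled_normal \<sigma>) borel (\<lambda>x. a + x)) A =
    (\<integral>\<^sup>+x. indicator A (a + x) \<partial>scaled_normal \<sigma>)"
    by (subst nn_integral_indicator[symmetric], simp, subst nn_integral_distr) simp_all
  also have "\<dots> = (\<integral>\<^sup>+x. ennreal (std_normal_density x) * indicator A (a + \<sigma> * x) \<partial>lborel)"
    by (simp add: nn_integral_distr nn_integral_density)
  also have "\<dots> = (\<integral>\<^sup>+x. ennreal (std_normal_density (- (a / \<sigma>) + 1 * x)) *
      indicator A (a + \<sigma> * (- (a / \<sigma>) + 1 * x)) \<partial>lborel)"
    by (subst nn_integral_real_affine[where c = 1 and t = "- (a / \<sigma>)"]) simp_all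
  also have "\<dots> = (\<integral>\<^sup>+x. ennreal (std_normal_density x) *
      (ennreal (exp (a * (\<sigma> * x) / \<sigma>\<^sup>2 - a\<^sup>2 / (2 * \<sigma>\<^sup>2))) * indicator A (\<sigma> * x)) \<partial>lborel)"
  proof (intro nn_integral_cong)
    fix x
    have "- (x - a / \<sigma>)\<^sup>2 / 2 = - x\<^sup>2 / 2 + (a * (\<sigma> * x) / \<sigma>\<^sup>2 - a\<^sup>2 / (2 * \<sigma>\<^sup>2))"
      using assms by (simp add: field_simps power2_eq_square)
    then have "std_normal_density (- (a / \<sigma>) + 1 * x) =
      std_normal_density x * exp (a * (\<sigma> * x) / \<sigma>\<^sup>2 - a\<^sup>2 / (2 * \<sigma>\<^sup>2))"
      by (simp add: std_normal_density_def mult_exp_exp)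
    then show "ennreal (std_normal_density (- (a / \<sigma>) + 1 * x)) * indicator A (a + \<sigma> * (- (a / \<sigma>) + 1 * x)) =
      ennreal (std_normal_density x) *
      (ennreal (exp (a * (\<sigma> * x) / \<sigma>\<^sup>2 - a\<^sup>2 / (2 * \<sigma>\<^sup>2))) * indicator A (\<sigma> * x))"
      using assms by (simp add: ennreal_mult mult.assoc field_simps)
  qed
  also have "\<dots> = emeasure (density (scaled_normal \<sigma>) (\<lambda>z. ennreal (exp (a * z / \<sigma>\<^sup>2 - a\<^sup>2 / (2 * \<sigma>\<^sup>2))))) A"
    by (simp add: emeasure_density nn_integral_distr nn_integral_density)
  finally show "emeasure (distr (scaled_normal \<sigma>) borel (\<lambda>x. a + x)) A =
    emeasure (density (scaled_normal \<sigma>) (\<lambda>z. ennreal (exp (a * z / \<sigma>\<^sup>2 - a\<^sup>2 / (2 * \<sigma>\<^sup>2))))) A" .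
qed simp

lemma vadd_measurable [measurable]:
  assumes [measurable]: "\<And>i. i < n \<Longrightarrow> (\<lambda>x. f x i) \<in> borel_measurable M" "\<And>i. i < n \<Longrightarrow> (\<lambda>x. g x i) \<in> borel_measurable M"
  shows "(\<lambda>x. vadd n (f x) (g x)) \<in> M \<rightarrow>\<^sub>M borel_Rn n"
  unfolding vadd_def by (rule measurable_restrict) simp

text \<open>The likelihood ratio of the observation \<open>y + g\<close> to the pure noise
  \<open>g\<close>. Taking the noise law as reference measure lets observations and noise be
  integrated against the same measure.\<close>

definition shift_density :: "nat \<Rightarrow> real \<Rightarrow> (nat \<Rightarrow> real) \<Rightarrow> (nat \<Rightarrow> real) \<Rightarrow> real" where
  "shift_density n \<sigma> y z = exp (vinner n y z / \<sigma>\<^sup>2 - vinner n y y / (2 * \<sigma>\<^sup>2))"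

lemma gaussian_shift:
  assumes "\<sigma> > 0"
  shows "distr (gaussian n \<sigma>) (borel_Rn n) (vadd n y) =
    density (gaussian n \<sigma>) (\<lambda>z. ennreal (shift_density n \<sigma> y z))"
proof -
  define M where "M i = distr (scaled_normal \<sigma>) borel (\<lambda>x. y i + x)" for i :: nat
  interpret G: product_prob_space "\<lambda>_::nat. scaled_normal \<sigma>" by (rule gaussian_product)
  have [measurable_cong]: "sets (M i) = sets borel" for i by (simp add: M_def)
  have "prob_space (M i)" for i
    unfolding M_def by (intro prob_space.prob_space_distr prob_space_scaled_normal) simp
  then interpret M: product_prob_space M
    unfolding product_prob_space_def product_prob_space_axioms_def product_sigma_finite_def
    using prob_space_imp_sigma_finite by blast
  have setsM: "sets (borel_Rn n) = sets (PiM {..<n} M)" by (intro sets_PiM_cong) (auto simp: M_def)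
  have "distr (gaussian n \<sigma>) (borel_Rn n) (vadd n y) = PiM {..<n} M"
  proof (rule M.PiM_eqI)
    fix A assume "\<And>i. i \<in> {..<n} \<Longrightarrow> A i \<in> sets (M i)"
    then have A [measurable]: "\<And>i. i < n \<Longrightarrow> A i \<in> sets borel" by (simp add: M_def)
    have [measurable]: "PiE {..<n} A \<in> sets (borel_Rn n)" by (rule sets_PiM_I_finite) auto
    have "vadd n y -` PiE {..<n} A \<inter> Rn n = PiE {..<n} (\<lambda>i. (\<lambda>x. y i + x) -` A i)"
      by (auto simp: vadd_def PiE_iff Rn_def)
    then have "emeasure (distr (gaussian n \<sigma>) (borel_Rn n) (vadd n y)) (PiE {..<n} A) =
      emeasure (gaussian n \<sigma>) (PiE {..<n} (\<lambda>i. (\<lambda>x. y i + x) -` A i))"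
      by (subst emeasure_distr) simp_all
    also have "\<dots> = (\<Prod>i<n. emeasure (scaled_normal \<sigma>) ((\<lambda>x. y i + x) -` A i))"
      unfolding gaussian_def
      by (rule G.emeasure_PiM) (auto intro!: measurable_sets_borel[of _ borel] A)
    also have "\<dots> = (\<Prod>i<n. emeasure (M i) (A i))"
      unfolding M_def by (intro prod.cong refl, subst emeasure_distr) auto
    finally show "emeasure (distr (gaussian n \<sigma>) (borel_Rn n) (vadd n y)) (PiE {..<n} A) =
      (\<Prod>i<n. emeasure (M i) (A i))" .
  qed (simp_all add: setsM)
  also have "\<dots> = density (gaussian n \<sigma>) (\<lambda>z. ennreal (shift_density n \<sigma> y z))"
  proof (rule M.PiM_eqI[symmetric])
    fix A assume "\<And>i. i \<in> {..<n} \<Longrightarrow> A i \<in> sets (M i)"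
    then have A [measurable]: "\<And>i. i < n \<Longrightarrow> A i \<in> sets borel" by (simp add: M_def)
    let ?w = "\<lambda>i z. ennreal (exp (y i * z / \<sigma>\<^sup>2 - (y i)\<^sup>2 / (2 * \<sigma>\<^sup>2)))"
    have [measurable]: "PiE {..<n} A \<in> sets (borel_Rn n)" by (rule sets_PiM_I_finite) auto
    have eq: "ennreal (shift_density n \<sigma> y z) * indicator (PiE {..<n} A) z = (\<Prod>i<n. ?w i (z i) * indicator (A i) (z i))"
      if "z \<in> Rn n" for z
    proof -
      have "shift_density n \<sigma> y z = (\<Prod>i<n. exp (y i * z i / \<sigma>\<^sup>2 - (y i)\<^sup>2 / (2 * \<sigma>\<^sup>2)))"
        unfolding shift_density_def vinner_def
        by (simp add: exp_sum[symmetric] sum_subtractf sum_divide_distrib power2_eq_square)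
      then have "ennreal (shift_density n \<sigma> y z) = (\<Prod>i<n. ?w i (z i))"
        by (simp add: prod_ennreal)
      moreover have "(indicator (PiE {..<n} A) z :: ennreal) = (\<Prod>i<n. indicator (A i) (z i))"
      proof (cases "z \<in> PiE {..<n} A")
        case False
        then obtain i where "i < n" "z i \<notin> A i" using \<open>z \<in> Rn n\<close> by (auto simp: Rn_def PiE_iff)
        then have "(\<Prod>i<n. indicator (A i) (z i) :: ennreal) = 0"
          by (intro prod_zero) (auto intro!: bexI[of _ i])
        then show ?thesis using False by simp
      qed (auto simp: PiE_iff)
      ultimately show ?thesis by (simp add: prod.distrib)
    qed
    have "emeasure (density (gaussian n \<sigma>) (\<lambda>z. ennreal (shift_density n \<sigma> y z))) (PiE {..<n} A) =
      (\<integral>\<^sup>+z. ennreal (shift_density n \<sigma> y z) * indicator (PiE {..<n} A) z \<partial>gaussian n \<sigma>)"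
      unfolding shift_density_def by (rule emeasure_density) measurable
    also have "\<dots> = (\<integral>\<^sup>+z. (\<Prod>i<n. ?w i (z i) * indicator (A i) (z i)) \<partial>gaussian n \<sigma>)"
      by (intro nn_integral_cong) (simp add: eq)
    also have "\<dots> = (\<Prod>i<n. \<integral>\<^sup>+z. ?w i z * indicator (A i) z \<partial>scaled_normal \<sigma>)"
      unfolding gaussian_def by (rule G.product_nn_integral_prod) simp_all
    also have "\<dots> = (\<Prod>i<n. emeasure (M i) (A i))"
      unfolding M_def scaled_normal_shift[OF assms] by (intro prod.cong refl) (subst emeasure_density, simp_all)
    finally show "emeasure (density (gaussian n \<sigma>) (\<lambda>z. ennreal (shift_density n \<sigma> y z))) (PiE {..<n} A) =
      (\<Prod>i<n. emeasure (M i) (A i))" .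
  qed (simp_all add: setsM)
  finally show ?thesis .
qed

text \<open>This is the total mass 1 of the noise law shifted by \<open>\<sigma>\<^sup>2\<close>
  times \<open>v\<close>.\<close>

lemma gaussian_mgf:
  assumes "\<sigma> > 0"
  shows "(\<integral>\<^sup>+g. ennreal (exp (vinner n v g - \<sigma>\<^sup>2 * vinner n v v / 2)) \<partial>gaussian n \<sigma>) = 1"
proof -
  interpret prob_space "gaussian n \<sigma>" by (rule prob_space_gaussian)
  let ?y = "vscale n (\<sigma>\<^sup>2) v"
  have "shift_density n \<sigma> ?y g = exp (vinner n v g - \<sigma>\<^sup>2 * vinner n v v / 2)" for g
    using assms by (simp add: shift_density_def field_simps power2_eq_square)
  moreover have "emeasure (density (gaussian n \<sigma>) (\<lambda>z. ennreal (shift_density n \<sigma> ?y z)))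
      (space (gaussian n \<sigma>)) = (\<integral>\<^sup>+g. ennreal (shift_density n \<sigma> ?y g) \<partial>gaussian n \<sigma>)"
    unfolding shift_density_def
    by (subst emeasure_density, measurable, rule nn_integral_cong) (simp add: indicator_def)
  moreover have "prob_space (distr (gaussian n \<sigma>) (borel_Rn n) (vadd n ?y))"
    by (intro prob_space_distr) measurable
  ultimately show ?thesis
    using prob_space.emeasure_space_1 unfolding gaussian_shift[OF assms] by fastforce
qed

section \<open>A prior with finite Fisher information\<close>

text \<open>
  The density vanishes to second order at the end points, which makes the second moment of its score
  (the Fisher information) finite.
\<close>

definition prior_density :: "real \<Rightarrow> real" where
  "prior_density t = 15 / 16 * (1 - t\<^sup>2)\<^sup>2 * indicator {-1..1} t"

definition prior :: "real measure" where
  "prior = density lborel (\<lambda>t. ennreal (prior_density t))"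

text \<open>The logarithmic derivative of \<open>prior_density\<close> inside the interval. At the
  end points division by zero gives 0.\<close>

definition score :: "real \<Rightarrow> real" where
  "score t = - 4 * t / (1 - t\<^sup>2)"

lemma prior_density_measurable [measurable]: "prior_density \<in> borel_measurable borel"
  unfolding prior_density_def[abs_def] by measurable

lemma prior_density_nonneg: "0 \<le> prior_density t"
  by (simp add: prior_density_def)

lemma sets_prior [measurable_cong, simp]: "sets prior = sets borel"
  by (simp add: prior_def)

lemma score_measurable [measurable]: "score \<in> borel_measurable borel"
  unfolding score_def[abs_def] by measurable

lemma prior_density_score: "prior_density t * score t = - (15 / 4) * t * (1 - t\<^sup>2) * indicator {-1..1} t"
  by (cases "1 - t\<^sup>2 = 0")
    (simp_all add: prior_density_def score_def field_simps power2_eq_square)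

lemma integral_prior:
  fixes f :: "real \<Rightarrow> real"
  assumes [measurable]: "f \<in> borel_measurable borel"
    and "\<And>t. prior_density t * f t = F' t * indicator {-1..1} t"
    and "\<And>t. (F has_real_derivative F' t) (at t)" "\<And>t. isCont F' t"
  shows "integrable prior f" "integral\<^sup>L prior f = F 1 - F (-1)"
proof -
  have "has_bochner_integral lborel (\<lambda>t. F' t * indicator {-1..1} t) (F 1 - F (-1))"
    by (rule has_bochner_integral_FTC_Icc_real) (use assms in auto)
  then show "integrable prior f" "integral\<^sup>L prior f = F 1 - F (-1)"
    unfolding prior_def
    by (simp_all add: integrable_real_density integral_real_density prior_density_nonneg assms(2) has_bochner_integral_iff)
qed

lemma prob_space_prior: "prob_space prior"
proof
  let ?F = "\<lambda>t::real. 15 / 16 * t - 5 / 8 * t ^ 3 + 3 / 16 * t ^ 5"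
  have "(\<integral>\<^sup>+t. ennreal (15 / 16 * (1 - t\<^sup>2)\<^sup>2) * indicator {-1..1} t \<partial>lborel) = ?F 1 - ?F (-1)"
  proof (rule nn_integral_FTC_Icc)
    show "(?F has_real_derivative 15 / 16 * (1 - t\<^sup>2)\<^sup>2) (at t)" for t
      by (auto intro!: derivative_eq_intros simp: power2_eq_square algebra_simps power4_eq_xxxx)
  qed auto
  moreover have "ennreal (prior_density t) = ennreal (15 / 16 * (1 - t\<^sup>2)\<^sup>2) * indicator {-1..1} t" for t
    by (simp add: prior_density_def indicator_def)
  ultimately show "emeasure prior (space prior) = 1"
    by (simp add: prior_def emeasure_density)
qed

lemma AE_prior: "AE t in prior. \<bar>t\<bar> \<le> 1"
  unfolding prior_def
  by (subst AE_density) (auto simp: prior_density_def indicator_def abs_le_iff intro!: AE_I2)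

text \<open>\<open>prior_density t * score t\<close> is the derivative of the density, so the value
  -1 is integration by parts against \<open>t\<close>. For the Fisher information, density times
  squared score is \<open>15 * t\<^sup>2\<close> inside the interval, with integral 10.\<close>

lemma score_moments:
  "integrable prior score" "integral\<^sup>L prior score = 0"
  "integrable prior (\<lambda>t. t * score t)" "integral\<^sup>L prior (\<lambda>t. t * score t) = -1"
  "integrable prior (\<lambda>t. score t * score t)" "integral\<^sup>L prior (\<lambda>t. score t * score t) \<le> 10"
proof -
  have 1: "((\<lambda>t::real. 15 / 16 * t ^ 4 - 15 / 8 * t\<^sup>2) has_real_derivative - (15 / 4) * t * (1 - t\<^sup>2)) (at t)" for t
    by (auto intro!: derivative_eq_intros simp: field_simps power2_eq_square power3_eq_cube)
  show "integrable prior score" "integral\<^sup>L prior score = 0"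
    using integral_prior[OF score_measurable prior_density_score 1] by (simp_all)
  have 2: "((\<lambda>t::real. 3 / 4 * t ^ 5 - 5 / 4 * t ^ 3) has_real_derivative t * (- (15 / 4) * t * (1 - t\<^sup>2))) (at t)" for t
    by (auto intro!: derivative_eq_intros simp: field_simps power2_eq_square power4_eq_xxxx)
  have "prior_density t * (t * score t) = t * (- (15 / 4) * t * (1 - t\<^sup>2)) * indicator {-1..1} t" for t
    using prior_density_score[of t] by (simp add: mult_ac)
  from integral_prior[OF _ this 2]
  show "integrable prior (\<lambda>t. t * score t)" "integral\<^sup>L prior (\<lambda>t. t * score t) = -1"
    by (simp_all)
  have 3: "((\<lambda>t::real. 5 * t ^ 3) has_real_derivative 15 * t\<^sup>2) (at t)" for t
    by (auto intro!: derivative_eq_intros simp: power2_eq_square)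
  have "has_bochner_integral lborel (\<lambda>t. 15 * t\<^sup>2 * indicator {-1..1} t) (5 * 1 ^ 3 - 5 * (-1) ^ 3 :: real)"
    by (rule has_bochner_integral_FTC_Icc_real[OF _ 3]) auto
  then have i: "integrable lborel (\<lambda>t::real. 15 * t\<^sup>2 * indicator {-1..1} t)"
    and v: "(\<integral>t. 15 * (t::real)\<^sup>2 * indicator {-1..1} t \<partial>lborel) = 10" by (simp_all add: has_bochner_integral_iff)
  have le: "\<bar>prior_density t * (score t * score t)\<bar> \<le> 15 * t\<^sup>2 * indicator {-1..1} t" for t
  proof (cases "1 - t\<^sup>2 = 0")
    case False
    define w where "w = 1 - t\<^sup>2"
    have "prior_density t * (score t * score t) = 15 * t\<^sup>2 * indicator {-1..1} t"
      using False unfolding prior_density_def score_def w_def[symmetric]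
      by (simp add: power2_eq_square)
    then show ?thesis by simp
  qed (simp add: prior_density_def score_def)
  have j: "integrable lborel (\<lambda>t. prior_density t * (score t * score t))"
    by (rule Bochner_Integration.integrable_bound[OF i]) (use le in \<open>auto intro!: AE_I2 order_trans[OF le]\<close>)
  then show "integrable prior (\<lambda>t. score t * score t)"
    unfolding prior_def by (simp add: integrable_real_density prior_density_nonneg)
  have "(\<integral>t. prior_density t * (score t * score t) \<partial>lborel) \<le> 10"
    unfolding v[symmetric] by (rule integral_mono[OF j i]) (use le in \<open>auto intro: order_trans[OF abs_ge_self]\<close>)
  then show "integral\<^sup>L prior (\<lambda>t. score t * score t) \<le> 10"
    unfolding prior_def by (simp add: integral_real_density prior_density_nonneg)
qed

text \<open>Times the prior density, the integrand is the derivative on [-1, 1] of the exponential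
  times that density, which vanishes at both end points. Along a line of parameters the Gaussian
  likelihood has this exponential form.\<close>

lemma integral_prior_exp_score:
  "integral\<^sup>L prior (\<lambda>t. exp (\<alpha> * t - \<beta> * t\<^sup>2) * (\<alpha> - 2 * \<beta> * t + score t)) = 0"
proof -
  let ?F = "\<lambda>t. exp (\<alpha> * t - \<beta> * t\<^sup>2) * (15 / 16 * (1 - t\<^sup>2)\<^sup>2)"
  let ?F' = "\<lambda>t. exp (\<alpha> * t - \<beta> * t\<^sup>2) * ((\<alpha> - 2 * \<beta> * t) * (15 / 16 * (1 - t\<^sup>2)\<^sup>2) - 15 / 4 * t * (1 - t\<^sup>2))"
  have "(?F has_real_derivative ?F' t) (at t)" for t
    by (auto intro!: derivative_eq_intros) (simp add: field_simps power2_eq_square)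
  moreover have "prior_density t * (exp (\<alpha> * t - \<beta> * t\<^sup>2) * (\<alpha> - 2 * \<beta> * t + score t)) = ?F' t * indicator {-1..1} t" for t
  proof -
    have "prior_density t * (exp (\<alpha> * t - \<beta> * t\<^sup>2) * (\<alpha> - 2 * \<beta> * t + score t)) =
      exp (\<alpha> * t - \<beta> * t\<^sup>2) * ((\<alpha> - 2 * \<beta> * t) * prior_density t + prior_density t * score t)"
      by (simp add: algebra_simps)
    then show ?thesis unfolding prior_density_score by (simp add: prior_density_def algebra_simps)
  qed
  ultimately show ?thesis
    by (subst integral_prior(2)[where F = ?F and F' = ?F']) auto
qed

section \<open>The van Trees inequality\<close>

lemma vsub_measurable [measurable]:
  assumes "\<And>i. i < n \<Longrightarrow> (\<lambda>x. f x i) \<in> borel_measurable M" "\<And>i. i < n \<Longrightarrow> (\<lambda>x. g x i) \<in> borel_measurable M"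
  shows "i < n \<Longrightarrow> (\<lambda>x. vsub n (f x) (g x) i) \<in> borel_measurable M"
  using assms by (simp add: vsub_def)

text \<open>Factoring the half-width \<open>h\<close> out of the parameter box leaves each
  coordinate with the fixed prior on [-1, 1], whose Fisher information is at most 10.\<close>

locale van_trees =
  fixes n :: nat and S :: "nat set" and c y :: "nat \<Rightarrow> nat \<Rightarrow> real" and h \<sigma> D :: real
  assumes fin [simp]: "finite S" and h: "0 < h" and \<sigma>: "0 < \<sigma>" and D: "0 < D"
    and dual: "\<And>i j. i \<in> S \<Longrightarrow> j \<in> S \<Longrightarrow> vinner n (y i) (c j) = (if i = j then 1 else 0)"
    and short: "\<And>j. j \<in> S \<Longrightarrow> vinner n (y j) (y j) \<le> 1 / D\<^sup>2"
    and expand: "\<And>j i. j \<in> S \<Longrightarrow> i < n \<Longrightarrow> y j i = (\<Sum>l\<in>S. vinner n (y j) (y l) * c l i)"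
begin

abbreviation priors :: "(nat \<Rightarrow> real) measure" where "priors \<equiv> PiM S (\<lambda>_. prior)"
abbreviation noise :: "(nat \<Rightarrow> real) measure" where "noise \<equiv> gaussian n \<sigma>"

definition pt :: "(nat \<Rightarrow> real) \<Rightarrow> nat \<Rightarrow> real" where
  "pt \<theta> = (\<lambda>i\<in>{..<n}. h * (\<Sum>j\<in>S. \<theta> j * c j i))"

text \<open>The score with respect to \<open>\<theta> j\<close> of the joint law of parameter and observation, at noise \<open>g\<close>.\<close>

definition joint_score :: "nat \<Rightarrow> (nat \<Rightarrow> real) \<Rightarrow> (nat \<Rightarrow> real) \<Rightarrow> real" where
  "joint_score j \<theta> g = h * vinner n (c j) g / \<sigma>\<^sup>2 + score (\<theta> j)"

lemma prob_space_priors: "prob_space priors"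
  by (intro prob_space_PiM prob_space_prior)

lemma sets_priors [measurable_cong]: "sets priors = sets (PiM S (\<lambda>_. borel))"
  by (intro sets_PiM_cong) auto

lemma pt_measurable [measurable]:
  "i < n \<Longrightarrow> (\<lambda>\<theta>. pt \<theta> i) \<in> borel_measurable priors"
  unfolding pt_def by simp measurable

lemma vinner_pt: "vinner n (pt \<theta>) v = h * (\<Sum>j\<in>S. \<theta> j * vinner n (c j) v)"
  by (simp add: pt_def vinner_def sum_distrib_left sum_distrib_right mult_ac)
    (subst sum.swap, simp add: mult_ac)

lemma integral_component:
  assumes "j \<in> S" "integrable prior f"
  shows "integrable priors (\<lambda>\<theta>. f (\<theta> j))" "integral\<^sup>L priors (\<lambda>\<theta>. f (\<theta> j)) = integral\<^sup>L prior (f :: real \<Rightarrow> real)"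
proof -
  have d: "distr priors prior (\<lambda>\<theta>. \<theta> j) = prior"
    using assms by (intro distr_PiM_component prob_space_prior)
  have m [measurable]: "f \<in> borel_measurable prior" using assms by auto
  show "integrable priors (\<lambda>\<theta>. f (\<theta> j))"
    using assms by (subst integrable_distr_eq[of "\<lambda>\<theta>. \<theta> j" priors prior f, symmetric]) (simp_all add: d)
  show "integral\<^sup>L priors (\<lambda>\<theta>. f (\<theta> j)) = integral\<^sup>L prior f"
    using assms by (subst integral_distr[of "\<lambda>\<theta>. \<theta> j" priors prior f, symmetric]) (simp_all add: d)
qed

lemma shift_density_pos: "0 < shift_density n \<sigma> a z"
  by (simp add: shift_density_def)

lemma shift_density_measurable [measurable]:
  assumes [measurable]: "\<And>i. i < n \<Longrightarrow> (\<lambda>x. f x i) \<in> borel_measurable M" "\<And>i. i < n \<Longrightarrow> (\<lambda>x. g x i) \<in> borel_measurable M"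
  shows "(\<lambda>x. shift_density n \<sigma> (f x) (g x)) \<in> borel_measurable M"
  unfolding shift_density_def by measurable

lemma integral_shift:
  fixes F :: "(nat \<Rightarrow> real) \<Rightarrow> real"
  assumes [measurable]: "F \<in> borel_measurable (borel_Rn n)"
  shows "integrable noise (\<lambda>g. F (vadd n a g)) \<longleftrightarrow> integrable noise (\<lambda>z. shift_density n \<sigma> a z * F z)"
    and "integral\<^sup>L noise (\<lambda>g. F (vadd n a g)) = integral\<^sup>L noise (\<lambda>z. shift_density n \<sigma> a z * F z)"
proof -
  have [measurable]: "F \<in> borel_measurable noise" by (simp add: measurable_cong_sets[OF sets_gaussian refl])
  have "integrable noise (\<lambda>g. F (vadd n a g)) \<longleftrightarrow> integrable (distr noise (borel_Rn n) (vadd n a)) F"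
    by (rule integrable_distr_eq[symmetric]) measurable
  also have "\<dots> \<longleftrightarrow> integrable noise (\<lambda>z. shift_density n \<sigma> a z * F z)"
    unfolding gaussian_shift[OF \<sigma>]
    by (rule integrable_real_density) (auto simp: less_imp_le[OF shift_density_pos])
  finally show "integrable noise (\<lambda>g. F (vadd n a g)) \<longleftrightarrow> integrable noise (\<lambda>z. shift_density n \<sigma> a z * F z)" .
  have "integral\<^sup>L noise (\<lambda>g. F (vadd n a g)) = integral\<^sup>L (distr noise (borel_Rn n) (vadd n a)) F"
    by (rule integral_distr[symmetric]) measurable
  also have "\<dots> = integral\<^sup>L noise (\<lambda>z. shift_density n \<sigma> a z * F z)"
    unfolding gaussian_shift[OF \<sigma>]
    by (rule integral_real_density) (auto simp: less_imp_le[OF shift_density_pos])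
  finally show "integral\<^sup>L noise (\<lambda>g. F (vadd n a g)) = integral\<^sup>L noise (\<lambda>z. shift_density n \<sigma> a z * F z)" .
qed

lemma joint_score_integrable: "integrable noise (joint_score j \<theta>)"
proof -
  interpret prob_space noise by (rule prob_space_gaussian)
  show ?thesis unfolding joint_score_def[abs_def]
    using gaussian_vinner_moments(1) by (intro Bochner_Integration.integrable_add) auto
qed

text \<open>The observation \<open>z\<close> is fixed, so the noise \<open>z - pt \<theta>\<close>
  moves with \<open>t\<close>. The likelihood is then the exponential of a quadratic in
  \<open>t\<close>, and \<open>joint_score\<close> is the logarithmic derivative of likelihood times
  prior.\<close>

lemma integral_prior_coordinate:
  assumes j: "j \<in> S"
  shows "(\<integral>t. shift_density n \<sigma> (pt (\<theta>(j := t))) z * joint_score j (\<theta>(j := t)) (vsub n z (pt (\<theta>(j := t)))) \<partial>prior) = 0"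
proof -
  define a where "a = pt (\<theta>(j := 0))"
  define \<alpha> where "\<alpha> = h * vinner n (c j) (vsub n z a) / \<sigma>\<^sup>2"
  define \<beta> where "\<beta> = h\<^sup>2 * vinner n (c j) (c j) / (2 * \<sigma>\<^sup>2)"
  have pt: "vinner n (pt (\<theta>(j := t))) v = vinner n a v + h * t * vinner n (c j) v" for t v
  proof -
    have "(\<Sum>l\<in>S. (\<theta>(j := t)) l * vinner n (c l) v) = t * vinner n (c j) v + (\<Sum>l\<in>S - {j}. \<theta> l * vinner n (c l) v)" for t
      using j by (subst sum.remove[of _ j]) (auto intro!: sum.cong)
    then show ?thesis by (simp add: a_def vinner_pt algebra_simps del: fun_upd_apply)
  qed
  have "shift_density n \<sigma> (pt (\<theta>(j := t))) z * joint_score j (\<theta>(j := t)) (vsub n z (pt (\<theta>(j := t)))) =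
    shift_density n \<sigma> a z * (exp (\<alpha> * t - \<beta> * t\<^sup>2) * (\<alpha> - 2 * \<beta> * t + score t))" for t
  proof -
    let ?q = "pt (\<theta>(j := t))"
    have 1: "vinner n ?q ?q = vinner n a a + 2 * h * t * vinner n (c j) a + h\<^sup>2 * t\<^sup>2 * vinner n (c j) (c j)"
      by (simp add: pt vinner_commute[of n a ?q] vinner_commute[of n "c j" ?q] vinner_commute[of n a "c j"])
        (simp add: algebra_simps power2_eq_square)
    have 2: "vinner n (c j) (vsub n z ?q) = vinner n (c j) (vsub n z a) - h * t * vinner n (c j) (c j)"
      by (simp add: vinner_commute[of n "c j" ?q] pt vinner_commute[of n a "c j"])
    have "shift_density n \<sigma> ?q z = shift_density n \<sigma> a z * exp (\<alpha> * t - \<beta> * t\<^sup>2)"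
      using \<sigma> unfolding shift_density_def 1 unfolding pt exp_add[symmetric] \<alpha>_def \<beta>_def
      by (simp add: field_simps power2_eq_square)
    moreover have "joint_score j (\<theta>(j := t)) (vsub n z ?q) = \<alpha> - 2 * \<beta> * t + score t"
      using \<sigma> unfolding joint_score_def 2 \<alpha>_def \<beta>_def by (simp add: field_simps power2_eq_square)
    ultimately show ?thesis by simp
  qed
  then show ?thesis by (simp add: integral_prior_exp_score)
qed

text \<open>
  Given the observation, the score times the joint density is a derivative in \<open>\<theta> j\<close> of a function that
  vanishes at the end points of the prior.
\<close>

lemma joint_score_orthogonal:
  fixes \<phi> :: "(nat \<Rightarrow> real) \<Rightarrow> real"
  assumes [measurable]: "\<phi> \<in> borel_measurable (borel_Rn n)" and B: "\<And>z. \<bar>\<phi> z\<bar> \<le> B" and j: "j \<in> S"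
  shows "integrable noise (\<lambda>g. \<phi> (vadd n (pt \<theta>) g) * joint_score j \<theta> g)"
    and "integrable priors (\<lambda>\<theta>. \<integral>g. \<phi> (vadd n (pt \<theta>) g) * joint_score j \<theta> g \<partial>noise)"
    and "(\<integral>\<theta>. \<integral>g. \<phi> (vadd n (pt \<theta>) g) * joint_score j \<theta> g \<partial>noise \<partial>priors) = 0"
proof -
  interpret noise: prob_space noise by (rule prob_space_gaussian)
  interpret priors: prob_space priors by (rule prob_space_priors)
  interpret pair_sigma_finite priors noise ..
  interpret prior: product_sigma_finite "\<lambda>_::nat. prior"
    using prob_space_prior prob_space_imp_sigma_finite by (simp add: product_sigma_finite_def)
  have [measurable]: "joint_score j \<theta> \<in> borel_measurable (borel_Rn n)" for \<theta>
    unfolding joint_score_def by measurable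
  have B0: "0 \<le> B" using B[of undefined] by linarith
  show int: "integrable noise (\<lambda>g. \<phi> (vadd n (pt \<theta>) g) * joint_score j \<theta> g)" for \<theta>
    by (rule Bochner_Integration.integrable_bound[OF integrable_mult_right[OF joint_score_integrable[of j \<theta>], of B]])
      (auto simp: abs_mult intro!: AE_I2 mult_mono order_trans[OF B abs_ge_self] B0)
  \<comment> \<open>Changing variables from the noise to the observation \<open>z\<close> frees the
    factor \<phi> of \<theta>, so that the prior can be integrated first.\<close>
  define F where "F \<theta> z = \<phi> z * joint_score j \<theta> (vsub n z (pt \<theta>))" for \<theta> z
  define K where "K \<theta> z = shift_density n \<sigma> (pt \<theta>) z * F \<theta> z" for \<theta> z
  have F: "F \<theta> (vadd n (pt \<theta>) g) = \<phi> (vadd n (pt \<theta>) g) * joint_score j \<theta> g" for \<theta> g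
    by (simp add: F_def joint_score_def)
  have F_meas [measurable]: "F \<theta> \<in> borel_measurable (borel_Rn n)" for \<theta>
    unfolding F_def joint_score_def by measurable
  have K_meas [measurable]: "(\<lambda>(\<theta>, z). K \<theta> z) \<in> borel_measurable (priors \<Otimes>\<^sub>M noise)"
    using j unfolding K_def F_def joint_score_def by measurable
  have K_int: "integrable noise (K \<theta>)" for \<theta>
    using int[of \<theta>] integral_shift(1)[OF F_meas, of \<theta> "pt \<theta>"] unfolding F K_def[abs_def] by simp
  have K_eq: "(\<integral>z. K \<theta> z \<partial>noise) = (\<integral>g. \<phi> (vadd n (pt \<theta>) g) * joint_score j \<theta> g \<partial>noise)" for \<theta>
    using integral_shift(2)[OF F_meas, of \<theta> "pt \<theta>"] unfolding F K_def by simp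
  \<comment> \<open>Returning to the noise variable removes the likelihood factor; as \<phi> is
    bounded, only absolute first moments of noise and score remain for Fubini.\<close>
  have K_le: "(\<integral>z. norm (K \<theta> z) \<partial>noise) \<le> B * (h / \<sigma>\<^sup>2 * (\<integral>g. \<bar>vinner n (c j) g\<bar> \<partial>noise) + \<bar>score (\<theta> j)\<bar>)" for \<theta>
  proof -
    have "(\<integral>z. norm (K \<theta> z) \<partial>noise) = (\<integral>g. \<bar>F \<theta> (vadd n (pt \<theta>) g)\<bar> \<partial>noise)"
      by (subst integral_shift(2)) (auto simp: K_def abs_mult less_imp_le[OF shift_density_pos])
    also have "\<dots> \<le> (\<integral>g. B * (h / \<sigma>\<^sup>2 * \<bar>vinner n (c j) g\<bar> + \<bar>score (\<theta> j)\<bar>) \<partial>noise)"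
    proof (rule integral_mono)
      show "integrable noise (\<lambda>g. \<bar>F \<theta> (vadd n (pt \<theta>) g)\<bar>)" unfolding F using int by (rule integrable_abs)
      show "integrable noise (\<lambda>g. B * (h / \<sigma>\<^sup>2 * \<bar>vinner n (c j) g\<bar> + \<bar>score (\<theta> j)\<bar>))"
        using gaussian_vinner_moments(1)
        by (intro integrable_mult_right Bochner_Integration.integrable_add integrable_abs) auto
      fix g
      have "\<bar>joint_score j \<theta> g\<bar> \<le> h / \<sigma>\<^sup>2 * \<bar>vinner n (c j) g\<bar> + \<bar>score (\<theta> j)\<bar>"
        unfolding joint_score_def using h by (intro order_trans[OF abs_triangle_ineq]) (simp add: abs_mult)
      then show "\<bar>F \<theta> (vadd n (pt \<theta>) g)\<bar> \<le> B * (h / \<sigma>\<^sup>2 * \<bar>vinner n (c j) g\<bar> + \<bar>score (\<theta> j)\<bar>)"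
        unfolding F abs_mult by (intro mult_mono B B0) auto
    qed
    also have "\<dots> = B * (h / \<sigma>\<^sup>2 * (\<integral>g. \<bar>vinner n (c j) g\<bar> \<partial>noise) + \<bar>score (\<theta> j)\<bar>)"
      using gaussian_vinner_moments(1) by (simp add: noise.prob_space[unfolded space_gaussian])
    finally show ?thesis .
  qed
  have nle: "\<bar>\<integral>z. norm (K \<theta> z) \<partial>noise\<bar> \<le> \<bar>B * (h / \<sigma>\<^sup>2 * (\<integral>g. \<bar>vinner n (c j) g\<bar> \<partial>noise) + \<bar>score (\<theta> j)\<bar>)\<bar>" for \<theta>
    by (subst abs_of_nonneg) (simp, rule order_trans[OF K_le abs_ge_self])
  have K_pair: "integrable (priors \<Otimes>\<^sub>M noise) (\<lambda>(\<theta>, z). K \<theta> z)"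
  proof (rule Fubini_integrable[OF K_meas])
    have "integrable priors (\<lambda>\<theta>. \<bar>score (\<theta> j)\<bar>)"
      using integral_component(1)[OF j score_moments(1)] by (rule integrable_abs)
    then have i: "integrable priors (\<lambda>\<theta>. B * (h / \<sigma>\<^sup>2 * (\<integral>g. \<bar>vinner n (c j) g\<bar> \<partial>noise) + \<bar>score (\<theta> j)\<bar>))"
      by (intro integrable_mult_right Bochner_Integration.integrable_add) auto
    show "integrable priors (\<lambda>\<theta>. \<integral>z. norm (case (\<theta>, z) of (\<theta>, z) \<Rightarrow> K \<theta> z) \<partial>noise)"
      by (rule Bochner_Integration.integrable_bound[OF i])
        (use nle in \<open>auto intro!: AE_I2\<close>)
  qed (use K_int in auto)
  show "integrable priors (\<lambda>\<theta>. \<integral>g. \<phi> (vadd n (pt \<theta>) g) * joint_score j \<theta> g \<partial>noise)"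
    using integrable_fst'[OF K_pair] by (simp add: K_eq)
  have zero: "(\<integral>\<theta>. K \<theta> z \<partial>priors) = 0" for z
  \<comment> \<open>A non-integrable section has Bochner integral 0 by convention, so the claim
    holds for every \<open>z\<close> and not merely almost every one.\<close>
  proof (cases "integrable priors (\<lambda>\<theta>. K \<theta> z)")
    case True
    have S: "insert j (S - {j}) = S" using j by auto
    have "(\<integral>\<theta>. K \<theta> z \<partial>priors) = (\<integral>\<theta>. \<integral>t. K (\<theta>(j := t)) z \<partial>prior \<partial>PiM (S - {j}) (\<lambda>_. prior))"
      using prior.product_integral_insert[of "S - {j}" j "\<lambda>\<theta>. K \<theta> z"] True unfolding S by simp
    also have "\<dots> = 0"
      unfolding K_def F_def using integral_prior_coordinate[OF j, of _ z]
      by (simp add: mult.left_commute[of _ "\<phi> z"] del: fun_upd_apply)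
    finally show ?thesis .
  qed (simp add: not_integrable_integral_eq)
  show "(\<integral>\<theta>. \<integral>g. \<phi> (vadd n (pt \<theta>) g) * joint_score j \<theta> g \<partial>noise \<partial>priors) = 0"
    using Fubini_integral[OF K_pair] by (simp add: zero K_eq)
qed

text \<open>The error is paired with the sum of \<open>joint_score j \<theta> g\<close> times
  \<open>y j\<close>. The estimator's part averages to 0 by \<open>joint_score_orthogonal\<close>,
  the parameter's part to \<open>h\<close> per column. The noise and prior parts of the test vector
  have mean squares \<open>card S * h\<^sup>2 / \<sigma>\<^sup>2\<close> and at most
  \<open>10 * card S / D\<^sup>2\<close>. Cauchy-Schwarz is replaced by a pointwise inequality with
  parameter \<tau>, which is then integrated.\<close>

lemma average_error_lower_bound:
  assumes M [measurable]: "M \<in> borel_Rn n \<rightarrow>\<^sub>M borel_Rn n" and b: "\<And>z i. i < n \<Longrightarrow> \<bar>M z i\<bar> \<le> b"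
  shows "ennreal (real (card S) * h\<^sup>2 / (2 * (h\<^sup>2 / \<sigma>\<^sup>2 + 10 / D\<^sup>2))) \<le>
    (\<integral>\<^sup>+\<theta>. \<integral>\<^sup>+g. ennreal ((vnorm n (vsub n (M (vadd n (pt \<theta>) g)) (pt \<theta>)))\<^sup>2) \<partial>noise \<partial>priors)"
proof -
  interpret noise: prob_space noise by (rule prob_space_gaussian)
  interpret priors: prob_space priors by (rule prob_space_priors)
  have const: "has_bochner_integral N (\<lambda>_. a) a" if "prob_space N" for a :: real and N :: "(nat \<Rightarrow> real) measure"
    using that by (simp add: has_bochner_integral_iff prob_space.prob_space prob_space_def finite_measure.integrable_const)
  define q where "q = h\<^sup>2 / \<sigma>\<^sup>2 + 10 / D\<^sup>2"
  \<comment> \<open>The maximiser of \<open>2 * \<tau> * h - 2 * \<tau>\<^sup>2 * q\<close>, with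
    maximum \<open>h\<^sup>2 / (2 * q)\<close> per column.\<close>
  define \<tau> where "\<tau> = h / (2 * q)"
  have q: "0 < q" using h \<sigma> D by (simp add: q_def add_pos_pos)
  have Mi [measurable]: "i < n \<Longrightarrow> (\<lambda>z. M z i) \<in> borel_measurable (borel_Rn n)" for i
    using measurable_compose[OF M measurable_component_singleton[of i "{..<n}" "\<lambda>_. borel"]] by simp
  define \<phi> where "\<phi> j z = vinner n (M z) (y j)" for j z
  have \<phi>_meas: "\<phi> j \<in> borel_measurable (borel_Rn n)" for j
    unfolding \<phi>_def[abs_def] by measurable
  have \<phi>_bound: "\<bar>\<phi> j z\<bar> \<le> (\<Sum>i<n. b * \<bar>y j i\<bar>)" for j z
    unfolding \<phi>_def vinner_def
    by (rule order_trans[OF sum_abs]) (auto simp: abs_mult intro!: sum_mono mult_right_mono b)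
  note orth = joint_score_orthogonal[OF \<phi>_meas \<phi>_bound]
  define \<Phi> where "\<Phi> j \<theta> = (\<integral>g. \<phi> j (vadd n (pt \<theta>) g) * joint_score j \<theta> g \<partial>noise)" for j \<theta>
  define A where "A g = (\<Sum>j\<in>S. \<Sum>l\<in>S. (h / \<sigma>\<^sup>2)\<^sup>2 * vinner n (y j) (y l) * (vinner n (c j) g * vinner n (c l) g))" for g
  define B where "B \<theta> = (\<Sum>j\<in>S. \<Sum>l\<in>S. vinner n (y j) (y l) * (score (\<theta> j) * score (\<theta> l)))" for \<theta> :: "nat \<Rightarrow> real"
  define s where "s = (\<integral>t. score t * score t \<partial>prior)"
  \<comment> \<open>The trace identity: pairing the expansion of \<open>y j\<close> with
    \<open>c j\<close> gives 1 whatever the Gram matrix of the columns.\<close>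
  have diag: "(\<Sum>l\<in>S. vinner n (y j) (y l) * vinner n (c j) (c l)) = 1" if "j \<in> S" for j
  proof -
    have "vinner n (y j) (c j) = (\<Sum>i<n. (\<Sum>l\<in>S. vinner n (y j) (y l) * c l i) * c j i)"
      unfolding vinner_def[of n "y j" "c j"] using expand[OF that] by (intro sum.cong) auto
    also have "\<dots> = (\<Sum>l\<in>S. vinner n (y j) (y l) * vinner n (c j) (c l))"
      unfolding sum_distrib_right by (subst sum.swap) (simp add: vinner_def[of n "c j"] sum_distrib_left mult_ac)
    finally show ?thesis using dual[OF that that] by simp
  qed
  have A: "has_bochner_integral noise A (h\<^sup>2 / \<sigma>\<^sup>2 * real (card S))"
  proof -
    have "has_bochner_integral noise A
      (\<Sum>j\<in>S. \<Sum>l\<in>S. (h / \<sigma>\<^sup>2)\<^sup>2 * vinner n (y j) (y l) * (\<sigma>\<^sup>2 * vinner n (c j) (c l)))"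
      unfolding A_def[abs_def] using gaussian_vinner_moments(3,4)
      by (intro has_bochner_integral_sum has_bochner_integral_mult_right) (simp add: has_bochner_integral_iff)
    also have "(\<Sum>j\<in>S. \<Sum>l\<in>S. (h / \<sigma>\<^sup>2)\<^sup>2 * vinner n (y j) (y l) * (\<sigma>\<^sup>2 * vinner n (c j) (c l))) =
      (\<Sum>j\<in>S. ((h / \<sigma>\<^sup>2)\<^sup>2 * \<sigma>\<^sup>2) * (\<Sum>l\<in>S. vinner n (y j) (y l) * vinner n (c j) (c l)))"
      by (simp add: sum_distrib_left mult_ac)
    also have "\<dots> = h\<^sup>2 / \<sigma>\<^sup>2 * real (card S)"
      using \<sigma> by (simp add: diag power_divide power2_eq_square)
    finally show ?thesis .
  qed
  have B: "has_bochner_integral priors B (\<Sum>j\<in>S. vinner n (y j) (y j) * s)"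
  proof -
    have "has_bochner_integral priors B (\<Sum>j\<in>S. \<Sum>l\<in>S. vinner n (y j) (y l) * (if j = l then s else 0))"
      unfolding B_def[abs_def] s_def using product_moments(3,4)[OF prob_space_prior fin _ _ score_moments(1,5,2)]
      by (intro has_bochner_integral_sum has_bochner_integral_mult_right) (simp add: has_bochner_integral_iff)
    then show ?thesis by (simp add: if_distrib cong: if_cong)
  qed
  have Bs: "(\<Sum>j\<in>S. vinner n (y j) (y j) * s) \<le> real (card S) * (10 / D\<^sup>2)"
  proof -
    have "vinner n (y j) (y j) * s \<le> 1 / D\<^sup>2 * 10" if "j \<in> S" for j
      using short[OF that] score_moments(6) by (intro mult_mono) (auto simp: s_def)
    then show ?thesis using sum_bounded_above[of S "\<lambda>j. vinner n (y j) (y j) * s" "1 / D\<^sup>2 * 10"] by simp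
  qed
  define Q where "Q \<theta> g = 2 * \<tau> * ((\<Sum>j\<in>S. \<phi> j (vadd n (pt \<theta>) g) * joint_score j \<theta> g)
      - (\<Sum>j\<in>S. h * \<theta> j * joint_score j \<theta> g)) - 2 * \<tau>\<^sup>2 * (A g + B \<theta>)" for \<theta> g
  define J where "J \<theta> = 2 * \<tau> * ((\<Sum>j\<in>S. \<Phi> j \<theta>) - (\<Sum>j\<in>S. h * \<theta> j * score (\<theta> j)))
      - 2 * \<tau>\<^sup>2 * (h\<^sup>2 / \<sigma>\<^sup>2 * real (card S) + B \<theta>)" for \<theta>
  have Q_int: "has_bochner_integral noise (Q \<theta>) (J \<theta>)" for \<theta>
  proof -
    have "has_bochner_integral noise (joint_score j \<theta>) (h * 0 / \<sigma>\<^sup>2 + score (\<theta> j))" for j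
      unfolding joint_score_def[abs_def] using gaussian_vinner_moments(1,2)
      by (intro has_bochner_integral_add has_bochner_integral_divide_zero has_bochner_integral_mult_right
          const prob_space_gaussian) (simp add: has_bochner_integral_iff)
    then have 1: "has_bochner_integral noise (joint_score j \<theta>) (score (\<theta> j))" for j by simp
    show ?thesis
      unfolding Q_def[abs_def] J_def \<Phi>_def using orth(1)
      by (intro has_bochner_integral_diff has_bochner_integral_mult_right has_bochner_integral_sum 1
          has_bochner_integral_add A const prob_space_gaussian) (simp add: has_bochner_integral_iff)
  qed
  have J_int: "has_bochner_integral priors J (2 * \<tau> * ((\<Sum>j\<in>S. 0) - (\<Sum>j\<in>S. h * (-1)))
      - 2 * \<tau>\<^sup>2 * (h\<^sup>2 / \<sigma>\<^sup>2 * real (card S) + (\<Sum>j\<in>S. vinner n (y j) (y j) * s)))"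
    unfolding J_def[abs_def] mult.assoc[of h]
    using orth(2,3) integral_component[OF _ score_moments(3)] score_moments(4)
    by (intro has_bochner_integral_diff has_bochner_integral_mult_right has_bochner_integral_sum
        has_bochner_integral_add B const prob_space_priors) (simp_all add: has_bochner_integral_iff \<Phi>_def)
  have pointwise: "Q \<theta> g \<le> (vnorm n (vsub n (M (vadd n (pt \<theta>) g)) (pt \<theta>)))\<^sup>2" for \<theta> g
  proof -
    define w where "w = vsub n (M (vadd n (pt \<theta>) g)) (pt \<theta>)"
    define U where "U i = (\<Sum>j\<in>S. h / \<sigma>\<^sup>2 * vinner n (c j) g * y j i)" for i
    define V where "V i = (\<Sum>j\<in>S. score (\<theta> j) * y j i)" for i
    have U: "vinner n U U = A g"
    proof -
      have "vinner n U U = (\<Sum>i<n. \<Sum>j\<in>S. \<Sum>l\<in>S. (h / \<sigma>\<^sup>2)\<^sup>2 * (y j i * y l i) * (vinner n (c j) g * vinner n (c l) g))"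
        unfolding vinner_def[of n U] U_def sum_product
        by (intro sum.cong refl) (simp add: power2_eq_square mult_ac)
      also have "\<dots> = A g"
        unfolding A_def vinner_def[of n "y _"] sum_distrib_left sum_distrib_right
        by (subst sum.swap, rule sum.cong[OF refl], subst sum.swap) simp
      finally show ?thesis .
    qed
    have V: "vinner n V V = B \<theta>"
    proof -
      have "vinner n V V = (\<Sum>i<n. \<Sum>j\<in>S. \<Sum>l\<in>S. (y j i * y l i) * (score (\<theta> j) * score (\<theta> l)))"
        unfolding vinner_def[of n V] V_def sum_product
        by (intro sum.cong refl) (simp add: mult_ac)
      also have "\<dots> = B \<theta>"
        unfolding B_def vinner_def[of n "y _"] sum_distrib_left sum_distrib_right
        by (subst sum.swap, rule sum.cong[OF refl], subst sum.swap) simp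
      finally show ?thesis .
    qed
    have wy: "vinner n w (y j) = \<phi> j (vadd n (pt \<theta>) g) - h * \<theta> j" if "j \<in> S" for j
    proof -
      have "(\<Sum>l\<in>S. \<theta> l * vinner n (c l) (y j)) = (\<Sum>l\<in>S. if l = j then \<theta> l else 0)"
        using that by (intro sum.cong) (auto simp: vinner_commute[of n "c _"] dual)
      then show ?thesis using that by (simp add: w_def \<phi>_def vinner_pt)
    qed
    have "vinner n w (\<lambda>i. U i + V i) = (\<Sum>j\<in>S. vinner n w (y j) * joint_score j \<theta> g)"
    proof -
      have "U i + V i = (\<Sum>j\<in>S. joint_score j \<theta> g * y j i)" for i
        by (simp add: U_def V_def joint_score_def sum.distrib algebra_simps)
      then show ?thesis
        by (simp add: vinner_def[of n w] sum_distrib_left sum_distrib_right mult_ac)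
          (subst sum.swap, simp add: mult_ac)
    qed
    also have "\<dots> = (\<Sum>j\<in>S. \<phi> j (vadd n (pt \<theta>) g) * joint_score j \<theta> g) - (\<Sum>j\<in>S. h * \<theta> j * joint_score j \<theta> g)"
      unfolding sum_subtractf[symmetric] by (intro sum.cong refl) (simp add: wy algebra_simps)
    finally have "Q \<theta> g = 2 * \<tau> * vinner n w (\<lambda>i. U i + V i) - 2 * \<tau>\<^sup>2 * (vinner n U U + vinner n V V)"
      by (simp add: Q_def U V)
    also have "\<dots> = (\<Sum>i<n. 2 * \<tau> * (w i * (U i + V i)) - 2 * \<tau>\<^sup>2 * (U i * U i + V i * V i))"
      by (simp add: vinner_def sum_distrib_left sum_subtractf sum.distrib algebra_simps)
    also have "\<dots> \<le> (\<Sum>i<n. w i * w i)"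
    proof (rule sum_mono)
      fix i
      \<comment> \<open>Bounding the noise part \<open>U\<close> and the prior part \<open>V\<close>
        separately costs a factor 2 but leaves no mixed term to integrate.\<close>
      have "w i * w i - (2 * \<tau> * (w i * (U i + V i)) - 2 * \<tau>\<^sup>2 * (U i * U i + V i * V i)) =
        (w i - \<tau> * (U i + V i))\<^sup>2 + (\<tau> * (U i - V i))\<^sup>2"
        by (simp add: power2_eq_square algebra_simps)
      then show "2 * \<tau> * (w i * (U i + V i)) - 2 * \<tau>\<^sup>2 * (U i * U i + V i * V i) \<le> w i * w i"
        using zero_le_power2[of "w i - \<tau> * (U i + V i)"] zero_le_power2[of "\<tau> * (U i - V i)"] by linarith
    qed
    finally show ?thesis by (simp add: vnorm_power2 w_def vinner_def)
  qed
  \<comment> \<open>\<open>ennreal\<close> truncates negative values to 0, which only raises the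
    integral; so lower bounds survive although \<open>Q\<close> and \<open>J\<close> may be
    negative.\<close>
  have nn: "ennreal r \<le> (\<integral>\<^sup>+x. ennreal (f x) \<partial>N)" if f: "has_bochner_integral N f r" for N and f :: "(nat \<Rightarrow> real) \<Rightarrow> real" and r
  proof -
    have "r \<le> (\<integral>x. max 0 (f x) \<partial>N)"
      using f by (auto simp: has_bochner_integral_iff intro!: integral_mono)
    then have "ennreal r \<le> ennreal (\<integral>x. max 0 (f x) \<partial>N)" by (rule ennreal_leI)
    also have "\<dots> = (\<integral>\<^sup>+x. ennreal (max 0 (f x)) \<partial>N)"
      using f by (intro nn_integral_eq_integral[symmetric]) (auto simp: has_bochner_integral_iff)
    also have "\<dots> = (\<integral>\<^sup>+x. ennreal (f x) \<partial>N)" by (intro nn_integral_cong) (simp add: ennreal_max_0)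
    finally show ?thesis .
  qed
  have "real (card S) * h\<^sup>2 / (2 * q) = 2 * \<tau> * (h * real (card S)) - 2 * \<tau>\<^sup>2 * (q * real (card S))"
    using q by (simp add: \<tau>_def field_simps power2_eq_square)
  also have "\<dots> \<le> 2 * \<tau> * (h * real (card S)) - 2 * \<tau>\<^sup>2 * (h\<^sup>2 / \<sigma>\<^sup>2 * real (card S) + (\<Sum>j\<in>S. vinner n (y j) (y j) * s))"
    using Bs by (intro diff_left_mono mult_left_mono) (auto simp: q_def algebra_simps)
  finally have "ennreal (real (card S) * h\<^sup>2 / (2 * q)) \<le> ennreal (2 * \<tau> * ((\<Sum>j\<in>S. 0) - (\<Sum>j\<in>S. h * (-1)))
      - 2 * \<tau>\<^sup>2 * (h\<^sup>2 / \<sigma>\<^sup>2 * real (card S) + (\<Sum>j\<in>S. vinner n (y j) (y j) * s)))"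
    by (intro ennreal_leI) (simp add: mult.commute)
  also have "\<dots> \<le> (\<integral>\<^sup>+\<theta>. ennreal (J \<theta>) \<partial>priors)" by (rule nn[OF J_int])
  also have "\<dots> \<le> (\<integral>\<^sup>+\<theta>. \<integral>\<^sup>+g. ennreal (Q \<theta> g) \<partial>noise \<partial>priors)"
    by (intro nn_integral_mono nn Q_int)
  also have "\<dots> \<le> (\<integral>\<^sup>+\<theta>. \<integral>\<^sup>+g. ennreal ((vnorm n (vsub n (M (vadd n (pt \<theta>) g)) (pt \<theta>)))\<^sup>2) \<partial>noise \<partial>priors)"
    by (intro nn_integral_mono ennreal_leI pointwise)
  finally show ?thesis unfolding q_def .
qed

end

section \<open>From the average over a box to the minimax risk\<close>

lemma scaled_box_in_lq_ball:
  assumes S: "S \<subseteq> {..<p}" "S \<noteq> {}" and q: "0 < q" and \<theta>: "\<And>j. j \<in> S \<Longrightarrow> \<bar>\<theta> j\<bar> \<le> (1::real)"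
  shows "(\<lambda>j\<in>{..<p}. if j \<in> S then real (card S) powr (- 1 / q) * \<theta> j else 0) \<in> lq_ball p q"
proof -
  define h where "h = real (card S) powr (- 1 / q)"
  have fin: "finite S" using S finite_subset by blast
  then have k: "0 < card S" using S by (simp add: card_gt_0_iff)
  have "h powr q = real (card S) powr (- 1)"
    unfolding h_def powr_powr using q by simp
  then have h: "0 \<le> h" "h powr q = 1 / real (card S)"
    using k by (simp_all add: h_def powr_minus_divide)
  have "(\<Sum>j<p. \<bar>if j \<in> S then h * \<theta> j else 0\<bar> powr q) = (\<Sum>j\<in>S. \<bar>h * \<theta> j\<bar> powr q)"
    using S(1) by (intro sum.mono_neutral_cong_right) auto
  also have "\<dots> \<le> (\<Sum>j\<in>S. h powr q)"
    using \<theta> h q mult_left_mono[of "\<bar>\<theta> _\<bar>" 1 h] by (intro sum_mono powr_mono2) (auto simp: abs_mult)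
  also have "\<dots> = 1" using k h by simp
  finally have "(\<Sum>j<p. \<bar>if j \<in> S then h * \<theta> j else 0\<bar> powr q) powr (1 / q) \<le> 1 powr (1 / q)"
    using q by (intro powr_mono2) (auto intro: sum_nonneg)
  then show ?thesis unfolding h_def[symmetric] by (simp add: lq_ball_def lq_norm_def Rn_def)
qed

text \<open>The worst case over \<open>K\<close> dominates the average over a prior carried by
  \<open>K\<close>. The prior lives on the box of the spread columns, which \<open>h\<close> scales
  into the image of the lq ball.\<close>

lemma minimax_risk_lower_bound:
  fixes X :: "nat \<Rightarrow> nat \<Rightarrow> real"
  assumes js: "spread_columns n p (\<lambda>j i. X i j) D js" "js \<noteq> []" and D: "0 < D" and \<sigma>: "0 < \<sigma>" and q: "0 < q"
  defines "k \<equiv> length js" and "h \<equiv> real (length js) powr (- 1 / q)"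
  shows "ennreal (real k * h\<^sup>2 / (2 * (h\<^sup>2 / \<sigma>\<^sup>2 + 10 / D\<^sup>2))) \<le> minimax_risk n (mat_vec n p X ` lq_ball p q) \<sigma>"
  unfolding minimax_risk_def
proof (rule INF_greatest)
  fix M assume "M \<in> estimators n"
  then have M [measurable]: "M \<in> borel_Rn n \<rightarrow>\<^sub>M borel_Rn n" by (simp add: estimators_def)
  let ?K = "mat_vec n p X ` lq_ball p q"
  define S where "S = set js"
  have S: "S \<subseteq> {..<p}" "S \<noteq> {}" "card S = k"
    using js by (auto simp: S_def k_def spread_columns_def distinct_card)
  have h: "0 < h" using js by (simp add: h_def)
  from spread_columns_dual_basis[OF js(1) D] obtain y where y:
    "\<forall>i\<in>S. \<forall>j\<in>S. vinner n (y i) (\<lambda>i. X i j) = (if i = j then 1 else 0)"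
    "\<forall>j\<in>S. vinner n (y j) (y j) \<le> 1 / D\<^sup>2"
    "\<forall>j\<in>S. \<forall>i<n. y j i = (\<Sum>l\<in>S. vinner n (y j) (y l) * X i l)"
    unfolding S_def by blast
  interpret van_trees n S "\<lambda>j i. X i j" y h \<sigma> D
    by unfold_locales (use y h \<sigma> D in \<open>auto simp: S_def\<close>)
  \<comment> \<open>\<open>b\<close> bounds all coordinates of all points of the box. Clipping an
    estimator to [-b, b] does not increase its error there and supplies the boundedness required by
    \<open>average_error_lower_bound\<close>.\<close>
  define b where "b = (\<Sum>i<n. \<Sum>j<p. h * \<bar>X i j\<bar>)"
  define M' where "M' z = (\<lambda>i\<in>{..<n}. max (- b) (min b (M z i)))" for z
  have b: "0 \<le> b" using h by (auto simp: b_def intro!: sum_nonneg)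
  have Mi [measurable]: "i < n \<Longrightarrow> (\<lambda>z. M z i) \<in> borel_measurable (borel_Rn n)" for i
    using measurable_compose[OF M measurable_component_singleton[of i "{..<n}" "\<lambda>_. borel"]] by simp
  have M'_meas: "M' \<in> borel_Rn n \<rightarrow>\<^sub>M borel_Rn n"
    unfolding M'_def by (rule measurable_restrict) simp
  have M'_bound: "\<bar>M' z i\<bar> \<le> b" if "i < n" for z i using that b by (auto simp: M'_def)
  have AE: "AE \<theta> in priors. \<forall>j\<in>S. \<bar>\<theta> j\<bar> \<le> 1"
    by (intro eventually_ball_finite ballI AE_PiM_component prob_space_prior AE_prior) auto
  have "(\<integral>\<^sup>+g. ennreal ((vnorm n (vsub n (M' (vadd n (pt \<theta>) g)) (pt \<theta>)))\<^sup>2) \<partial>noise) \<le> risk n M ?K \<sigma>"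
    if \<theta>: "\<forall>j\<in>S. \<bar>\<theta> j\<bar> \<le> 1" for \<theta>
  proof -
    define \<Theta> where "\<Theta> = (\<lambda>j\<in>{..<p}. if j \<in> S then h * \<theta> j else 0)"
    have "\<Theta> \<in> lq_ball p q"
      using scaled_box_in_lq_ball[OF S(1,2) q, of \<theta>] \<theta> unfolding \<Theta>_def h_def S(3) k_def by blast
    moreover have "pt \<theta> = mat_vec n p X \<Theta>"
    proof -
      have "(\<Sum>j<p. X i j * \<Theta> j) = (\<Sum>j\<in>S. X i j * (h * \<theta> j))" for i
        using S(1) by (intro sum.mono_neutral_cong_right) (auto simp: \<Theta>_def)
      then show ?thesis by (simp add: pt_def mat_vec_def sum_distrib_left mult_ac fun_eq_iff)
    qed
    ultimately have "pt \<theta> \<in> ?K" by blast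
    have pt_bound: "\<bar>pt \<theta> i\<bar> \<le> b" if "i < n" for i
    proof -
      have "\<bar>pt \<theta> i\<bar> \<le> (\<Sum>j\<in>S. h * \<bar>X i j\<bar>)"
        using that \<theta> h unfolding pt_def
        by (auto simp: abs_mult sum_distrib_left[symmetric] intro!: mult_left_mono order_trans[OF sum_abs] sum_mono mult_left_le_one_le)
      also have "\<dots> \<le> (\<Sum>j<p. h * \<bar>X i j\<bar>)" using S h by (intro sum_mono2) auto
      also have "\<dots> \<le> b" unfolding b_def using that h
        by (intro member_le_sum[of i "{..<n}" "\<lambda>i. \<Sum>j<p. h * \<bar>X i j\<bar>"]) (auto intro!: sum_nonneg)
      finally show ?thesis .
    qed
    have clip: "(vnorm n (vsub n (M' z) (pt \<theta>)))\<^sup>2 \<le> (vnorm n (vsub n (M z) (pt \<theta>)))\<^sup>2" for z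
    proof -
      have "\<bar>M' z i - pt \<theta> i\<bar> \<le> \<bar>M z i - pt \<theta> i\<bar>" if "i < n" for i
        using pt_bound[OF that] that unfolding M'_def restrict_apply lessThan_iff if_P[OF that] by linarith
      then have "(M' z i - pt \<theta> i)\<^sup>2 \<le> (M z i - pt \<theta> i)\<^sup>2" if "i < n" for i
        using that abs_le_square_iff by blast
      then show ?thesis unfolding vnorm_power2 unfolding vinner_def
        by (intro sum_mono) (simp add: vsub_def flip: power2_eq_square)
    qed
    have "(\<integral>\<^sup>+g. ennreal ((vnorm n (vsub n (M' (vadd n (pt \<theta>) g)) (pt \<theta>)))\<^sup>2) \<partial>noise) \<le> err n M (pt \<theta>) \<sigma>"
      unfolding err_def by (intro nn_integral_mono ennreal_leI clip)
    also have "\<dots> \<le> risk n M ?K \<sigma>" unfolding risk_def by (rule SUP_upper) fact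
    finally show ?thesis .
  qed
  then have "(\<integral>\<^sup>+\<theta>. \<integral>\<^sup>+g. ennreal ((vnorm n (vsub n (M' (vadd n (pt \<theta>) g)) (pt \<theta>)))\<^sup>2) \<partial>noise \<partial>priors)
      \<le> (\<integral>\<^sup>+\<theta>. risk n M ?K \<sigma> \<partial>priors)"
    using AE by (intro nn_integral_mono_AE) auto
  also have "\<dots> = risk n M ?K \<sigma>"
    using prob_space.emeasure_space_1[OF prob_space_priors] by simp
  finally show "ennreal (real k * h\<^sup>2 / (2 * (h\<^sup>2 / \<sigma>\<^sup>2 + 10 / D\<^sup>2))) \<le> risk n M ?K \<sigma>"
    using average_error_lower_bound[OF M'_meas M'_bound] unfolding S(3) by (rule order_trans[rotated])
qed

section \<open>Rounding of sparse combinations\<close>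

lemma powr_le_one_mult:
  fixes x q :: real
  assumes "0 \<le> x" "x \<le> 1" "0 < q" "q \<le> 1"
  shows "x \<le> x powr q"
proof (cases "x = 0")
  case False
  then have "x powr 1 \<le> x powr q" using assms by (intro powr_mono') auto
  then show ?thesis using False assms by simp
qed simp

text \<open>The left side is the variance of unbiased rounding to a neighbouring integer. It is at
  most 1, and for \<open>\<bar>x\<bar> \<le> 1\<close> one of its two factors is at most
  \<open>\<bar>x\<bar>\<close>.\<close>

lemma frac_variance_le:
  fixes x q :: real
  assumes q: "0 < q" "q \<le> 1"
  shows "frac x * (1 - frac x) \<le> \<bar>x\<bar> powr q"
proof -
  have f: "0 \<le> frac x" "frac x < 1" using frac_lt_1 by auto
  show ?thesis
  proof (cases "\<bar>x\<bar> \<le> 1")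
    case False
    have "frac x * (1 - frac x) \<le> 1 * 1" using f by (intro mult_mono) auto
    also have "1 * 1 \<le> \<bar>x\<bar> powr q" using ge_one_powr_ge_zero[of "\<bar>x\<bar>" q] False q by simp
    finally show ?thesis .
  next
    case True
    have "frac x * (1 - frac x) \<le> \<bar>x\<bar>"
    proof (cases "0 \<le> x")
      case True
      then have "frac x \<le> x" by (simp add: frac_def)
      then show ?thesis using f True mult_mono[of "frac x" x "1 - frac x" 1] by simp
    next
      case False
      then have "floor x = -1" using True by (intro floor_unique) auto
      then have "1 - frac x = \<bar>x\<bar>" using False by (simp add: frac_def)
      then show ?thesis using f mult_right_mono[of "frac x" 1 "\<bar>x\<bar>"] by simp
    qed
    also have "\<bar>x\<bar> \<le> \<bar>x\<bar> powr q" using True q by (intro powr_le_one_mult) auto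
    finally show ?thesis .
  qed
qed

text \<open>The left side is the mean of the penalty after unbiased rounding. For
  \<open>1 \<le> \<bar>x\<bar>\<close> both neighbours have modulus at most
  \<open>2 * \<bar>x\<bar>\<close>; otherwise one neighbour is 0 and the other is hit with
  probability \<open>\<bar>x\<bar>\<close>, at most \<open>\<bar>x\<bar> powr q\<close>.\<close>

lemma rounded_powr_le:
  fixes x q :: real
  assumes q: "0 < q" "q \<le> 1"
  shows "(1 - frac x) * \<bar>of_int \<lfloor>x\<rfloor>\<bar> powr q + frac x * \<bar>of_int (\<lfloor>x\<rfloor> + 1)\<bar> powr q \<le> 2 * \<bar>x\<bar> powr q"
    (is "?l \<le> _")
proof -
  have f: "0 \<le> frac x" "frac x < 1" using frac_lt_1 by auto
  have xp: "x = of_int \<lfloor>x\<rfloor> + frac x" by (simp add: frac_def)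
  have two: "(2 * \<bar>x\<bar>) powr q \<le> 2 * \<bar>x\<bar> powr q"
    using powr_mono[of q 1 "2::real"] q by (simp add: powr_mult mult_right_mono)
  have big: "?l \<le> 2 * \<bar>x\<bar> powr q" if "\<bar>of_int \<lfloor>x\<rfloor>\<bar> \<le> 2 * \<bar>x\<bar>" "\<bar>of_int (\<lfloor>x\<rfloor> + 1)\<bar> \<le> 2 * \<bar>x\<bar>"
  proof -
    have "?l \<le> (1 - frac x) * (2 * \<bar>x\<bar> powr q) + frac x * (2 * \<bar>x\<bar> powr q)"
      using that q f by (intro add_mono mult_left_mono order_trans[OF powr_mono2 two]) auto
    then show ?thesis by (simp add: algebra_simps)
  qed
  consider "1 \<le> \<bar>x\<bar>" | "0 \<le> x" "x < 1" | "-1 < x" "x < 0" by linarith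
  then show ?thesis
  proof cases
    case 1
    then show ?thesis
      using of_int_floor_le[of x] real_of_int_floor_add_one_gt[of x] unfolding of_int_add of_int_1
      by (intro big[unfolded of_int_add of_int_1]) linarith+
  next
    case 2
    then have "\<lfloor>x\<rfloor> = 0" by (intro floor_unique) auto
    then show ?thesis using powr_le_one_mult[of x q] 2 q by (simp add: frac_def)
  next
    case 3
    then have "\<lfloor>x\<rfloor> = -1" by (intro floor_unique) auto
    then show ?thesis using powr_le_one_mult[of "- x" q] 3 q by (simp add: frac_def)
  qed
qed

text \<open>The factors are matched: if \<open>vinner n v v \<le> 2 * vinner n v g\<close>, the
  value is at least \<open>vinner n v v / 2\<close>, while the exponential of
  \<open>discrepancy n g v / (4 * \<sigma>\<^sup>2)\<close> has mean exactly 1 under noise of level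
  \<open>\<sigma> > 0\<close>.\<close>

definition discrepancy :: "nat \<Rightarrow> (nat \<Rightarrow> real) \<Rightarrow> (nat \<Rightarrow> real) \<Rightarrow> real" where
  "discrepancy n g v = 2 * vinner n v g - vinner n v v / 2"

lemma mat_vec_update:
  assumes "m < p"
  shows "mat_vec n p Z (\<eta>(m := t)) = vadd n (mat_vec n p Z (\<eta>(m := 0))) (vscale n t (\<lambda>i. Z i m))"
proof -
  have "(\<Sum>j<p. Z i j * (\<eta>(m := t)) j) = (\<Sum>j\<in>{..<p} - {m}. Z i j * \<eta> j) + t * Z i m" for i t
    using assms by (subst sum.remove[of _ m]) (auto intro!: sum.cong)
  then show ?thesis
    by (auto simp: mat_vec_def vadd_def vscale_def fun_eq_iff simp del: fun_upd_apply)
qed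

text \<open>
  Rounding a coordinate at random to one of the two neighbouring multiples of \<open>\<tau>\<close>, without bias,
  changes the mean of the quadratic function \<open>discrepancy n g\<close> only by the variance; some outcome
  does at least as well as the mean.
\<close>

lemma round_coordinates:
  fixes \<theta> :: "nat \<Rightarrow> real"
  assumes q: "0 < q" "q \<le> 1" and pos: "0 < \<tau>" "0 \<le> s" "0 \<le> \<kappa>"
    and Z: "\<And>j. j < p \<Longrightarrow> vinner n (\<lambda>i. Z i j) (\<lambda>i. Z i j) \<le> \<delta>\<^sup>2" and "m \<le> p"
  shows "\<exists>z :: nat \<Rightarrow> int. (\<forall>j. \<bar>of_int (z j)\<bar> \<le> \<bar>\<theta> j\<bar> / \<tau> + 1) \<and>
    s * discrepancy n g (mat_vec n p Z \<theta>) - (s * \<delta>\<^sup>2 * \<tau>\<^sup>2 / 2 + 2 * \<kappa>) * (\<Sum>j<m. \<bar>\<theta> j / \<tau>\<bar> powr q)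
    \<le> s * discrepancy n g (mat_vec n p Z (\<lambda>j. if j < m then \<tau> * of_int (z j) else \<theta> j))
        - \<kappa> * (\<Sum>j<m. \<bar>of_int (z j)\<bar> powr q)"
  using \<open>m \<le> p\<close>
proof (induction m)
  case 0
  show ?case using pos by (intro exI[of _ "\<lambda>_. 0"]) simp
next
  case (Suc m)
  define C where "C = s * \<delta>\<^sup>2 * \<tau>\<^sup>2 / 2 + 2 * \<kappa>"
  obtain z :: "nat \<Rightarrow> int" where z: "\<And>j. \<bar>of_int (z j)\<bar> \<le> \<bar>\<theta> j\<bar> / \<tau> + 1"
    "s * discrepancy n g (mat_vec n p Z \<theta>) - C * (\<Sum>j<m. \<bar>\<theta> j / \<tau>\<bar> powr q)
      \<le> s * discrepancy n g (mat_vec n p Z (\<lambda>j. if j < m then \<tau> * of_int (z j) else \<theta> j))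
        - \<kappa> * (\<Sum>j<m. \<bar>of_int (z j)\<bar> powr q)"
    using Suc unfolding C_def by auto
  define \<eta> where "\<eta> = (\<lambda>j. if j < m then \<tau> * of_int (z j) else \<theta> j)"
  define G where "G t = discrepancy n g (mat_vec n p Z (\<eta>(m := t)))" for t
  define e where "e = vinner n (\<lambda>i. Z i m) (\<lambda>i. Z i m)"
  define x where "x = \<theta> m / \<tau>"
  define f where "f = frac x"
  have f: "0 \<le> f" "f < 1" using frac_lt_1 by (auto simp: f_def)
  have xf: "x = of_int \<lfloor>x\<rfloor> + f" by (simp add: f_def frac_def)
  \<comment> \<open>In one coordinate the function is quadratic, so unbiased rounding lowers its
    mean by exactly \<open>e / 2\<close> times the variance
    \<open>\<tau>\<^sup>2 * (f * (1 - f))\<close>.\<close>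
  obtain a b where G: "\<And>t. G t = a + b * t - e / 2 * t\<^sup>2"
  proof
    let ?a = "mat_vec n p Z (\<eta>(m := 0))"
    have m: "m < p" using Suc.prems by simp
    show "G t = (2 * vinner n ?a g - vinner n ?a ?a / 2) + (2 * vinner n (\<lambda>i. Z i m) g - vinner n (\<lambda>i. Z i m) ?a) * t - e / 2 * t\<^sup>2" for t
      unfolding G_def discrepancy_def mat_vec_update[OF m, of n Z \<eta> t] e_def
      by (simp add: vinner_commute[of n ?a "\<lambda>i. Z i m"] algebra_simps power2_eq_square)
  qed
  define H where "H i = s * G (\<tau> * of_int i) - \<kappa> * \<bar>of_int i\<bar> powr q" for i :: int
  have "s * G (\<tau> * x) - C * \<bar>x\<bar> powr q \<le> (1 - f) * H \<lfloor>x\<rfloor> + f * H (\<lfloor>x\<rfloor> + 1)"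
  proof -
    have "(1 - f) * G (\<tau> * of_int \<lfloor>x\<rfloor>) + f * G (\<tau> * of_int (\<lfloor>x\<rfloor> + 1)) = G (\<tau> * x) - e / 2 * \<tau>\<^sup>2 * (f * (1 - f))"
      by (subst (3) xf) (simp add: G field_simps power2_eq_square)
    moreover have "(1 - f) * H \<lfloor>x\<rfloor> + f * H (\<lfloor>x\<rfloor> + 1) =
      s * ((1 - f) * G (\<tau> * of_int \<lfloor>x\<rfloor>) + f * G (\<tau> * of_int (\<lfloor>x\<rfloor> + 1)))
      - \<kappa> * ((1 - f) * \<bar>of_int \<lfloor>x\<rfloor>\<bar> powr q + f * \<bar>of_int (\<lfloor>x\<rfloor> + 1)\<bar> powr q)"
      unfolding H_def by (simp add: algebra_simps del: of_int_add)
    ultimately have "(1 - f) * H \<lfloor>x\<rfloor> + f * H (\<lfloor>x\<rfloor> + 1) =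
      s * (G (\<tau> * x) - e / 2 * \<tau>\<^sup>2 * (f * (1 - f)))
      - \<kappa> * ((1 - f) * \<bar>of_int \<lfloor>x\<rfloor>\<bar> powr q + f * \<bar>of_int (\<lfloor>x\<rfloor> + 1)\<bar> powr q)"
      by simp
    moreover have "\<kappa> * ((1 - f) * \<bar>of_int \<lfloor>x\<rfloor>\<bar> powr q + f * \<bar>of_int (\<lfloor>x\<rfloor> + 1)\<bar> powr q) \<le> \<kappa> * (2 * \<bar>x\<bar> powr q)"
      using rounded_powr_le[OF q, of x] pos unfolding f_def by (intro mult_left_mono) auto
    moreover have "s * (e / 2 * \<tau>\<^sup>2 * (f * (1 - f))) \<le> s * (\<delta>\<^sup>2 / 2 * \<tau>\<^sup>2 * \<bar>x\<bar> powr q)"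
      using Z[of m] Suc.prems pos frac_variance_le[OF q, of x] f unfolding e_def f_def
      by (intro mult_left_mono mult_mono) auto
    moreover have "s * (G (\<tau> * x) - e / 2 * \<tau>\<^sup>2 * (f * (1 - f))) = s * G (\<tau> * x) - s * (e / 2 * \<tau>\<^sup>2 * (f * (1 - f)))"
      "C * \<bar>x\<bar> powr q = s * (\<delta>\<^sup>2 / 2 * \<tau>\<^sup>2 * \<bar>x\<bar> powr q) + \<kappa> * (2 * \<bar>x\<bar> powr q)"
      by (simp_all add: C_def algebra_simps)
    ultimately show ?thesis by linarith
  qed
  moreover have "(1 - f) * H \<lfloor>x\<rfloor> + f * H (\<lfloor>x\<rfloor> + 1) \<le> max (H \<lfloor>x\<rfloor>) (H (\<lfloor>x\<rfloor> + 1))"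
    using f convex_bound_le[of "H \<lfloor>x\<rfloor>" "max (H \<lfloor>x\<rfloor>) (H (\<lfloor>x\<rfloor> + 1))" "H (\<lfloor>x\<rfloor> + 1)" "1 - f" f] by simp
  ultimately have "s * G (\<tau> * x) - C * \<bar>x\<bar> powr q \<le> max (H \<lfloor>x\<rfloor>) (H (\<lfloor>x\<rfloor> + 1))" by (rule order_trans)
  then obtain i where i: "i = \<lfloor>x\<rfloor> \<or> i = \<lfloor>x\<rfloor> + 1" "s * G (\<tau> * x) - C * \<bar>x\<bar> powr q \<le> H i"
    unfolding le_max_iff_disj by blast
  have ib: "\<bar>of_int i\<bar> \<le> \<bar>\<theta> m\<bar> / \<tau> + 1"
  proof -
    have "\<bar>of_int i\<bar> \<le> \<bar>x\<bar> + 1" using i(1) f xf by auto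
    then show ?thesis using pos by (simp add: x_def abs_divide)
  qed
  have eq: "\<eta>(m := \<tau> * of_int i) = (\<lambda>j. if j < Suc m then \<tau> * of_int ((z(m := i)) j) else \<theta> j)"
    "\<eta>(m := \<tau> * x) = \<eta>"
    using pos by (auto simp: \<eta>_def x_def fun_eq_iff less_Suc_eq)
  have s: "(\<Sum>j<m. \<bar>of_int ((z(m := i)) j)\<bar> powr q) = (\<Sum>j<m. \<bar>of_int (z j)\<bar> powr q)"
    by (intro sum.cong) auto
  have "s * discrepancy n g (mat_vec n p Z \<theta>) - C * (\<Sum>j<Suc m. \<bar>\<theta> j / \<tau>\<bar> powr q)
    \<le> s * G (\<tau> * x) - \<kappa> * (\<Sum>j<m. \<bar>of_int (z j)\<bar> powr q) - C * \<bar>x\<bar> powr q"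
    using z(2)[folded \<eta>_def] unfolding G_def eq(2) sum.lessThan_Suc x_def[symmetric]
    by (simp add: distrib_left)
  also have "\<dots> \<le> s * G (\<tau> * of_int i) - \<kappa> * (\<Sum>j<Suc m. \<bar>of_int ((z(m := i)) j)\<bar> powr q)"
    using i(2) unfolding H_def sum.lessThan_Suc s by (simp add: algebra_simps)
  finally have "s * discrepancy n g (mat_vec n p Z \<theta>) - C * (\<Sum>j<Suc m. \<bar>\<theta> j / \<tau>\<bar> powr q)
    \<le> s * G (\<tau> * of_int i) - \<kappa> * (\<Sum>j<Suc m. \<bar>of_int ((z(m := i)) j)\<bar> powr q)" .
  moreover have "\<forall>j. \<bar>of_int ((z(m := i)) j)\<bar> \<le> \<bar>\<theta> j\<bar> / \<tau> + 1" using z(1) ib by simp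
  ultimately show ?case unfolding G_def eq(1) C_def by blast
qed

lemma sum_inverse_squares_le: "(\<Sum>i=1..m. 1 / (real i)\<^sup>2) \<le> 2 - 1 / real (Suc m)"
proof (cases "m = 0")
  case False
  then have "0 < m" by simp
  then have "(\<Sum>i=1..m. 1 / (real i)\<^sup>2) \<le> 2 - 1 / real m"
  proof (induction m rule: nat_induct_non_zero)
    case (Suc m)
    have "1 / (real (Suc m))\<^sup>2 \<le> 1 / (real m * real (Suc m))"
      using Suc.hyps by (intro divide_left_mono) (auto simp: power2_eq_square)
    also have "\<dots> = 1 / real m - 1 / real (Suc m)"
      using Suc.hyps by (simp add: field_simps)
    finally have "1 / (real (Suc m))\<^sup>2 \<le> 1 / real m - 1 / real (Suc m)" .
    then show ?case using Suc.IH by simp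
  qed simp
  also have "\<dots> \<le> 2 - 1 / real (Suc m)" using False by (simp add: frac_le)
  finally show ?thesis .
qed simp

text \<open>
  With \<open>\<kappa> = 3/q ln p\<close> one has \<open>\<kappa> q \<ge> 2\<close>, so \<open>i powr q \<ge> 1 + q ln i\<close> bounds the weight of the integer \<open>i\<close> by
  \<open>exp (- \<kappa>) / i\<^sup>2\<close>; and \<open>exp (- \<kappa>) \<le> 1 / (4 p)\<close> gives \<open>(1 + 1/p) ^ p\<close> for the product over the coordinates.
\<close>

lemma integer_weights_sum_le:
  fixes q :: real and p :: nat
  assumes q: "0 < q" "q \<le> 1" and p: "2 \<le> p"
  shows "(\<Sum>z\<in>PiE {..<p} (\<lambda>_. {- int N..int N}). exp (- (3 / q * ln p) * (\<Sum>j<p. \<bar>of_int (z j)\<bar> powr q))) \<le> 3"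
proof -
  define \<kappa> where "\<kappa> = 3 / q * ln p"
  define w where "w i = exp (- \<kappa> * \<bar>real_of_int i\<bar> powr q)" for i
  have "ln 2 \<le> ln (real p)" using p by simp
  then have lnp: "2 / 3 \<le> ln (real p)" using ln2_ge_two_thirds by linarith
  have \<kappa>q: "2 \<le> \<kappa> * q" using q lnp by (simp add: \<kappa>_def)
  have e\<kappa>: "exp (- \<kappa>) \<le> 1 / (4 * real p)"
  proof -
    have "3 * ln p \<le> \<kappa>" using q lnp by (simp add: \<kappa>_def field_simps mult_left_le)
    then have "exp (- \<kappa>) \<le> exp (- (3 * ln p))" by simp
    also have "\<dots> = 1 / real p ^ 3"
      using p by (simp add: exp_minus exp_of_nat_mult[of 3, simplified] divide_inverse)
    also have "\<dots> \<le> 1 / (4 * real p)"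
    proof (rule divide_left_mono)
      have "2 * 2 \<le> real p * real p" using p by (intro mult_mono) auto
      then have "4 * real p \<le> (real p * real p) * real p" using p by (intro mult_right_mono) auto
      then show "4 * real p \<le> real p ^ 3" by (simp add: power3_eq_cube)
    qed (use p in auto)
    finally show ?thesis .
  qed
  have w_le: "w (int i) \<le> exp (- \<kappa>) * (1 / (real i)\<^sup>2)" if "1 \<le> i" for i
  proof -
    have "1 + q * ln i \<le> real i powr q" using that exp_ge_add_one_self[of "q * ln i"] by (simp add: powr_def)
    moreover have "0 \<le> ln (real i)" using that by simp
    moreover have "0 \<le> \<kappa>" using q lnp by (simp add: \<kappa>_def)
    ultimately have "\<kappa> + 2 * ln i \<le> \<kappa> * real i powr q"
      using mult_left_mono[of "1 + q * ln i" "real i powr q" \<kappa>] mult_right_mono[OF \<kappa>q, of "ln i"]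
      by (simp add: algebra_simps)
    then have "w (int i) \<le> exp (- \<kappa> - 2 * ln i)" by (simp add: w_def)
    also have "\<dots> = exp (- \<kappa>) * (1 / (real i)\<^sup>2)"
      using that by (simp add: exp_diff exp_of_nat_mult[of 2, simplified])
    finally show ?thesis .
  qed
  have "(\<Sum>i\<in>{- int N..int N}. w i) = 1 + 2 * (\<Sum>i=1..N. w (int i))"
  proof -
    have "{- int N..int N} = (insert 0 (int ` {1..N})) \<union> (\<lambda>i. - int i) ` {1..N}"
    proof (intro set_eqI iffI)
      fix i assume i: "i \<in> {- int N..int N}"
      have "i \<in> int ` {1..N}" if "0 < i" using that i by (intro image_eqI[of _ _ "nat i"]) auto
      moreover have "i \<in> (\<lambda>i. - int i) ` {1..N}" if "i < 0" using that i by (intro image_eqI[of _ _ "nat (- i)"]) auto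
      ultimately show "i \<in> (insert 0 (int ` {1..N})) \<union> (\<lambda>i. - int i) ` {1..N}"
        by (cases "i = 0"; cases "0 < i") auto
    qed auto
    moreover have "w (- i) = w i" for i by (simp add: w_def)
    moreover have "w 0 = 1" by (simp add: w_def)
    moreover have "sum w (insert 0 (int ` {1..N}) \<union> (\<lambda>i. - int i) ` {1..N}) =
        w 0 + sum w (int ` {1..N}) + sum w ((\<lambda>i. - int i) ` {1..N})"
      by (subst sum.union_disjoint, simp, simp, force, subst sum.insert) auto
    moreover have "sum w (int ` {1..N}) = (\<Sum>i=1..N. w (int i))"
      "sum w ((\<lambda>i. - int i) ` {1..N}) = (\<Sum>i=1..N. w (- int i))"
      by (subst sum.reindex; auto simp: inj_on_def)+
    ultimately show ?thesis by simp
  qed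
  also have "\<dots> \<le> 1 + 2 * (exp (- \<kappa>) * 2)"
  proof -
    have "(\<Sum>i=1..N. w (int i)) \<le> exp (- \<kappa>) * (\<Sum>i=1..N. 1 / (real i)\<^sup>2)"
      unfolding sum_distrib_left by (intro sum_mono w_le) auto
    also have "\<dots> \<le> exp (- \<kappa>) * 2"
      by (intro mult_left_mono order_trans[OF sum_inverse_squares_le]) auto
    finally show ?thesis by simp
  qed
  also have "\<dots> \<le> 1 + 1 / real p" using e\<kappa> by (simp add: field_simps)
  finally have sum1: "(\<Sum>i\<in>{- int N..int N}. w i) \<le> exp (1 / real p)"
    using exp_ge_add_one_self[of "1 / real p"] by linarith
  have "(\<Sum>z\<in>PiE {..<p} (\<lambda>_. {- int N..int N}). exp (- \<kappa> * (\<Sum>j<p. \<bar>of_int (z j)\<bar> powr q))) =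
    (\<Sum>z\<in>PiE {..<p} (\<lambda>_. {- int N..int N}). \<Prod>j<p. w (z j))"
    by (simp add: w_def exp_sum[symmetric] sum_distrib_left)
  also have "\<dots> = (\<Prod>j<p. \<Sum>i\<in>{- int N..int N}. w i)" by (rule prod_sum_PiE[symmetric]) auto
  also have "\<dots> \<le> (\<Prod>j<p. exp (1 / real p))"
    using sum1 by (intro prod_mono) (auto simp: w_def intro!: sum_nonneg)
  also have "\<dots> = exp 1" using p by (simp add: exp_of_nat_mult[symmetric])
  also have "\<dots> \<le> 3" by (rule exp_le)
  finally show ?thesis unfolding \<kappa>_def by simp
qed

text \<open>\<open>W\<close> sums weighted exponentials of mean 1 over all grid points and does not
  depend on \<theta>. Hence one integrable majorant serves every \<theta> at once, including the one
  produced by the data. The numbers 8 and \<open>34 = 8 * 17 / 4\<close> come from dividing by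
  \<open>s / 2 = 1 / (8 * \<sigma>\<^sup>2)\<close>.\<close>

lemma sparse_error_bound:
  fixes Z :: "nat \<Rightarrow> nat \<Rightarrow> real" and q \<sigma> L :: real and p :: nat
  assumes q: "0 < q" "q \<le> 1" and p: "2 \<le> p" and \<sigma>: "0 < \<sigma>" and L: "0 < L"
    and Z: "\<And>j. j < p \<Longrightarrow> vinner n (\<lambda>i. Z i j) (\<lambda>i. Z i j) \<le> (L * \<sigma>)\<^sup>2"
  defines "\<kappa> \<equiv> 3 / q * ln p"
  shows "\<exists>W \<in> borel_measurable (gaussian n \<sigma>). (\<integral>\<^sup>+g. ennreal (W g) \<partial>gaussian n \<sigma>) \<le> 3 \<and> (\<forall>g. 0 \<le> W g) \<and>
    (\<forall>\<theta> g u. (\<Sum>j<p. \<bar>\<theta> j\<bar> powr q) \<le> 2 \<longrightarrow> u = mat_vec n p Z \<theta> \<longrightarrow> vinner n u u \<le> 2 * vinner n u g \<longrightarrow>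
      vinner n u u \<le> \<sigma>\<^sup>2 * (8 * W g + 34 * (L powr q * \<kappa> powr (1 - q / 2))))"
proof -
  have "ln 2 \<le> ln (real p)" using p by simp
  then have "2 / 3 \<le> ln (real p)" using ln2_ge_two_thirds by linarith
  then have \<kappa>: "0 < \<kappa>" using q by (simp add: \<kappa>_def)
  \<comment> \<open>This mesh balances the two rounding costs: the variance term is
    \<open>\<kappa> / 8\<close>, against \<open>2 * \<kappa>\<close> for the penalty, in total
    \<open>17 / 8 * \<kappa>\<close>.\<close>
  define \<tau> where "\<tau> = sqrt \<kappa> / L"
  define s where "s = 1 / (4 * \<sigma>\<^sup>2)"
  have \<tau>: "0 < \<tau>" using \<kappa> L by (simp add: \<tau>_def)
  have s: "0 < s" using \<sigma> by (simp add: s_def)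
  \<comment> \<open>Each \<open>\<bar>\<theta> j\<bar>\<close> is at most
    \<open>2 powr (1 / q)\<close>, so the rounded integers stay within \<open>N\<close> and the sum
    \<open>W\<close> is finite.\<close>
  define N where "N = nat \<lceil>2 powr (1 / q) / \<tau> + 1\<rceil>"
  let ?P = "PiE {..<p} (\<lambda>_. {- int N..int N})"
  define v where "v z = mat_vec n p Z (\<lambda>j. \<tau> * of_int (z j))" for z :: "nat \<Rightarrow> int"
  define r where "r z = exp (- \<kappa> * (\<Sum>j<p. \<bar>of_int (z j)\<bar> powr q))" for z :: "nat \<Rightarrow> int"
  define W where "W g = (\<Sum>z\<in>?P. r z * exp (s * discrepancy n g (v z)))" for g
  have exp_meas [measurable]: "(\<lambda>g. exp (s * discrepancy n g (v z))) \<in> borel_measurable (gaussian n \<sigma>)" for z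
    unfolding discrepancy_def by measurable
  have W_meas: "W \<in> borel_measurable (gaussian n \<sigma>)" unfolding W_def[abs_def] by (intro borel_measurable_sum borel_measurable_times exp_meas) simp
  have W_nonneg: "0 \<le> W g" for g unfolding W_def r_def by (rule sum_nonneg) simp
  have mgf: "(\<integral>\<^sup>+g. ennreal (exp (s * discrepancy n g a)) \<partial>gaussian n \<sigma>) = 1" for a
  proof -
    have "s * discrepancy n g a = vinner n (vscale n (2 * s) a) g - \<sigma>\<^sup>2 * vinner n (vscale n (2 * s) a) (vscale n (2 * s) a) / 2" for g
      using \<sigma> by (simp add: discrepancy_def s_def field_simps power2_eq_square)
    then show ?thesis using gaussian_mgf[OF \<sigma>, of n "vscale n (2 * s) a"] by simp
  qed
  have "(\<integral>\<^sup>+g. ennreal (W g) \<partial>gaussian n \<sigma>) = (\<integral>\<^sup>+g. (\<Sum>z\<in>?P. ennreal (r z) * ennreal (exp (s * discrepancy n g (v z)))) \<partial>gaussian n \<sigma>)"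
    by (intro nn_integral_cong) (simp add: W_def r_def ennreal_mult[symmetric] sum_ennreal)
  also have "\<dots> = (\<Sum>z\<in>?P. ennreal (r z))"
    by (subst nn_integral_sum, simp) (simp add: nn_integral_cmult mgf)
  also have "\<dots> = ennreal (\<Sum>z\<in>?P. r z)" by (simp add: r_def sum_ennreal)
  also have "\<dots> \<le> ennreal 3"
    using integer_weights_sum_le[OF q p, of N] by (intro ennreal_leI) (simp add: r_def \<kappa>_def)
  finally have W_int: "(\<integral>\<^sup>+g. ennreal (W g) \<partial>gaussian n \<sigma>) \<le> 3" by simp
  have main: "vinner n u u \<le> \<sigma>\<^sup>2 * (8 * W g + 34 * (L powr q * \<kappa> powr (1 - q / 2)))"
    if \<theta>: "(\<Sum>j<p. \<bar>\<theta> j\<bar> powr q) \<le> 2" and u: "u = mat_vec n p Z \<theta>" and ug: "vinner n u u \<le> 2 * vinner n u g"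
    for \<theta> g u
  proof -
    define T where "T = (\<Sum>j<p. \<bar>\<theta> j / \<tau>\<bar> powr q)"
    obtain z0 :: "nat \<Rightarrow> int" where z0: "\<And>j. \<bar>of_int (z0 j)\<bar> \<le> \<bar>\<theta> j\<bar> / \<tau> + 1"
      "s * discrepancy n g u - (s * (L * \<sigma>)\<^sup>2 * \<tau>\<^sup>2 / 2 + 2 * \<kappa>) * T
      \<le> s * discrepancy n g (mat_vec n p Z (\<lambda>j. if j < p then \<tau> * of_int (z0 j) else \<theta> j))
          - \<kappa> * (\<Sum>j<p. \<bar>of_int (z0 j)\<bar> powr q)"
      using round_coordinates[where n = n and p = p and m = p and \<theta> = \<theta> and g = g and Z = Z,
          OF q \<tau> less_imp_le[OF s] less_imp_le[OF \<kappa>] Z order_refl]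
      unfolding T_def u by blast
    define z where "z = restrict z0 {..<p}"
    have vz: "mat_vec n p Z (\<lambda>j. if j < p then \<tau> * of_int (z0 j) else \<theta> j) = v z"
      unfolding v_def mat_vec_def z_def by (intro restrict_ext sum.cong refl) auto
    have "z \<in> ?P"
    proof -
      have "z0 j \<in> {- int N..int N}" if j: "j < p" for j
      proof -
        have "\<bar>\<theta> j\<bar> powr q \<le> (\<Sum>j<p. \<bar>\<theta> j\<bar> powr q)"
          using j by (intro member_le_sum) auto
        then have "(\<bar>\<theta> j\<bar> powr q) powr (1 / q) \<le> 2 powr (1 / q)"
          using \<theta> q by (intro powr_mono2) auto
        then have "\<bar>\<theta> j\<bar> \<le> 2 powr (1 / q)" using q by (simp add: powr_powr)
        then have "\<bar>\<theta> j\<bar> / \<tau> + 1 \<le> 2 powr (1 / q) / \<tau> + 1" using \<tau> by (simp add: divide_right_mono)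
        then have "\<bar>real_of_int (z0 j)\<bar> \<le> 2 powr (1 / q) / \<tau> + 1" using z0(1)[of j] by linarith
        also have "\<dots> \<le> real N" unfolding N_def by linarith
        finally show ?thesis by auto
      qed
      then show ?thesis by (auto simp: z_def)
    qed
    have "s * discrepancy n g u - (s * (L * \<sigma>)\<^sup>2 * \<tau>\<^sup>2 / 2 + 2 * \<kappa>) * T
        \<le> s * discrepancy n g (v z) - \<kappa> * (\<Sum>j<p. \<bar>of_int (z j)\<bar> powr q)"
      using z0(2) unfolding vz by (simp add: z_def)
    \<comment> \<open>By \<open>x \<le> exp x\<close> the penalised exponent is at most one
      nonnegative term of \<open>W\<close>, hence at most \<open>W\<close>.\<close>
    also have "\<dots> \<le> exp (s * discrepancy n g (v z) - \<kappa> * (\<Sum>j<p. \<bar>of_int (z j)\<bar> powr q))"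
      by (rule order_trans[OF _ exp_ge_add_one_self]) simp
    also have "\<dots> = r z * exp (s * discrepancy n g (v z))"
      by (simp add: r_def mult_exp_exp)
    also have "\<dots> \<le> W g" unfolding W_def
      using \<open>z \<in> ?P\<close> by (intro member_le_sum) (auto simp: r_def intro: finite_PiE)
    finally have le: "s * discrepancy n g u \<le> W g + (s * (L * \<sigma>)\<^sup>2 * \<tau>\<^sup>2 / 2 + 2 * \<kappa>) * T" by simp
    have T: "T \<le> 2 * (L powr q * \<kappa> powr (- q / 2))"
    proof -
      have "\<tau> powr q = \<kappa> powr (q / 2) / L powr q"
      proof -
        have "sqrt \<kappa> powr q = (\<kappa> powr (1 / 2)) powr q" using \<kappa> by (simp add: powr_half_sqrt)
        then show ?thesis using \<kappa> L by (simp add: \<tau>_def powr_divide powr_powr)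
      qed
      moreover have "\<kappa> powr (- q / 2) = 1 / \<kappa> powr (q / 2)"
        using powr_minus_divide[of \<kappa> "q / 2"] by simp
      ultimately have "1 / \<tau> powr q = L powr q * \<kappa> powr (- q / 2)" by simp
      moreover have "T = (\<Sum>j<p. \<bar>\<theta> j\<bar> powr q) * (1 / \<tau> powr q)"
        using \<tau> by (simp add: T_def abs_divide powr_divide sum_divide_distrib)
      ultimately show ?thesis using mult_right_mono[OF \<theta>, of "L powr q * \<kappa> powr (- q / 2)"] by simp
    qed
    have c: "s * (L * \<sigma>)\<^sup>2 * \<tau>\<^sup>2 / 2 + 2 * \<kappa> = 17 / 8 * \<kappa>"
      using \<sigma> L \<kappa> by (simp add: s_def \<tau>_def power_mult_distrib power_divide)
    have \<kappa>q: "\<kappa> * \<kappa> powr (- q / 2) = \<kappa> powr (1 - q / 2)"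
      using \<kappa> powr_add[of \<kappa> 1 "- q / 2"] by simp
    have "17 / 8 * \<kappa> * T \<le> 17 / 8 * \<kappa> * (2 * (L powr q * \<kappa> powr (- q / 2)))"
      using \<kappa> by (intro mult_left_mono T) auto
    also have "\<dots> = 17 / 4 * (L powr q * (\<kappa> * \<kappa> powr (- q / 2)))" by simp
    finally have "17 / 8 * \<kappa> * T \<le> 17 / 4 * (L powr q * \<kappa> powr (1 - q / 2))" unfolding \<kappa>q .
    then have "s * discrepancy n g u \<le> W g + 17 / 4 * (L powr q * \<kappa> powr (1 - q / 2))"
      using le unfolding c by linarith
    moreover have "s * (vinner n u u / 2) \<le> s * discrepancy n g u"
      using s ug by (intro mult_left_mono) (auto simp: discrepancy_def)
    ultimately have "s * (vinner n u u / 2) \<le> W g + 17 / 4 * (L powr q * \<kappa> powr (1 - q / 2))" by linarith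
    then show ?thesis using \<sigma> by (simp add: s_def field_simps)
  qed
  show ?thesis using W_meas W_int W_nonneg main by blast
qed

section \<open>Measurable selection of nearest points\<close>

lemma continuous_on_vnorm_vsub: "continuous_on UNIV (\<lambda>u. vnorm n (vsub n u z))"
proof -
  have "vnorm n (vsub n u z) = sqrt (\<Sum>i<n. (u i - z i)\<^sup>2)" for u
    by (simp add: vnorm_def L2_set_def vsub_def)
  then show ?thesis
    by (simp add: continuous_intros continuous_on_product_coordinates)
qed

text \<open>The event that the set of nearest points of \<open>S\<close> to \<open>z\<close> meets
  \<open>C\<close>; the selection below is built from such events.\<close>

definition attains_distance :: "nat \<Rightarrow> (nat \<Rightarrow> real) set \<Rightarrow> (nat \<Rightarrow> real) set \<Rightarrow> (nat \<Rightarrow> real) \<Rightarrow> bool" where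
  "attains_distance n S C z \<longleftrightarrow> (\<exists>u\<in>S \<inter> C. \<forall>v\<in>S. vnorm n (vsub n u z) \<le> vnorm n (vsub n v z))"

lemma closure_approx:
  fixes f :: "'a::topological_space \<Rightarrow> real"
  assumes "continuous_on UNIV f" "u \<in> closure T" "f u < c"
  shows "\<exists>t\<in>T. f t < c"
proof -
  have "open {x. f x < c}" using assms(1) by (intro open_Collect_less) auto
  then show ?thesis
    using assms(2,3) open_Int_closure_eq_empty[of "{x. f x < c}" T] by blast
qed

text \<open>The event says that the distance from \<open>z\<close> to \<open>S \<inter> C\<close> is
  no larger than that to \<open>S\<close>. By compactness and continuity it can be tested on
  countable dense subsets with tolerances \<open>1 / (m + 1)\<close>, which leaves countable
  quantifiers only.\<close>

lemma attains_distance_measurable: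
  fixes S C :: "(nat \<Rightarrow> real) set"
  assumes S: "compact S" and C: "closed C"
  shows "{z \<in> space (borel_Rn n). attains_distance n S C z} \<in> sets (borel_Rn n)"
proof (cases "S \<inter> C = {}")
  case False
  obtain TS where TS: "countable TS" "TS \<subseteq> S" "S \<subseteq> closure TS" by (rule separable)
  obtain T where T: "countable T" "T \<subseteq> S \<inter> C" "S \<inter> C \<subseteq> closure T" by (rule separable)
  have cmp: "compact (S \<inter> C)" using assms by (rule compact_Int_closed)
  have "attains_distance n S C z \<longleftrightarrow>
    (\<forall>v\<in>TS. \<forall>m::nat. \<exists>u\<in>T. vnorm n (vsub n u z) < vnorm n (vsub n v z) + 1 / (real m + 1))" for z
  proof
    assume "attains_distance n S C z"
    then obtain u where u: "u \<in> S \<inter> C" "\<And>v. v \<in> S \<Longrightarrow> vnorm n (vsub n u z) \<le> vnorm n (vsub n v z)"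
      by (auto simp: attains_distance_def)
    show "\<forall>v\<in>TS. \<forall>m::nat. \<exists>u\<in>T. vnorm n (vsub n u z) < vnorm n (vsub n v z) + 1 / (real m + 1)"
    proof (intro ballI allI)
      fix v m assume "v \<in> TS"
      then have "vnorm n (vsub n u z) \<le> vnorm n (vsub n v z)" using u(2) TS(2) by auto
      then have "vnorm n (vsub n u z) < vnorm n (vsub n v z) + 1 / (real m + 1)"
        by (rule le_less_trans) (simp add: add_pos_nonneg)
      then show "\<exists>u\<in>T. vnorm n (vsub n u z) < vnorm n (vsub n v z) + 1 / (real m + 1)"
        using closure_approx[OF continuous_on_vnorm_vsub[of n z]] u(1) T(3) by blast
    qed
  next
    assume r: "\<forall>v\<in>TS. \<forall>m::nat. \<exists>u\<in>T. vnorm n (vsub n u z) < vnorm n (vsub n v z) + 1 / (real m + 1)"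
    obtain u where u: "u \<in> S \<inter> C" "\<And>v. v \<in> S \<inter> C \<Longrightarrow> vnorm n (vsub n u z) \<le> vnorm n (vsub n v z)"
      using continuous_attains_inf[OF cmp False continuous_on_subset[OF continuous_on_vnorm_vsub[of n z] subset_UNIV]]
      by blast
    have TSle: "vnorm n (vsub n u z) \<le> vnorm n (vsub n v z)" if "v \<in> TS" for v
    proof (rule field_le_epsilon)
      fix e :: real assume "0 < e"
      then obtain m :: nat where m: "inverse (real (Suc m)) < e" using reals_Archimedean by blast
      obtain t where t: "t \<in> T" "vnorm n (vsub n t z) < vnorm n (vsub n v z) + 1 / (real m + 1)"
        using r \<open>v \<in> TS\<close> by blast
      have "vnorm n (vsub n u z) \<le> vnorm n (vsub n t z)" using u(2) t(1) T(2) by blast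
      moreover have "1 / (real m + 1) < e" using m by (simp add: inverse_eq_divide add.commute)
      ultimately show "vnorm n (vsub n u z) \<le> vnorm n (vsub n v z) + e" using t(2) by linarith
    qed
    have "vnorm n (vsub n u z) \<le> vnorm n (vsub n v z)" if v: "v \<in> S" for v
    proof (rule ccontr)
      assume "\<not> vnorm n (vsub n u z) \<le> vnorm n (vsub n v z)"
      then obtain t where "t \<in> TS" "vnorm n (vsub n t z) < vnorm n (vsub n u z)"
        using closure_approx[OF continuous_on_vnorm_vsub[of n z], of v TS "vnorm n (vsub n u z)"] v TS(3) by auto
      then show False using TSle[of t] by simp
    qed
    then show "attains_distance n S C z" using u(1) by (auto simp: attains_distance_def)
  qed
  moreover have "{z \<in> space (borel_Rn n).
    (\<forall>v\<in>TS. \<forall>m::nat. \<exists>u\<in>T. vnorm n (vsub n u z) < vnorm n (vsub n v z) + 1 / (real m + 1))} \<in> sets (borel_Rn n)"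
  proof -
    have [measurable]: "(\<lambda>z. vnorm n (vsub n u z)) \<in> borel_measurable (borel_Rn n)" for u
      unfolding vnorm_def L2_set_def vsub_def by (simp cong: sum.cong) measurable
    note [simp] = TS(1) T(1)
    show ?thesis by measurable
  qed
  ultimately show ?thesis by simp
qed (auto simp: attains_distance_def)

text \<open>
  Bisect along an enumeration of all half spaces \<open>u i \<le> r\<close> with rational \<open>r\<close>, always keeping the lower
  half if it still contains a nearest point. Which half is kept depends measurably on \<open>z\<close>, and the
  nested cells shrink to one nearest point.
\<close>

fun cell :: "nat \<Rightarrow> (nat \<Rightarrow> real) set \<Rightarrow> (nat \<Rightarrow> real) \<Rightarrow> nat \<Rightarrow> (nat \<Rightarrow> real) set" where
  "cell n S z 0 = UNIV"
| "cell n S z (Suc m) = (case from_nat m :: nat \<times> rat of (i, r) \<Rightarrow>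
    if attains_distance n S (cell n S z m \<inter> {u. u i \<le> real_of_rat r}) z
    then cell n S z m \<inter> {u. u i \<le> real_of_rat r} else cell n S z m \<inter> {u. real_of_rat r \<le> u i})"

lemma closed_halfspaces: "closed {u :: nat \<Rightarrow> real. u i \<le> r}" "closed {u :: nat \<Rightarrow> real. r \<le> u i}"
  by (intro closed_Collect_le continuous_on_product_coordinates continuous_on_const)+

lemma closed_cell: "closed (cell n S z m)"
  by (induction m) (auto simp: closed_halfspaces closed_Int split: prod.split)

lemma cell_decreasing: "m \<le> k \<Longrightarrow> cell n S z k \<subseteq> cell n S z m"
  by (induction k) (auto simp: le_Suc_eq split: prod.splits if_splits)

lemma cell_attains_distance:
  assumes "compact S" "S \<noteq> {}"
  shows "attains_distance n S (cell n S z m) z"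
proof (induction m)
  case 0
  show ?case
    using continuous_attains_inf[OF assms continuous_on_subset[OF continuous_on_vnorm_vsub[of n z] subset_UNIV]]
    by (auto simp: attains_distance_def)
next
  case (Suc m)
  obtain i r where ir: "(from_nat m :: nat \<times> rat) = (i, r)" by fastforce
  show ?case
  proof (cases "attains_distance n S (cell n S z m \<inter> {u. u i \<le> real_of_rat r}) z")
    case False
    obtain u where "u \<in> S \<inter> cell n S z m" "\<forall>v\<in>S. vnorm n (vsub n u z) \<le> vnorm n (vsub n v z)"
      using Suc by (auto simp: attains_distance_def)
    with False show ?thesis by (force simp: ir attains_distance_def)
  qed (simp add: ir)
qed

text \<open>The cell depends on \<open>z\<close>, so the induction carries an arbitrary closed
  \<open>C\<close>: splitting on the last decision leaves events of the same form for the previous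
  cell.\<close>

lemma cell_attains_distance_measurable:
  assumes S: "compact S" and "closed C"
  shows "{z \<in> space (borel_Rn n). attains_distance n S (cell n S z m \<inter> C) z} \<in> sets (borel_Rn n)"
  using assms(2)
proof (induction m arbitrary: C)
  case 0
  then show ?case using attains_distance_measurable[OF S 0] by simp
next
  case (Suc m)
  obtain i r where ir: "(from_nat m :: nat \<times> rat) = (i, r)" by fastforce
  let ?L = "{u :: nat \<Rightarrow> real. u i \<le> real_of_rat r}" and ?U = "{u :: nat \<Rightarrow> real. real_of_rat r \<le> u i}"
  let ?A = "\<lambda>C. {z \<in> space (borel_Rn n). attains_distance n S (cell n S z m \<inter> C) z}"
  have "{z \<in> space (borel_Rn n). attains_distance n S (cell n S z (Suc m) \<inter> C) z} =
    (?A ?L \<inter> ?A (?L \<inter> C)) \<union> (?A (?U \<inter> C) - ?A ?L)"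
    by (auto simp: ir Int_assoc)
  also have "\<dots> \<in> sets (borel_Rn n)"
    by (intro sets.Un sets.Int sets.Diff Suc.IH closed_Int closed_halfspaces Suc.prems)
  finally show ?case .
qed

lemma measurable_nearest_point:
  assumes S: "compact S" "S \<noteq> {}" "S \<subseteq> Rn n"
  shows "\<exists>N \<in> borel_Rn n \<rightarrow>\<^sub>M borel_Rn n. \<forall>z. nearest_point n S z (N z)"
proof -
  define opt where "opt z = S \<inter> (\<Inter>v\<in>S. {u. vnorm n (vsub n u z) \<le> vnorm n (vsub n v z)})" for z
  have cl: "closed (\<Inter>v\<in>S. {u. vnorm n (vsub n u z) \<le> vnorm n (vsub n v z)})" for z
    by (intro closed_INT ballI) (rule closed_Collect_le[OF continuous_on_vnorm_vsub continuous_on_const])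
  have opt_compact: "compact (opt z)" for z unfolding opt_def by (rule compact_Int_closed[OF S(1) cl])
  have "\<exists>u. u \<in> opt z \<and> (\<forall>m. u \<in> cell n S z m)" for z
  proof -
    \<comment> \<open>The cells are nested and closed, and each contains a nearest point;
      compactness of the set of nearest points yields one common to all cells.\<close>
    have "opt z \<inter> (\<Inter>m\<in>UNIV. cell n S z m) \<noteq> {}"
    proof (rule compact_imp_fip_image[where f = "cell n S z", OF opt_compact closed_cell])
      fix I :: "nat set" assume "finite I"
      then obtain k where k: "\<forall>m\<in>I. m \<le> k" unfolding finite_nat_set_iff_bounded_le by (elim exE)
      have "cell n S z k \<subseteq> (\<Inter>m\<in>I. cell n S z m)"
        using k by (intro INT_greatest cell_decreasing) simp
      moreover have "opt z \<inter> cell n S z k \<noteq> {}"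
        using cell_attains_distance[OF S(1,2), of n z k] by (auto simp: attains_distance_def opt_def)
      ultimately show "opt z \<inter> (\<Inter>m\<in>I. cell n S z m) \<noteq> {}" by blast
    qed
    then show ?thesis by (simp add: ex_in_conv[symmetric])
  qed
  then have "\<forall>z. \<exists>u. u \<in> opt z \<and> (\<forall>m. u \<in> cell n S z m)" by (rule allI)
  from choice[OF this] obtain N where "\<forall>z. N z \<in> opt z \<and> (\<forall>m. N z \<in> cell n S z m)" by (elim exE)
  then have N: "\<And>z. N z \<in> opt z" "\<And>z m. N z \<in> cell n S z m" by simp_all
  have "(\<lambda>z. N z i) \<in> borel_measurable (borel_Rn n)" for i
  proof (rule borel_measurableI_less)
    fix c
    let ?A = "\<lambda>r. {z \<in> space (borel_Rn n). attains_distance n S (cell n S z (to_nat (i, r)) \<inter> {u. u i \<le> real_of_rat r}) z}"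
    have cell_Suc: "cell n S z (Suc (to_nat (i, r))) =
      (if attains_distance n S (cell n S z (to_nat (i, r)) \<inter> {u. u i \<le> real_of_rat r}) z
       then cell n S z (to_nat (i, r)) \<inter> {u. u i \<le> real_of_rat r}
       else cell n S z (to_nat (i, r)) \<inter> {u. real_of_rat r \<le> u i})" for z r
      by simp
    \<comment> \<open>If \<open>N z i < r\<close>, the upper half cannot have been kept at the stage
      coding \<open>(i, r)\<close>; conversely, keeping the lower half forces
      \<open>N z i \<le> r\<close>.\<close>
    have "{z \<in> space (borel_Rn n). N z i < c} = (\<Union>r\<in>{r. real_of_rat r < c}. ?A r)"
    proof (intro set_eqI iffI)
      fix z assume z: "z \<in> {z \<in> space (borel_Rn n). N z i < c}"
      then obtain r where r: "N z i < real_of_rat r" "real_of_rat r < c" using of_rat_dense by blast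
      then have "attains_distance n S (cell n S z (to_nat (i, r)) \<inter> {u. u i \<le> real_of_rat r}) z"
        using N(2)[of z "Suc (to_nat (i, r))"] unfolding cell_Suc by (auto split: if_splits)
      then show "z \<in> (\<Union>r\<in>{r. real_of_rat r < c}. ?A r)" using z r by blast
    next
      fix z assume "z \<in> (\<Union>r\<in>{r. real_of_rat r < c}. ?A r)"
      then obtain r where r: "real_of_rat r < c" "z \<in> ?A r" by blast
      then have "N z i \<le> real_of_rat r"
        using N(2)[of z "Suc (to_nat (i, r))"] unfolding cell_Suc by auto
      then show "z \<in> {z \<in> space (borel_Rn n). N z i < c}" using r by auto
    qed
    also have "\<dots> \<in> sets (borel_Rn n)"
      by (intro sets.countable_UN'' cell_attains_distance_measurable S closed_halfspaces) auto
    finally show "{z \<in> space (borel_Rn n). N z i < c} \<in> sets (borel_Rn n)" .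
  qed
  moreover have "N z \<in> Rn n" for z using N(1)[of z] S(3) by (auto simp: opt_def)
  ultimately have "N \<in> borel_Rn n \<rightarrow>\<^sub>M borel_Rn n"
    by (intro measurable_PiM_single') (auto simp: Rn_def)
  moreover have "nearest_point n S z (N z)" for z
    using N(1)[of z] by (auto simp: nearest_point_def is_arg_min_def opt_def not_less)
  ultimately show ?thesis by blast
qed

section \<open>Projected nearest neighbour estimators\<close>

lemma lq_norm_le_1_iff:
  assumes "0 < q"
  shows "lq_norm p q \<theta> \<le> 1 \<longleftrightarrow> (\<Sum>i<p. \<bar>\<theta> i\<bar> powr q) \<le> 1"
proof -
  let ?s = "\<Sum>i<p. \<bar>\<theta> i\<bar> powr q"
  have s: "0 \<le> ?s" by (simp add: sum_nonneg)
  have "?s = (?s powr (1 / q)) powr q" using s assms by (simp add: powr_powr)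
  then show ?thesis
    unfolding lq_norm_def using powr_le1[of q "?s powr (1 / q)"] powr_le1[of "1 / q" ?s] s assms by auto
qed

lemma lq_ball_coordinate_le_1:
  fixes \<theta> :: "nat \<Rightarrow> real"
  assumes "0 < q" "(\<Sum>i<p. \<bar>\<theta> i\<bar> powr q) \<le> 1" "i < p"
  shows "\<bar>\<theta> i\<bar> \<le> (1::real)"
proof -
  have "\<bar>\<theta> i\<bar> powr q \<le> (\<Sum>i<p. \<bar>\<theta> i\<bar> powr q)" using assms(3) by (intro member_le_sum) auto
  then have "(\<bar>\<theta> i\<bar> powr q) powr (1 / q) \<le> 1" using assms by (intro powr_le1) auto
  then show ?thesis using assms(1) by (simp add: powr_powr)
qed

text \<open>The topology is that of all functions on \<open>nat\<close>. Coordinates from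
  \<open>p\<close> on are pinned to \<open>undefined\<close>, so the ball is a closed subset of a
  product of compact sets and Tychonoff applies.\<close>

lemma compact_lq_ball:
  assumes q: "0 < q"
  shows "compact (lq_ball p q)"
proof -
  let ?B = "PiE UNIV (\<lambda>i. if i < p then {-1..1} else {undefined}) :: (nat \<Rightarrow> real) set"
  have "compactin (product_topology (\<lambda>_. euclidean) UNIV) ?B"
    unfolding compactin_PiE by auto
  then have B: "compact ?B" by (simp add: euclidean_product_topology)
  have "continuous_on UNIV (\<lambda>\<theta> :: nat \<Rightarrow> real. \<Sum>i<p. \<bar>\<theta> i\<bar> powr q)"
    using q by (intro continuous_on_sum continuous_on_powr' continuous_on_rabs continuous_on_product_coordinates
        continuous_on_const) auto
  then have C: "closed {\<theta> :: nat \<Rightarrow> real. (\<Sum>i<p. \<bar>\<theta> i\<bar> powr q) \<le> 1}"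
    by (rule closed_Collect_le) (rule continuous_on_const)
  have "lq_ball p q = ?B \<inter> {\<theta>. (\<Sum>i<p. \<bar>\<theta> i\<bar> powr q) \<le> 1}"
  proof (intro set_eqI iffI)
    fix \<theta> assume "\<theta> \<in> lq_ball p q"
    then have \<theta>: "\<theta> \<in> Rn p" "(\<Sum>i<p. \<bar>\<theta> i\<bar> powr q) \<le> 1" by (auto simp: lq_ball_def lq_norm_le_1_iff[OF q])
    then have "\<theta> i \<in> (if i < p then {-1..1} else {undefined})" for i
      using lq_ball_coordinate_le_1[OF q \<theta>(2), of i] by (auto simp: Rn_def PiE_iff extensional_def abs_le_iff)
    then show "\<theta> \<in> ?B \<inter> {\<theta>. (\<Sum>i<p. \<bar>\<theta> i\<bar> powr q) \<le> 1}" using \<theta>(2) by auto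
  next
    fix \<theta> assume \<theta>: "\<theta> \<in> ?B \<inter> {\<theta>. (\<Sum>i<p. \<bar>\<theta> i\<bar> powr q) \<le> 1}"
    then have "\<theta> i \<in> (if i < p then {-1..1} else {undefined})" for i
      using PiE_mem[of \<theta> UNIV "\<lambda>i. if i < p then {-1..1} else {undefined}" i] by simp
    then have "\<theta> i = undefined" if "\<not> i < p" for i using that by (metis singletonD)
    then show "\<theta> \<in> lq_ball p q" using \<theta> by (auto simp: lq_ball_def lq_norm_le_1_iff[OF q] Rn_def PiE_iff extensional_def)
  qed
  then show ?thesis using compact_Int_closed[OF B C] by simp
qed

lemma continuous_on_mat_vec: "continuous_on UNIV (mat_vec n p X)"
proof (rule continuous_on_coordinatewise_then_product)
  fix i
  have "continuous_on UNIV (\<lambda>\<theta> :: nat \<Rightarrow> real. \<Sum>j<p. X i j * \<theta> j)"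
    by (intro continuous_on_sum continuous_on_mult continuous_on_const continuous_on_product_coordinates)
  then show "continuous_on UNIV (\<lambda>\<theta>. mat_vec n p X \<theta> i)"
    by (cases "i < n") (simp_all add: mat_vec_def)
qed

lemma compact_mat_vec_lq_ball: "0 < q \<Longrightarrow> compact (mat_vec n p X ` lq_ball p q)"
  by (intro compact_continuous_image continuous_on_subset[OF continuous_on_mat_vec] compact_lq_ball) auto

lemma zero_in_lq_ball: "0 < q \<Longrightarrow> (\<lambda>i\<in>{..<p}. 0) \<in> lq_ball p q"
  by (simp add: lq_ball_def lq_norm_le_1_iff Rn_def)

text \<open>Dividing by \<open>\<bar>a\<bar> + \<bar>b\<bar>\<close> produces two fractions in
  [0, 1] with sum 1, and there \<open>x \<le> x powr q\<close>.\<close>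

lemma abs_diff_powr_le:
  fixes a b :: real
  assumes q: "0 < q" "q \<le> 1"
  shows "\<bar>a - b\<bar> powr q \<le> \<bar>a\<bar> powr q + \<bar>b\<bar> powr q"
proof (cases "\<bar>a\<bar> + \<bar>b\<bar> = 0")
  case False
  define t where "t = \<bar>a\<bar> + \<bar>b\<bar>"
  have t: "0 < t" using False by (auto simp: t_def)
  have *: "\<bar>x\<bar> / t \<le> \<bar>x\<bar> powr q / t powr q" if "\<bar>x\<bar> \<le> t" for x
    using powr_le_one_mult[of "\<bar>x\<bar> / t" q] q t that by (simp add: powr_divide)
  have "1 = \<bar>a\<bar> / t + \<bar>b\<bar> / t" using t by (simp add: t_def flip: add_divide_distrib)
  also have "\<dots> \<le> \<bar>a\<bar> powr q / t powr q + \<bar>b\<bar> powr q / t powr q"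
    by (intro add_mono *) (auto simp: t_def)
  finally have "t powr q \<le> \<bar>a\<bar> powr q + \<bar>b\<bar> powr q" using t by (simp add: field_simps)
  moreover have "\<bar>a - b\<bar> powr q \<le> t powr q" using q by (intro powr_mono2) (auto simp: t_def)
  ultimately show ?thesis by linarith
next
  case True
  then have "a = 0" "b = 0" by auto
  then show ?thesis by simp
qed

section \<open>Orthogonal projections in terms of residuals\<close>

lemma linear_subspace_orth_compl: "linear_subspace n (orth_compl n P)"
  by (auto simp: linear_subspace_def orth_compl_def)

lemma orth_proj_eqI:
  assumes P: "linear_subspace n P" and u: "u \<in> P" "vsub n x u \<in> orth_compl n P"
  shows "orth_proj n P x = u"
  unfolding orth_proj_def
proof (rule the_equality)
  fix w assume w: "w \<in> P \<and> vsub n x w \<in> orth_compl n P"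
  define d where "d = vsub n w u"
  have "vadd n w (vscale n (-1) u) \<in> P" using P u w by (simp add: linear_subspace_def)
  also have "vadd n w (vscale n (-1) u) = d" by (auto simp: d_def vadd_def vscale_def vsub_def)
  finally have "vinner n d (vsub n x u) = 0" "vinner n d (vsub n x w) = 0" using u w by (auto simp: orth_compl_def)
  then have "vinner n d (vsub n w u) = 0" by simp
  then have "vinner n d d = 0" unfolding d_def .
  moreover have "w \<in> Rn n" "u \<in> Rn n" using P u w by (auto simp: linear_subspace_def)
  ultimately show "w = u"
    by (intro Rn_eqI[of w n u]) (simp_all add: vinner_self_eq_0 d_def vsub_def del: vinner_linear)
qed (use u in simp)

text \<open>The span of \<open>xs\<close> is represented as the kernel of the residual map inside
  \<open>Rn n\<close>: linearity makes it a subspace, and both projections become explicit.\<close>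

lemma residual_kernel_subspace:
  defines "P \<equiv> \<lambda>n xs. {x \<in> Rn n. residual n xs x = vzero n}"
  shows "linear_subspace n (P n xs)"
    and "orth_proj n (P n xs) x = vsub n x (residual n xs x)"
    and "orth_proj n (orth_compl n (P n xs)) x = residual n xs x"
proof -
  have z: "residual n xs (vzero n) = vzero n"
    by (rule residual_unique) (auto simp: vspan_vzero)
  have a: "vadd n (vzero n) (vzero n) = vzero n" "vscale n c (vzero n) = vzero n" for c
    by (auto simp: vadd_def vscale_def vzero_def)
  show P: "linear_subspace n (P n xs)"
    by (auto simp: linear_subspace_def P_def z residual_linear a)
  have k: "vsub n x (residual n xs x) \<in> P n xs"
    by (simp add: P_def residual_linear residual_idem)
  have r: "residual n xs x \<in> orth_compl n (P n xs)"
    by (auto simp: orth_compl_def P_def simp flip: residual_self_adjoint)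
  have "vsub n x (vsub n x (residual n xs x)) = residual n xs x"
    by (rule Rn_eqI[where n = n]) (auto, auto simp: vsub_def)
  then show "orth_proj n (P n xs) x = vsub n x (residual n xs x)"
    using r k P by (intro orth_proj_eqI) auto
  have "vsub n x (residual n xs x) \<in> orth_compl n (orth_compl n (P n xs))"
    using k by (auto simp: orth_compl_def vinner_commute[of n _ "vsub n x _"] simp del: vinner_linear)
  then show "orth_proj n (orth_compl n (P n xs)) x = residual n xs x"
    using r by (intro orth_proj_eqI linear_subspace_orth_compl) auto
qed

lemma residual_measurable:
  assumes "\<And>i. i < n \<Longrightarrow> (\<lambda>x. f x i) \<in> borel_measurable M" "i < n"
  shows "(\<lambda>x. residual n xs (f x) i) \<in> borel_measurable M"
  using assms(2)
proof (induction xs arbitrary: i)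
  case (Cons a ys)
  note [measurable] = Cons.IH
  show ?case using Cons.prems unfolding residual.simps vscale_def by (simp add: vsub_def) measurable
qed (simp add: assms(1))

text \<open>
  The bound \<open>\<parallel>u\<parallel>\<^sup>2 \<le> 2 \<langle>u, g\<rangle>\<close> compares the nearest point with the projection of \<open>y\<close> itself.
\<close>

lemma projected_nn_estimator_exists:
  fixes X :: "nat \<Rightarrow> nat \<Rightarrow> real" and n p :: nat and q :: real
  assumes q: "0 < q" "q \<le> 1"
  defines "K \<equiv> mat_vec n p X ` lq_ball p q"
  shows "\<exists>P M. linear_subspace n P \<and> projected_nn_estimator n K P M \<and>
    (\<forall>y\<in>K. \<forall>g\<in>Rn n. \<exists>\<theta> u. (\<Sum>j<p. \<bar>\<theta> j\<bar> powr q) \<le> 2 \<and> (\<Sum>j<p. \<bar>\<theta> j\<bar>) \<le> 2 \<and>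
      u = mat_vec n p (\<lambda>i j. residual n xs (\<lambda>i. X i j) i) \<theta> \<and>
      vsub n (M (vadd n y g)) y = vadd n (vsub n g (residual n xs g)) u \<and> vinner n u u \<le> 2 * vinner n u g)"
proof -
  define Z where "Z = (\<lambda>i j. residual n xs (\<lambda>i. X i j) i)"
  define P where "P = {x \<in> Rn n. residual n xs x = vzero n}"
  have P: "linear_subspace n P" "\<And>x. orth_proj n P x = vsub n x (residual n xs x)"
    "\<And>x. orth_proj n (orth_compl n P) x = residual n xs x"
    unfolding P_def by (rule residual_kernel_subspace)+
  have rX: "residual n xs (mat_vec n p X \<theta>) = mat_vec n p Z \<theta>" for \<theta>
    unfolding Z_def by (rule residual_mat_vec)
  define S where "S = mat_vec n p Z ` lq_ball p q"
  have SK: "orth_proj n (orth_compl n P) ` K = S"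
    by (simp add: P(3) K_def S_def image_image rX)
  have "compact S" unfolding S_def using q by (intro compact_mat_vec_lq_ball)
  moreover have "S \<noteq> {}" using zero_in_lq_ball[OF q(1), of p] by (auto simp: S_def)
  moreover have "S \<subseteq> Rn n" by (auto simp: S_def)
  ultimately obtain N where N: "N \<in> borel_Rn n \<rightarrow>\<^sub>M borel_Rn n" "\<And>z. nearest_point n S z (N z)"
    using measurable_nearest_point[of S n] by blast
  define M where "M y = vadd n (vsub n y (residual n xs y)) (N (residual n xs y))" for y
  have res_meas: "residual n xs \<in> borel_Rn n \<rightarrow>\<^sub>M borel_Rn n"
  proof (rule measurable_PiM_single')
    show "(\<lambda>x. residual n xs x i) \<in> borel_measurable (borel_Rn n)" if "i \<in> {..<n}" for i
      using that by (intro residual_measurable) auto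
    show "(\<lambda>x i. residual n xs x i) \<in> space (borel_Rn n) \<rightarrow> (\<Pi>\<^sub>E i\<in>{..<n}. space borel)"
      using residual_in_Rn[of n xs] by (auto simp: Rn_def)
  qed
  have coord: "(\<lambda>x. x i) \<in> borel_measurable (borel_Rn n)" if "i < n" for i
    using that by simp
  have "M \<in> borel_Rn n \<rightarrow>\<^sub>M borel_Rn n"
  proof -
    have [measurable]: "(\<lambda>y. N (residual n xs y) i) \<in> borel_measurable (borel_Rn n)" if "i < n" for i
      using measurable_compose[OF measurable_compose[OF res_meas N(1)] coord[OF that]] .
    have [measurable]: "(\<lambda>y. residual n xs y i) \<in> borel_measurable (borel_Rn n)" if "i < n" for i
      using measurable_compose[OF res_meas coord[OF that]] .
    have [measurable]: "(\<lambda>y. vsub n y (residual n xs y) i) \<in> borel_measurable (borel_Rn n)" if "i < n" for i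
      using that by (simp add: vsub_def)
    show ?thesis unfolding M_def by measurable
  qed
  then have "projected_nn_estimator n K P M"
    unfolding projected_nn_estimator_def estimators_def SK P using N(2) by (auto simp: M_def intro!: exI[of _ N])
  moreover have "\<exists>\<theta> u. (\<Sum>j<p. \<bar>\<theta> j\<bar> powr q) \<le> 2 \<and> (\<Sum>j<p. \<bar>\<theta> j\<bar>) \<le> 2 \<and> u = mat_vec n p Z \<theta> \<and>
      vsub n (M (vadd n y g)) y = vadd n (vsub n g (residual n xs g)) u \<and> vinner n u u \<le> 2 * vinner n u g"
    if y: "y \<in> K" and g: "g \<in> Rn n" for y g
  proof -
    let ?r = "residual n xs"
    define w where "w = N (?r (vadd n y g))"
    have near: "w \<in> S" "\<And>v. v \<in> S \<Longrightarrow> vnorm n (vsub n w (?r (vadd n y g))) \<le> vnorm n (vsub n v (?r (vadd n y g)))"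
      using N(2)[of "?r (vadd n y g)"] by (auto simp: nearest_point_def is_arg_min_def not_less w_def)
    obtain a b where a: "a \<in> lq_ball p q" "w = mat_vec n p Z a" and b: "b \<in> lq_ball p q" "y = mat_vec n p X b"
      using near(1) y by (auto simp: S_def K_def)
    define u where "u = vsub n w (?r y)"
    have u: "u = mat_vec n p Z (\<lambda>j. a j - b j)"
      unfolding u_def a(2) b(2) rX by (auto simp: mat_vec_def vsub_def algebra_simps sum_subtractf)
    \<comment> \<open>Two bounds on \<open>a - b\<close> are extracted: the \<open>q\<close>-sum for
      \<open>sparse_error_bound\<close> and the absolute sum for
      \<open>estimable_diameter\<close>.\<close>
    have a1: "(\<Sum>j<p. \<bar>a j\<bar> powr q) \<le> 1" and b1: "(\<Sum>j<p. \<bar>b j\<bar> powr q) \<le> 1"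
      using a(1) b(1) by (auto simp: lq_ball_def lq_norm_le_1_iff[OF q(1)])
    have "(\<Sum>j<p. \<bar>a j - b j\<bar> powr q) \<le> (\<Sum>j<p. \<bar>a j\<bar> powr q + \<bar>b j\<bar> powr q)"
      by (intro sum_mono abs_diff_powr_le q)
    then have 1: "(\<Sum>j<p. \<bar>a j - b j\<bar> powr q) \<le> 2" using a1 b1 by (simp add: sum.distrib)
    have l1: "(\<Sum>j<p. \<bar>c j\<bar>) \<le> 1" if "(\<Sum>j<p. \<bar>c j\<bar> powr q) \<le> 1" for c :: "nat \<Rightarrow> real"
    proof -
      have "(\<Sum>j<p. \<bar>c j\<bar>) \<le> (\<Sum>j<p. \<bar>c j\<bar> powr q)"
        using lq_ball_coordinate_le_1[OF q(1) that] q by (intro sum_mono powr_le_one_mult) auto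
      then show ?thesis using that by linarith
    qed
    have "(\<Sum>j<p. \<bar>a j - b j\<bar>) \<le> (\<Sum>j<p. \<bar>a j\<bar> + \<bar>b j\<bar>)" by (intro sum_mono) auto
    then have 2: "(\<Sum>j<p. \<bar>a j - b j\<bar>) \<le> 2" using l1[OF a1] l1[OF b1] by (simp add: sum.distrib)
    have yR: "y \<in> Rn n" using b(2) by simp
    have 3: "vsub n (M (vadd n y g)) y = vadd n (vsub n g (?r g)) u"
    proof -
      have "M (vadd n y g) = vadd n (vsub n (vadd n y g) (?r (vadd n y g))) w" by (simp only: M_def w_def)
      then show ?thesis
        by (intro Rn_eqI[where n = n]) (simp_all add: u_def residual_linear, simp_all add: vsub_def vadd_def)
    qed
    have "?r y \<in> S" using b by (auto simp: S_def rX)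
    then have "(vnorm n (vsub n w (?r (vadd n y g))))\<^sup>2 \<le> (vnorm n (vsub n (?r y) (?r (vadd n y g))))\<^sup>2"
      by (intro power_mono near) auto
    \<comment> \<open>The comparison becomes that of \<open>u - ?r g\<close> with
      \<open>- ?r g\<close>; expanding the squares cancels the noise term. As
      \<open>?r u = u\<close>, the residual of \<open>g\<close> may be replaced by
      \<open>g\<close>.\<close>
    moreover have "vsub n w (?r (vadd n y g)) = vsub n u (?r g)"
      by (rule Rn_eqI[where n = n]) (simp_all add: u_def residual_linear, simp_all add: vsub_def vadd_def)
    moreover have "vsub n (?r y) (?r (vadd n y g)) = vscale n (-1) (?r g)"
      by (rule Rn_eqI[where n = n]) (simp_all add: residual_linear, simp_all add: vsub_def vadd_def vscale_def)
    ultimately have "vinner n u u \<le> 2 * vinner n u (?r g)"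
      using vinner_commute[of n u "?r g"] by (simp add: vnorm_power2)
    moreover have "vinner n u (?r g) = vinner n u g"
    proof -
      have "?r u = u" unfolding u_def a(2) rX[symmetric] residual_linear residual_idem ..
      then show ?thesis by (metis residual_self_adjoint)
    qed
    ultimately show ?thesis using 1 2 3 u by (intro exI[of _ "\<lambda>j. a j - b j"] exI[of _ u]) simp
  qed
  ultimately show ?thesis using P(1) unfolding Z_def by blast
qed

section \<open>Comparison of upper and lower bounds\<close>

lemma residual_noise_second_moment:
  "(\<integral>\<^sup>+g. ennreal (vinner n (vsub n g (residual n xs g)) (vsub n g (residual n xs g))) \<partial>gaussian n \<sigma>)
    \<le> ennreal (real (length xs) * \<sigma>\<^sup>2)"
proof -
  obtain es where es: "length es \<le> length xs" "\<And>e. e \<in> set es \<Longrightarrow> vinner n e e \<le> 1"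
    "\<And>x. vinner n (vsub n x (residual n xs x)) (vsub n x (residual n xs x)) = (\<Sum>e\<leftarrow>es. (vinner n x e)\<^sup>2)"
    using residual_complement_norm[of xs n] by metis
  have "(\<integral>\<^sup>+g. ennreal (\<Sum>e\<leftarrow>es. (vinner n g e)\<^sup>2) \<partial>gaussian n \<sigma>) \<le> ennreal (real (length es) * \<sigma>\<^sup>2)"
    using es(2)
  proof (induction es)
    case (Cons e es)
    have "(\<integral>\<^sup>+g. ennreal (\<Sum>e\<leftarrow>e # es. (vinner n g e)\<^sup>2) \<partial>gaussian n \<sigma>) =
      (\<integral>\<^sup>+g. ennreal ((vinner n e g)\<^sup>2) + ennreal (\<Sum>e\<leftarrow>es. (vinner n g e)\<^sup>2) \<partial>gaussian n \<sigma>)"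
    proof (intro nn_integral_cong)
      fix g
      have "0 \<le> (\<Sum>e\<leftarrow>es. (vinner n g e)\<^sup>2)" by (rule sum_list_nonneg) auto
      then show "ennreal (\<Sum>e\<leftarrow>e # es. (vinner n g e)\<^sup>2) = ennreal ((vinner n e g)\<^sup>2) + ennreal (\<Sum>e\<leftarrow>es. (vinner n g e)\<^sup>2)"
        by (simp add: vinner_commute[of n g e] ennreal_plus)
    qed
    also have "\<dots> = (\<integral>\<^sup>+g. ennreal ((vinner n e g)\<^sup>2) \<partial>gaussian n \<sigma>) + (\<integral>\<^sup>+g. ennreal (\<Sum>e\<leftarrow>es. (vinner n g e)\<^sup>2) \<partial>gaussian n \<sigma>)"
    proof (rule nn_integral_add)
      have "(\<lambda>g. \<Sum>e\<leftarrow>es. (vinner n g e)\<^sup>2) \<in> borel_measurable (gaussian n \<sigma>)"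
        by (induction es) (simp_all, measurable)
      then show "(\<lambda>g. ennreal (\<Sum>e\<leftarrow>es. (vinner n g e)\<^sup>2)) \<in> borel_measurable (gaussian n \<sigma>)" by measurable
    qed measurable
    also have "\<dots> \<le> ennreal (\<sigma>\<^sup>2) + ennreal (real (length es) * \<sigma>\<^sup>2)"
      using Cons.IH Cons.prems mult_left_mono[of "vinner n e e" 1 "\<sigma>\<^sup>2"]
      unfolding gaussian_second_moment by (intro add_mono ennreal_leI) auto
    also have "\<dots> = ennreal (real (length (e # es)) * \<sigma>\<^sup>2)"
      by (simp add: ennreal_plus[symmetric] algebra_simps del: ennreal_plus)
    finally show ?case .
  qed simp
  also have "\<dots> \<le> ennreal (real (length xs) * \<sigma>\<^sup>2)"
    using es(1) by (intro ennreal_leI mult_right_mono) auto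
  finally show ?thesis unfolding es(3) .
qed

lemma vinner_add_le: "vinner n (vadd n a b) (vadd n a b) \<le> 2 * vinner n a a + 2 * vinner n b b"
proof -
  have "0 \<le> vinner n (vsub n a b) (vsub n a b)" by (rule vinner_self_nonneg)
  then show ?thesis by simp
qed

lemma residual_Nil: "g \<in> Rn n \<Longrightarrow> residual n [] g = g"
  by (rule Rn_eqI[OF residual_in_Rn]) simp_all

section \<open>Risk bounds in the separate regimes\<close>

definition estimable ::
  "nat \<Rightarrow> nat \<Rightarrow> (nat \<Rightarrow> nat \<Rightarrow> real) \<Rightarrow> real \<Rightarrow> real \<Rightarrow> ennreal \<Rightarrow> bool" where
  "estimable n p X q s r \<longleftrightarrow> (let K = mat_vec n p X ` lq_ball p q in
     \<exists>P M. linear_subspace n P \<and> projected_nn_estimator n K P M \<and> risk n M K s \<le> r)"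

context
  fixes n p :: nat and X :: "nat \<Rightarrow> nat \<Rightarrow> real" and q :: real
  assumes q: "0 < q" "q \<le> 1" and p: "2 \<le> p"
begin

text \<open>The sparse bound divides by \<open>\<sigma>\<^sup>2\<close>, so zero noise is separate.
  Cauchy-Schwarz turns the basic inequality into a squared error of at most
  \<open>4 * vinner n g g\<close>, whose mean is 0.\<close>

lemma estimable_noiseless: "estimable n p X q 0 0"
proof -
  let ?K = "mat_vec n p X ` lq_ball p q"
  obtain P M where PM: "linear_subspace n P" "projected_nn_estimator n ?K P M"
    and M: "\<And>y g. y \<in> ?K \<Longrightarrow> g \<in> Rn n \<Longrightarrow> \<exists>\<theta> u. (\<Sum>j<p. \<bar>\<theta> j\<bar> powr q) \<le> 2 \<and> (\<Sum>j<p. \<bar>\<theta> j\<bar>) \<le> 2 \<and>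
      u = mat_vec n p (\<lambda>i j. residual n [] (\<lambda>i. X i j) i) \<theta> \<and>
      vsub n (M (vadd n y g)) y = vadd n (vsub n g (residual n [] g)) u \<and> vinner n u u \<le> 2 * vinner n u g"
    using projected_nn_estimator_exists[OF q, where xs = "[]" and n = n and p = p and X = X] by metis
  have "err n M y 0 \<le> 0" if y: "y \<in> ?K" for y
  proof -
    have "err n M y 0 \<le> (\<integral>\<^sup>+g. (\<Sum>i<n. 4 * ennreal ((vinner n (\<lambda>j. if j = i then 1 else 0) g)\<^sup>2)) \<partial>gaussian n 0)"
      unfolding err_def
    proof (intro nn_integral_mono)
      fix g assume "g \<in> space (gaussian n 0)"
      then have g: "g \<in> Rn n" by simp
      obtain u where u: "vsub n (M (vadd n y g)) y = vadd n (vsub n g (residual n [] g)) u" "vinner n u u \<le> 2 * vinner n u g"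
        using M[OF y g] by blast
      have "vinner n u u \<le> 4 * vinner n g g"
      proof (cases "vinner n u u = 0")
        case False
        then have pos: "0 < vinner n u u" using vinner_self_nonneg[of n u] by linarith
        have "(vinner n u u)\<^sup>2 \<le> (2 * vinner n u g)\<^sup>2" using u(2) by (intro power_mono) auto
        also have "\<dots> \<le> 4 * (vinner n u u * vinner n g g)" using vinner_Cauchy_Schwarz[of n u g] by (simp add: power_mult_distrib)
        finally show ?thesis using pos by (simp add: power2_eq_square)
      qed simp
      moreover have "vinner n (\<lambda>j. if j = i then 1 else 0) g = g i" if "i < n" for i
        using that by (simp add: vinner_def if_distrib[of "\<lambda>a. a * _"] cong: if_cong)
      then have "4 * vinner n g g = (\<Sum>i<n. 4 * (vinner n (\<lambda>j. if j = i then 1 else 0) g)\<^sup>2)"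
        by (simp add: vinner_def[of n g] sum_distrib_left power2_eq_square)
      moreover have "vinner n (vsub n (M (vadd n y g)) y) (vsub n (M (vadd n y g)) y) = vinner n u u"
        unfolding u(1) residual_Nil[OF g] by simp
      ultimately have "ennreal ((vnorm n (vsub n (M (vadd n y g)) y))\<^sup>2) \<le> ennreal (\<Sum>i<n. 4 * (vinner n (\<lambda>j. if j = i then 1 else 0) g)\<^sup>2)"
        unfolding vnorm_power2 by (intro ennreal_leI) linarith
      also have "\<dots> = (\<Sum>i<n. 4 * ennreal ((vinner n (\<lambda>j. if j = i then 1 else 0) g)\<^sup>2))"
        by (subst sum_ennreal[symmetric]) (simp_all add: ennreal_mult)
      finally show "ennreal ((vnorm n (vsub n (M (vadd n y g)) y))\<^sup>2) \<le> (\<Sum>i<n. 4 * ennreal ((vinner n (\<lambda>j. if j = i then 1 else 0) g)\<^sup>2))" .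
    qed
    also have "\<dots> = 0"
      by (subst nn_integral_sum, measurable) (simp add: nn_integral_cmult gaussian_second_moment)
    finally show ?thesis .
  qed
  then have "risk n M ?K 0 \<le> 0" unfolding risk_def by (rule SUP_least)
  then show ?thesis using PM unfolding estimable_def Let_def by blast
qed

text \<open>Separating projected noise from nearest neighbour error doubles both. As
  \<open>W\<close> has mean at most 3, the constants are \<open>48 = 2 * 8 * 3\<close> and
  \<open>68 = 2 * 34\<close>.\<close>

lemma estimable_projection:
  assumes \<sigma>: "0 < \<sigma>" and L: "0 < L"
    and xs: "\<And>j. j < p \<Longrightarrow> vinner n (residual n xs (\<lambda>i. X i j)) (residual n xs (\<lambda>i. X i j)) \<le> (L * \<sigma>)\<^sup>2"
  shows "estimable n p X q \<sigma> (ennreal (\<sigma>\<^sup>2 * (2 * real (length xs) + 48 + 68 * (L powr q * (3 / q * ln p) powr (1 - q / 2)))))"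
proof -
  let ?K = "mat_vec n p X ` lq_ball p q"
  define Z where "Z = (\<lambda>i j. residual n xs (\<lambda>i. X i j) i)"
  define B where "B = L powr q * (3 / q * ln p) powr (1 - q / 2)"
  have B: "0 \<le> B" by (simp add: B_def)
  obtain P M where PM: "linear_subspace n P" "projected_nn_estimator n ?K P M"
    and M: "\<And>y g. y \<in> ?K \<Longrightarrow> g \<in> Rn n \<Longrightarrow> \<exists>\<theta> u. (\<Sum>j<p. \<bar>\<theta> j\<bar> powr q) \<le> 2 \<and> (\<Sum>j<p. \<bar>\<theta> j\<bar>) \<le> 2 \<and>
      u = mat_vec n p Z \<theta> \<and>
      vsub n (M (vadd n y g)) y = vadd n (vsub n g (residual n xs g)) u \<and> vinner n u u \<le> 2 * vinner n u g"
    using projected_nn_estimator_exists[OF q, where xs = xs and n = n and p = p and X = X] unfolding Z_def by metis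
  have Zcol: "vinner n (\<lambda>i. Z i j) (\<lambda>i. Z i j) \<le> (L * \<sigma>)\<^sup>2" if "j < p" for j
    using xs[OF that] by (simp add: Z_def)
  obtain W where W: "W \<in> borel_measurable (gaussian n \<sigma>)" "(\<integral>\<^sup>+g. ennreal (W g) \<partial>gaussian n \<sigma>) \<le> 3" "\<And>g. 0 \<le> W g"
    "\<And>\<theta> g u. (\<Sum>j<p. \<bar>\<theta> j\<bar> powr q) \<le> 2 \<Longrightarrow> u = mat_vec n p Z \<theta> \<Longrightarrow> vinner n u u \<le> 2 * vinner n u g \<Longrightarrow>
      vinner n u u \<le> \<sigma>\<^sup>2 * (8 * W g + 34 * B)"
    using sparse_error_bound[where Z = Z, OF q p \<sigma> L Zcol] unfolding B_def by blast
  let ?V = "\<lambda>g. vinner n (vsub n g (residual n xs g)) (vsub n g (residual n xs g))"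
  have V_meas: "?V \<in> borel_measurable (gaussian n \<sigma>)"
  proof -
    have [measurable]: "(\<lambda>g. residual n xs g i) \<in> borel_measurable (gaussian n \<sigma>)" if "i < n" for i
      using that by (intro residual_measurable) auto
    show ?thesis by measurable
  qed
  have "err n M y \<sigma> \<le> ennreal (\<sigma>\<^sup>2 * (2 * real (length xs) + 48 + 68 * B))" if y: "y \<in> ?K" for y
  proof -
    have "err n M y \<sigma> \<le> (\<integral>\<^sup>+g. 2 * ennreal (?V g) + (ennreal (16 * \<sigma>\<^sup>2) * ennreal (W g) + ennreal (68 * \<sigma>\<^sup>2 * B)) \<partial>gaussian n \<sigma>)"
      unfolding err_def
    proof (intro nn_integral_mono)
      fix g assume "g \<in> space (gaussian n \<sigma>)"
      then have g: "g \<in> Rn n" by simp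
      obtain \<theta> u where u: "(\<Sum>j<p. \<bar>\<theta> j\<bar> powr q) \<le> 2" "u = mat_vec n p Z \<theta>"
        "vsub n (M (vadd n y g)) y = vadd n (vsub n g (residual n xs g)) u" "vinner n u u \<le> 2 * vinner n u g"
        using M[OF y g] by blast
      have "(vnorm n (vsub n (M (vadd n y g)) y))\<^sup>2 \<le> 2 * ?V g + 2 * vinner n u u"
        unfolding vnorm_power2 u(3) by (rule vinner_add_le)
      also have "\<dots> \<le> 2 * ?V g + (16 * \<sigma>\<^sup>2 * W g + 68 * \<sigma>\<^sup>2 * B)"
        using W(4)[OF u(1,2,4)] by (simp add: algebra_simps del: vinner_linear)
      finally have "ennreal ((vnorm n (vsub n (M (vadd n y g)) y))\<^sup>2) \<le> ennreal (2 * ?V g + (16 * \<sigma>\<^sup>2 * W g + 68 * \<sigma>\<^sup>2 * B))"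
        by (rule ennreal_leI)
      also have "\<dots> = 2 * ennreal (?V g) + (ennreal (16 * \<sigma>\<^sup>2) * ennreal (W g) + ennreal (68 * \<sigma>\<^sup>2 * B))"
        using B W(3)[of g] vinner_self_nonneg[of n "vsub n g (residual n xs g)"]
        by (simp add: ennreal_plus ennreal_mult del: vinner_linear)
      finally show "ennreal ((vnorm n (vsub n (M (vadd n y g)) y))\<^sup>2) \<le>
        2 * ennreal (?V g) + (ennreal (16 * \<sigma>\<^sup>2) * ennreal (W g) + ennreal (68 * \<sigma>\<^sup>2 * B))" .
    qed
    also have "\<dots> = 2 * (\<integral>\<^sup>+g. ennreal (?V g) \<partial>gaussian n \<sigma>) +
        (ennreal (16 * \<sigma>\<^sup>2) * (\<integral>\<^sup>+g. ennreal (W g) \<partial>gaussian n \<sigma>) + ennreal (68 * \<sigma>\<^sup>2 * B))"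
      using V_meas W(1) prob_space.emeasure_space_1[OF prob_space_gaussian[of n \<sigma>]]
      by (simp add: nn_integral_add nn_integral_cmult del: vinner_linear)
    also have "\<dots> \<le> 2 * ennreal (real (length xs) * \<sigma>\<^sup>2) + (ennreal (16 * \<sigma>\<^sup>2) * ennreal 3 + ennreal (68 * \<sigma>\<^sup>2 * B))"
      using W(2) by (intro add_mono mult_left_mono residual_noise_second_moment) auto
    also have "\<dots> = ennreal (2 * (real (length xs) * \<sigma>\<^sup>2)) + (ennreal (16 * \<sigma>\<^sup>2 * 3) + ennreal (68 * \<sigma>\<^sup>2 * B))"
    proof -
      have "2 * ennreal x = ennreal (2 * x)" if "0 \<le> x" for x using that by (simp add: ennreal_mult)
      moreover have "ennreal (16 * \<sigma>\<^sup>2) * ennreal 3 = ennreal (16 * \<sigma>\<^sup>2 * 3)" by (rule ennreal_mult[symmetric]) auto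
      ultimately show ?thesis by (simp only: zero_le_mult_iff of_nat_0_le_iff zero_le_power2 simp_thms)
    qed
    also have "\<dots> = ennreal (2 * (real (length xs) * \<sigma>\<^sup>2) + (16 * \<sigma>\<^sup>2 * 3 + 68 * \<sigma>\<^sup>2 * B))"
      using B by (simp del: ennreal_plus add: ennreal_plus[symmetric])
    also have "\<dots> = ennreal (\<sigma>\<^sup>2 * (2 * real (length xs) + 48 + 68 * B))" by (simp add: algebra_simps)
    finally show ?thesis .
  qed
  then have "risk n M ?K \<sigma> \<le> ennreal (\<sigma>\<^sup>2 * (2 * real (length xs) + 48 + 68 * B))" unfolding risk_def by (rule SUP_least)
  then show ?thesis using PM unfolding estimable_def Let_def B_def by blast
qed

text \<open>With \<open>xs = []\<close> the error is a combination of columns of length at most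
  \<open>sqrt e\<close> whose coefficients have absolute sum at most 2, whatever the noise. This is
  the relevant bound when \<open>K\<close> is small compared with the noise.\<close>

lemma estimable_diameter:
  assumes e: "\<And>j. j < p \<Longrightarrow> vinner n (\<lambda>i. X i j) (\<lambda>i. X i j) \<le> e"
  shows "estimable n p X q \<sigma> (ennreal (4 * e))"
proof -
  let ?K = "mat_vec n p X ` lq_ball p q"
  define Z where "Z = (\<lambda>i j. residual n [] (\<lambda>i. X i j) i)"
  obtain P M where PM: "linear_subspace n P" "projected_nn_estimator n ?K P M"
    and M: "\<And>y g. y \<in> ?K \<Longrightarrow> g \<in> Rn n \<Longrightarrow> \<exists>\<theta> u. (\<Sum>j<p. \<bar>\<theta> j\<bar> powr q) \<le> 2 \<and> (\<Sum>j<p. \<bar>\<theta> j\<bar>) \<le> 2 \<and>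
      u = mat_vec n p Z \<theta> \<and>
      vsub n (M (vadd n y g)) y = vadd n (vsub n g (residual n [] g)) u \<and> vinner n u u \<le> 2 * vinner n u g"
    using projected_nn_estimator_exists[OF q, where xs = "[]" and n = n and p = p and X = X] unfolding Z_def by metis
  have e0: "0 \<le> e" using e[of 0] p vinner_self_nonneg[of n "\<lambda>i. X i 0"] by linarith
  have "err n M y \<sigma> \<le> ennreal (4 * e)" if y: "y \<in> ?K" for y
  proof -
    have "err n M y \<sigma> \<le> (\<integral>\<^sup>+g. ennreal (4 * e) \<partial>gaussian n \<sigma>)"
      unfolding err_def
    proof (intro nn_integral_mono ennreal_leI)
      fix g assume "g \<in> space (gaussian n \<sigma>)"
      then have g: "g \<in> Rn n" by simp
      obtain \<theta> u where u: "(\<Sum>j<p. \<bar>\<theta> j\<bar>) \<le> 2" "u = mat_vec n p Z \<theta>"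
        "vsub n (M (vadd n y g)) y = vadd n (vsub n g (residual n [] g)) u"
        using M[OF y g] by blast
      define a where "a = vnorm n u"
      have "a\<^sup>2 = (\<Sum>j<p. \<theta> j * vinner n (\<lambda>i. Z i j) u)"
        unfolding a_def vnorm_power2 by (subst (1) u(2)) (rule vinner_mat_vec)
      also have "\<dots> \<le> (\<Sum>j<p. \<bar>\<theta> j\<bar> * (sqrt e * a))"
      proof (rule sum_mono)
        fix j assume j: "j \<in> {..<p}"
        have "(vinner n (\<lambda>i. Z i j) u)\<^sup>2 \<le> e * a\<^sup>2"
        proof -
          have "vinner n (\<lambda>i. Z i j) (\<lambda>i. Z i j) \<le> vinner n (\<lambda>i. X i j) (\<lambda>i. X i j)"
            unfolding Z_def by (rule residual_mono)
          also have "\<dots> \<le> e" using e j by simp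
          finally show ?thesis
            unfolding a_def vnorm_power2 by (intro order_trans[OF vinner_Cauchy_Schwarz] mult_right_mono) auto
        qed
        then have "sqrt ((vinner n (\<lambda>i. Z i j) u)\<^sup>2) \<le> sqrt (e * a\<^sup>2)" by (rule real_sqrt_le_mono)
        then have "\<bar>vinner n (\<lambda>i. Z i j) u\<bar> \<le> sqrt e * a" by (simp add: real_sqrt_mult a_def)
        then show "\<theta> j * vinner n (\<lambda>i. Z i j) u \<le> \<bar>\<theta> j\<bar> * (sqrt e * a)"
          using mult_left_mono[of "\<bar>vinner n (\<lambda>i. Z i j) u\<bar>" "sqrt e * a" "\<bar>\<theta> j\<bar>"]
            abs_ge_self[of "\<theta> j * vinner n (\<lambda>i. Z i j) u"] unfolding abs_mult by linarith
      qed
      also have "\<dots> = (\<Sum>j<p. \<bar>\<theta> j\<bar>) * (sqrt e * a)" by (simp add: sum_distrib_right)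
      also have "\<dots> \<le> 2 * (sqrt e * a)" using u(1) e0 by (intro mult_right_mono) (auto simp: a_def)
      finally have "a * a \<le> (2 * sqrt e) * a" by (simp add: power2_eq_square)
      then have "a \<le> 2 * sqrt e" using e0 by (cases "a = 0") (auto simp: a_def order_less_le)
      then have "a\<^sup>2 \<le> (2 * sqrt e)\<^sup>2" by (intro power_mono) (auto simp: a_def)
      then have "vinner n u u \<le> 4 * e" using e0 by (simp add: a_def vnorm_power2 power_mult_distrib)
      then show "(vnorm n (vsub n (M (vadd n y g)) y))\<^sup>2 \<le> 4 * e"
        unfolding u(3) residual_Nil[OF g] vnorm_power2 by simp
    qed
    also have "\<dots> = ennreal (4 * e)" using prob_space.emeasure_space_1[OF prob_space_gaussian[of n \<sigma>]] by simp
    finally show ?thesis .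
  qed
  then have "risk n M ?K \<sigma> \<le> ennreal (4 * e)" unfolding risk_def by (rule SUP_least)
  then show ?thesis using PM unfolding estimable_def Let_def by blast
qed

text \<open>The factor \<open>1 / q\<close> in \<open>E\<close> stems from \<kappa>, by
  \<open>(3 / q) powr (1 - q / 2) \<le> 3 / q\<close>; it is at most \<open>c_const q\<close>
  because \<open>2 powr (1 / q) * ln (2 / q)\<close> is at least \<open>2 * ln 2\<close>. The bound
  \<open>2 / 3 \<le> E\<close> absorbs additive constants.\<close>

lemma rate_bounds:
  defines "E \<equiv> 1 / q * ln p powr (1 - q / 2)"
  shows "E \<le> c_const q * ln p powr (1 - q / 2)" "2 / 3 \<le> E" "(3 / q * ln p) powr (1 - q / 2) \<le> 3 * E"
proof -
  have "ln 2 \<le> ln (real p)" using p by simp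
  then have lnp: "2 / 3 \<le> ln (real p)" using ln2_ge_two_thirds by linarith
  have "2 powr 1 \<le> 2 powr (1 / q)" using q by (intro powr_mono) auto
  moreover have "ln 2 \<le> ln (2 / q)" using q by (intro ln_mono) (auto simp: field_simps)
  ultimately have "2 * (2 / 3) \<le> 2 powr (1 / q) * ln (2 / q)"
    using ln2_ge_two_thirds by (intro mult_mono) auto
  then have "1 / q * 1 \<le> 1 / q * (2 powr (1 / q) * ln (2 / q))" using q by (intro mult_left_mono) auto
  then have "1 / q \<le> c_const q" by (simp add: c_const_def mult_ac)
  then show "E \<le> c_const q * ln p powr (1 - q / 2)" unfolding E_def by (intro mult_right_mono) auto
  have "2 / 3 \<le> ln p powr (1 - q / 2)"
  proof (cases "ln (real p) \<le> 1")
    case True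
    then show ?thesis using powr_le_one_mult[of "ln p" "1 - q / 2"] lnp q by linarith
  next
    case False
    then show ?thesis using ge_one_powr_ge_zero[of "ln p" "1 - q / 2"] q by simp
  qed
  moreover have "1 \<le> 1 / q" using q by simp
  ultimately have "1 * (2 / 3) \<le> 1 / q * ln p powr (1 - q / 2)" using q by (intro mult_mono) auto
  then show "2 / 3 \<le> E" unfolding E_def mult_1 .
  have "(3 / q) powr (1 - q / 2) \<le> (3 / q) powr 1" using q by (intro powr_mono) auto
  then have "(3 / q) powr (1 - q / 2) * ln p powr (1 - q / 2) \<le> 3 / q * ln p powr (1 - q / 2)"
    using q by (intro mult_right_mono) auto
  then show "(3 / q * ln p) powr (1 - q / 2) \<le> 3 * E"
    using q lnp unfolding E_def by (subst powr_mult) (auto simp: mult_ac)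
qed

lemma estimable_minimax:
  assumes \<sigma>: "0 \<le> \<sigma>"
  shows "estimable n p X q \<sigma> (ennreal (11000 * c_const q * ln p powr (1 - q / 2)) * minimax_risk n (mat_vec n p X ` lq_ball p q) \<sigma>)"
proof -
  let ?R = "minimax_risk n (mat_vec n p X ` lq_ball p q) \<sigma>"
  define E where "E = 1 / q * ln p powr (1 - q / 2)"
  note rb = rate_bounds[folded E_def]
  \<comment> \<open>\<open>11000 = 500 * 22\<close>, where 500 comes from the upper bound and 22
    from the lower bound for \<open>1 \<le> k\<close>.\<close>
  have concl: ?thesis if "estimable n p X q \<sigma> (ennreal u)" "ennreal l \<le> ?R" "u \<le> 11000 * E * l" "0 \<le> l" for u l
  proof -
    have "u \<le> (11000 * c_const q * ln p powr (1 - q / 2)) * l"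
      using that(3) mult_right_mono[OF rb(1) that(4)] by (simp add: mult.assoc)
    then have "ennreal u \<le> ennreal (11000 * c_const q * ln p powr (1 - q / 2)) * ennreal l"
      using that(4) rb(1,2) by (subst ennreal_mult[symmetric]) (auto intro!: ennreal_leI simp: mult.assoc)
    also have "\<dots> \<le> ennreal (11000 * c_const q * ln p powr (1 - q / 2)) * ?R"
      by (intro mult_left_mono that(2)) auto
    finally show ?thesis using that(1) unfolding estimable_def Let_def by (meson order_trans)
  qed
  show ?thesis
  proof (cases "\<sigma> = 0")
    case True
    then show ?thesis using estimable_noiseless concl[of 0 0] by simp
  next
    case False
    then have \<sigma>: "0 < \<sigma>" using \<sigma> by simp
    define \<delta> where "\<delta> k = real k powr (1 / q) * \<sigma>" for k
    obtain js xs where js: "spread_columns n p (\<lambda>j i. X i j) (\<delta> (length js)) js"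
      and xs: "length xs = length js"
      "\<And>l. l < p \<Longrightarrow> vinner n (residual n xs (\<lambda>i. X i l)) (residual n xs (\<lambda>i. X i l)) \<le> (\<delta> (Suc (length js)))\<^sup>2"
      using exists_spread_columns[of n p "\<lambda>j i. X i j" \<delta>] by blast
    define k where "k = length js"
    show ?thesis
    proof (cases "js = []")
      case False
      then have k: "1 \<le> real k" by (cases js) (auto simp: k_def)
      define L where "L = real (Suc k) powr (1 / q)"
      have L: "0 < L" "L powr q = real k + 1" using q by (simp_all add: L_def powr_powr)
      define h where "h = real k powr (- 1 / q)"
      have \<delta>h: "0 < \<delta> k" "0 < h" "h * \<delta> k = \<sigma>"
        using k \<sigma> by (auto simp: \<delta>_def h_def powr_add[symmetric])
      then have \<delta>k: "\<delta> k = \<sigma> / h" by (simp add: field_simps)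
      \<comment> \<open>The threshold equals \<open>\<sigma> / h\<close>, so the prior's term is 10
        times the noise's term, and \<open>2 * (1 + 10) = 22\<close>.\<close>
      have "real k * h\<^sup>2 / (2 * (h\<^sup>2 / \<sigma>\<^sup>2 + 10 / (\<delta> k)\<^sup>2)) = real k * \<sigma>\<^sup>2 / 22"
        unfolding \<delta>k using \<sigma> \<delta>h(2) by (simp add: field_simps power2_eq_square)
      moreover have "ennreal (real k * h\<^sup>2 / (2 * (h\<^sup>2 / \<sigma>\<^sup>2 + 10 / (\<delta> k)\<^sup>2))) \<le> ?R"
        unfolding k_def h_def using js False \<delta>h(1)[unfolded k_def] \<sigma> q(1) by (rule minimax_risk_lower_bound)
      ultimately have lower: "ennreal (real k * \<sigma>\<^sup>2 / 22) \<le> ?R" by (simp only:)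
      have upper: "estimable n p X q \<sigma> (ennreal (\<sigma>\<^sup>2 * (2 * real (length xs) + 48 + 68 * (L powr q * (3 / q * ln p) powr (1 - q / 2)))))"
        using xs(2) by (intro estimable_projection \<sigma> L) (simp add: \<delta>_def L_def k_def)
      have "L powr q * (3 / q * ln p) powr (1 - q / 2) \<le> (2 * real k) * (3 * E)"
        using k rb(3) L by (intro mult_mono) auto
      also have "\<dots> = 6 * (E * real k)" by simp
      finally have "L powr q * (3 / q * ln p) powr (1 - q / 2) \<le> 6 * (E * real k)" .
      moreover have "2 / 3 * real k \<le> E * real k" using rb(2) k by (intro mult_right_mono) auto
      \<comment> \<open>In units of \<open>E * real k\<close>, the three terms are at most 3, 72 and
        \<open>68 * 6 = 408\<close>, where \<open>L powr q = k + 1 \<le> 2 * k\<close> was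
        used.\<close>
      ultimately have "2 * real k + 48 + 68 * (L powr q * (3 / q * ln p) powr (1 - q / 2)) \<le> 500 * (E * real k)"
        using k by linarith
      then have "\<sigma>\<^sup>2 * (2 * real k + 48 + 68 * (L powr q * (3 / q * ln p) powr (1 - q / 2))) \<le> \<sigma>\<^sup>2 * (500 * (E * real k))"
        by (rule mult_left_mono) simp
      then show ?thesis using upper unfolding xs(1) k_def[symmetric]
        by (intro concl[OF _ lower]) (auto simp: mult_ac)
    next
      case True
      let ?e = "\<lambda>l. vinner n (\<lambda>i. X i l) (\<lambda>i. X i l)"
      have "xs = []" using xs True by simp
      then have e\<sigma>: "?e l \<le> \<sigma>\<^sup>2" if "l < p" for l using xs(2)[OF that] True by (simp add: \<delta>_def)
      obtain m where m: "m < p" "\<And>l. l < p \<Longrightarrow> ?e l \<le> ?e m"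
      proof -
        have "Max (?e ` {..<p}) \<in> ?e ` {..<p}" using p by (intro Max_in) (auto simp: lessThan_empty_iff)
        then obtain m where "m < p" "?e m = Max (?e ` {..<p})" by auto
        then show ?thesis using that[of m] by auto
      qed
      have upper: "estimable n p X q \<sigma> (ennreal (4 * ?e m))" using m(2) by (rule estimable_diameter)
      show ?thesis
      proof (cases "?e m = 0")
        case True
        then show ?thesis using upper by (intro concl[of _ 0]) auto
      next
        case False
        then have pos: "0 < ?e m" using vinner_self_nonneg[of n "\<lambda>i. X i m"] by linarith
        \<comment> \<open>The lower bound is applied to the longest column alone, with its own
          length as \<open>D\<close> and \<open>h = 1\<close>. Since
          \<open>?e m \<le> \<sigma>\<^sup>2\<close>, the result is at least
          \<open>?e m / 22\<close>.\<close>
        have "spread_columns n p (\<lambda>j i. X i j) (sqrt (?e m)) [m]"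
          using m(1) pos by (simp add: spread_columns_def)
        then have lower: "ennreal (1 / (2 * (1 / \<sigma>\<^sup>2 + 10 / ?e m))) \<le> ?R"
          using minimax_risk_lower_bound[of n p X "sqrt (?e m)" "[m]" \<sigma> q] pos \<sigma> q by simp
        have "1 / \<sigma>\<^sup>2 \<le> 1 / ?e m" using e\<sigma>[OF m(1)] pos \<sigma> by (intro divide_left_mono) auto
        then have "2 * (1 / \<sigma>\<^sup>2 + 10 / ?e m) \<le> 2 * (1 / ?e m + 10 / ?e m)" by simp
        also have "\<dots> = 22 * (1 / ?e m)" by simp
        finally have "2 * (1 / \<sigma>\<^sup>2 + 10 / ?e m) \<le> 22 * (1 / ?e m)" .
        then have "1 / (22 * (1 / ?e m)) \<le> 1 / (2 * (1 / \<sigma>\<^sup>2 + 10 / ?e m))"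
          using pos \<sigma> by (intro divide_left_mono mult_pos_pos add_pos_pos) auto
        then have l: "?e m / 22 \<le> 1 / (2 * (1 / \<sigma>\<^sup>2 + 10 / ?e m))" by simp
        have "4 * ?e m \<le> 11000 * (2 / 3) * (?e m / 22)" using pos by simp
        also have "\<dots> \<le> 11000 * E * (1 / (2 * (1 / \<sigma>\<^sup>2 + 10 / ?e m)))"
          using rb(2) l pos by (intro mult_mono) auto
        finally show ?thesis using pos by (intro concl[OF upper lower]) auto
      qed
    qed
  qed
qed

end

theorem theorem1:
  "\<exists>A>0. \<forall>(n::nat) (p::nat) (X :: nat \<Rightarrow> nat \<Rightarrow> real) (q::real) (\<sigma>::real).
     1 \<le> n \<longrightarrow> n \<le> p \<longrightarrow> 2 \<le> p \<longrightarrow> 0 < q \<longrightarrow> q \<le> 1 \<longrightarrow> 0 \<le> \<sigma> \<longrightarrow>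
     (let K = mat_vec n p X ` lq_ball p q in
        \<exists>P M. linear_subspace n P \<and> projected_nn_estimator n K P M \<and>
          risk n M K \<sigma>
            \<le> ennreal (A * c_const q * ln (real p) powr (1 - q / 2)) * minimax_risk n K \<sigma>)"
  using estimable_minimax unfolding estimable_def by (intro exI[of _ 11000] conjI allI impI) simp_all

end
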